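(* Let $X=\mathbb C^n$. For any $z_0^*\in\dot T^*X$, the inclusions $\mathfrak S_{z_0^*}\subset\widehat{\mathfrak S}_{{\rm cl},z_0^*}\subset\widehat{\mathfrak S}_{z_0^*}$ and $\mathfrak N_{z_0^*}\subset\widehat{\mathfrak N}_{{\rm cl},z_0^*}\subset\widehat{\mathfrak N}_{z_0^*}$ induce isomorphisms $$\mathfrak S_{z_0^*}/\mathfrak N_{z_0^*}\xrightarrow{\ \sim\ }\widehat{\mathfrak S}_{{\rm cl},z_0^*}/\widehat{\mathfrak N}_{{\rm cl},z_0^*}\xrightarrow{\ \sim\ }\widehat{\mathfrak S}_{z_0^*}/\widehat{\mathfrak N}_{z_0^*}.$$
   Context: $\|z\|=\max_i|z_i|$; $\dot T^*X$ is $T^*X=\{(z;\zeta)\}$ minus the zero section. For an open conic $\varOmega\subset T^*X$ and $\rho\ge0$, $\varOmega_\rho$ is the closure of $\bigcup_{(z;\zeta)\in\varOmega}\{(z+z';\zeta+\zeta');\ \|z'\|\le\rho,\ \|\zeta'\|\le\rho\|\zeta\|\}$; $V[d]=\{(z;\zeta)\in V;\ \|\zeta\|\ge d\}$; $d_\rho=d(1-\rho)$; $S=\{\eta\in\mathbb C;\ 0<|\eta|<r,\ |\arg\eta|<\theta/4\}$ with $r,\theta\in]0,\frac12[$; for $U\subset S$, $(\varOmega_\rho*U)[md_\rho]=\{(z;\zeta,\eta)\in\varOmega_\rho\times U;\ \|\eta\zeta\|\ge md_\rho\}$. Functions on these sets are understood to be holomorphic on neighborhoods of them; $t$ is an indeterminate.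 In each definition $d>0$ and $\rho\in]0,1[$ are some constants depending on $P$. $\mathfrak N(\varOmega;S)$: functions $P(z,\zeta,\eta)$ holomorphic on $\varOmega_\rho[d_\rho]\times S$ for which there is $\delta>0$ such that for every $Z\Subset S$ there is $C_Z>0$ with $|P|\le C_Ze^{-\delta\|\eta\zeta\|}$ on $\varOmega_\rho[d_\rho]\times Z$. $\mathfrak S(\varOmega;S)$: functions $P$ holomorphic on $\varOmega_\rho[d_\rho]\times S$ with $\partial_\eta P\in\mathfrak N(\varOmega;S)$ such that for every $h>0$, $Z\Subset S$ there is $C_{h,Z}>0$ with $|P|\le C_{h,Z}e^{h\|\zeta\|}$ on $\varOmega_\rho[d_\rho]\times Z$. $\widehat{\mathfrak N}_{\rm cl}(\varOmega;S)$: formal series $P=\sum_{\nu\ge0}t^\nu P_\nu$, $P_\nu$ holomorphic on $\varOmega_\rho[d_\rho]\times S$, for which there is $A>0$ such that for every $Z\Subset S$, $h>0$ there is $C_{h,Z}>0$ with $|\sum_{\nu=0}^{m-1}P_\nu|\le C_{h,Z}\,m!\,A^me^{h\|\zeta\|}/\|\eta\zeta\|^m$ ($m\in\mathbb N$) on $\varOmega_\rho[d_\rho]\times Z$. $\widehat{\mathfrak S}_{\rm cl}(\varOmega;S)$: formal series $P=\sum t^\nu P_\nu$, $P_\nu$ holomorphic on $\varOmega_\rho[d_\rho]\times S$, for which there is $A>0$ such that for every $Z\Subset S$, $h>0$ there is $C_{h,Z}>0$ with $|P_\nu|\le C_{h,Z}\,\nu!\,A^\nu e^{h\|\zeta\|}/\|\eta\zeta\|^\nu$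 ($\nu\ge0$) on $\varOmega_\rho[d_\rho]\times Z$, and $\partial_\eta P\in\widehat{\mathfrak N}_{\rm cl}(\varOmega;S)$. $\widehat{\mathfrak N}(\varOmega;S)$: formal series $P=\sum t^\nu P_\nu$, $P_\nu$ holomorphic on $(\varOmega_\rho*S)[(\nu+1)d_\rho]$, for which there is $A\in]0,1[$ such that for every $Z\Subset S$, $h>0$ there is $C_{h,Z}>0$ with $|\sum_{\nu=0}^{m-1}P_\nu|\le C_{h,Z}A^me^{h\|\zeta\|}$ ($m\in\mathbb N$) on $(\varOmega_\rho*Z)[md_\rho]$. $\widehat{\mathfrak S}(\varOmega;S)$: formal series $P=\sum t^\nu P_\nu$, $P_\nu$ holomorphic on $(\varOmega_\rho*S)[(\nu+1)d_\rho]$, for which there is $A\in]0,1[$ such that for every $Z\Subset S$, $h>0$ there is $C_{h,Z}>0$ with $|P_\nu|\le C_{h,Z}A^\nu e^{h\|\zeta\|}$ ($\nu\ge0$) on $(\varOmega_\rho*Z)[(\nu+1)d_\rho]$, and $\partial_\eta P\in\widehat{\mathfrak N}(\varOmega;S)$. The objects with index $z_0^*$ are the inductive limits over open conic neighborhoods $\varOmega$ of $z_0^*$ (relatively compact in $T^*X$ modulo $\mathbb R_{>0}$) and over $r,\theta\to0$. A function is regarded as a formal series concentrated in degree $0$ in $t$. *)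

theory Defs
  imports
    "HOL-Analysis.Analysis"
    "HOL-Computational_Algebra.Formal_Power_Series"
    "HOL-Library.Function_Algebras"
    "HOL-Algebra.Module"
    "HOL-Algebra.AbelCoset"
begin

section \<open>Linear algebra over the complex numbers\<close>

definition complex_ring :: "complex ring" where
  "complex_ring = \<lparr>carrier = UNIV, mult = (*), one = 1, zero = 0, add = (+)\<rparr>"

definition linear_maps ::
    "('r, 'q) ring_scheme \<Rightarrow> ('r, 'a, 'm) module_scheme \<Rightarrow> ('r, 'b, 'k) module_scheme \<Rightarrow> ('a \<Rightarrow> 'b) set" where
  "linear_maps R M N = {f \<in> hom (add_monoid M) (add_monoid N).
     \<forall>a\<in>carrier R. \<forall>x\<in>carrier M. f (a \<odot>\<^bsub>M\<^esub> x) = a \<odot>\<^bsub>N\<^esub> f x}"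

definition linear_isos ::
    "('r, 'q) ring_scheme \<Rightarrow> ('r, 'a, 'm) module_scheme \<Rightarrow> ('r, 'b, 'k) module_scheme \<Rightarrow> ('a \<Rightarrow> 'b) set" where
  "linear_isos R M N = {f \<in> linear_maps R M N. bij_betw f (carrier M) (carrier N)}"

text \<open>The quotient module by a submodule \<open>H\<close>; its elements are the additive cosets of \<open>H\<close>.
  The multiplicative fields of a module record carry no information. The union in the scalar
  multiplication (and in \<open>induced_map\<close>) is over the representatives \<open>x\<close> of a coset, which all
  contribute the same coset.\<close>

definition quotient_module :: "('r, 'a, 'm) module_scheme \<Rightarrow> 'a set \<Rightarrow> ('r, 'a set) module" where
  "quotient_module M H =
     \<lparr>carrier = a_rcosets\<^bsub>M\<^esub> H, mult = undefined, one = undefined, zero = H,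
      add = set_add M, smult = (\<lambda>a X. \<Union>x\<in>X. H +>\<^bsub>M\<^esub> (a \<odot>\<^bsub>M\<^esub> x))\<rparr>"

text \<open>The map from a quotient of \<open>M\<close> to the quotient of \<open>M'\<close> by \<open>H'\<close> that is induced by
  \<open>f\<close>.\<close>

definition induced_map :: "('r, 'b, 'm) module_scheme \<Rightarrow> 'b set \<Rightarrow> ('a \<Rightarrow> 'b) \<Rightarrow> 'a set \<Rightarrow> 'b set" where
  "induced_map M' H' f X = (\<Union>x\<in>X. H' +>\<^bsub>M'\<^esub> f x)"


section \<open>Cones, sectors and domains\<close>

text \<open>\<open>T\<^sup>*X\<close> for \<open>X = \<complex>\<^sup>n\<close> is the type of pairs \<open>(z, \<zeta>)\<close>; symbols are
  functions of \<open>(z, \<zeta>, \<eta>)\<close>. They are total functions whose values outside the relevant domains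
  are irrelevant. A formal series in \<open>t\<close> is a formal power series whose coefficients lie in the
  ring of functions.\<close>

type_synonym 'n cotangent = "(complex^'n) \<times> (complex^'n)"
type_synonym 'n point = "(complex^'n) \<times> (complex^'n) \<times> complex"
type_synonym 'n symb = "'n point \<Rightarrow> complex"
type_synonym 'n series = "'n symb fps"

text \<open>The library norm on \<open>complex^'n\<close> is the Euclidean one.\<close>

definition maxnorm :: "complex^'n \<Rightarrow> real" where
  "maxnorm z = Max (range (\<lambda>i. cmod (z $ i)))"

definition fibre_conic :: "'n::finite cotangent set \<Rightarrow> bool" where
  "fibre_conic \<Omega> \<longleftrightarrow> (\<forall>z \<zeta>. \<forall>c>0. (z, \<zeta>) \<in> \<Omega> \<longrightarrow> (z, c *\<^sub>R \<zeta>) \<in> \<Omega>)"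

definition relcompact_mod_scaling :: "'n::finite cotangent set \<Rightarrow> bool" where
  "relcompact_mod_scaling \<Omega> \<longleftrightarrow>
     (\<exists>K. compact K \<and> (\<forall>(z, \<zeta>)\<in>\<Omega>. \<exists>c>0. (z, c *\<^sub>R \<zeta>) \<in> K))"

definition conic_nhds :: "'n::finite cotangent \<Rightarrow> 'n cotangent set set" where
  "conic_nhds z0 = {\<Omega>. open \<Omega> \<and> fibre_conic \<Omega> \<and> relcompact_mod_scaling \<Omega> \<and> z0 \<in> \<Omega>}"

definition thicken :: "'n::finite cotangent set \<Rightarrow> real \<Rightarrow> 'n cotangent set" where
  "thicken \<Omega> \<rho> = closure {(z + z', \<zeta> + \<zeta>') | z \<zeta> z' \<zeta>'.
     (z, \<zeta>) \<in> \<Omega> \<and> maxnorm z' \<le> \<rho> \<and> maxnorm \<zeta>' \<le> \<rho> * maxnorm \<zeta>}"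

definition sector :: "real \<Rightarrow> real \<Rightarrow> complex set" where
  "sector r \<theta> = {\<eta>. 0 < cmod \<eta> \<and> cmod \<eta> < r \<and> \<bar>Arg \<eta>\<bar> < \<theta> / 4}"

definition sectors :: "complex set set" where
  "sectors = {sector r \<theta> | r \<theta>. 0 < r \<and> r < 1/2 \<and> 0 < \<theta> \<and> \<theta> < 1/2}"

definition rel_compact_in :: "complex set \<Rightarrow> complex set \<Rightarrow> bool" where
  "rel_compact_in Z S \<longleftrightarrow> compact (closure Z) \<and> closure Z \<subseteq> S"

text \<open>\<open>dom_prod \<Omega> U d \<rho>\<close> is \<open>\<Omega>\<^sub>\<rho>[d\<^sub>\<rho>] \<times> U\<close> and
  \<open>dom_star \<Omega> U d \<rho> m\<close> is \<open>(\<Omega>\<^sub>\<rho> * U)[m d\<^sub>\<rho>]\<close>,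
  where \<open>d\<^sub>\<rho> = d (1 - \<rho>)\<close>.\<close>

definition dom_prod :: "'n::finite cotangent set \<Rightarrow> complex set \<Rightarrow> real \<Rightarrow> real \<Rightarrow> 'n point set" where
  "dom_prod \<Omega> U d \<rho> =
     {(z, \<zeta>, \<eta>). (z, \<zeta>) \<in> thicken \<Omega> \<rho> \<and> maxnorm \<zeta> \<ge> d * (1 - \<rho>) \<and> \<eta> \<in> U}"

definition dom_star :: "'n::finite cotangent set \<Rightarrow> complex set \<Rightarrow> real \<Rightarrow> real \<Rightarrow> nat \<Rightarrow> 'n point set" where
  "dom_star \<Omega> U d \<rho> m =
     {(z, \<zeta>, \<eta>). (z, \<zeta>) \<in> thicken \<Omega> \<rho> \<and> \<eta> \<in> U \<and> maxnorm (\<eta> *s \<zeta>) \<ge> real m * (d * (1 - \<rho>))}"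

text \<open>Holomorphy in several variables on some neighbourhood of \<open>A\<close>: complex Frechet
  differentiability.\<close>

definition holomorphic_near :: "'n::finite symb \<Rightarrow> 'n point set \<Rightarrow> bool" where
  "holomorphic_near P A \<longleftrightarrow> (\<exists>W. open W \<and> A \<subseteq> W \<and>
     (\<forall>p\<in>W. \<exists>D. (P has_derivative D) (at p) \<and>
        (\<forall>c z \<zeta> \<eta>. D (c *s z, c *s \<zeta>, c * \<eta>) = c * D (z, \<zeta>, \<eta>))))"

definition d_eta :: "'n symb \<Rightarrow> 'n symb" where
  "d_eta P = (\<lambda>(z, \<zeta>, \<eta>). deriv (\<lambda>w. P (z, \<zeta>, w)) \<eta>)"

definition series_d_eta :: "'n series \<Rightarrow> 'n series" where
  "series_d_eta P = Abs_fps (\<lambda>\<nu>. d_eta (fps_nth P \<nu>))"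


section \<open>Symbols and null symbols on a cone and a sector\<close>

definition null_symbols :: "'n::finite cotangent set \<Rightarrow> complex set \<Rightarrow> 'n symb set" where
  "null_symbols \<Omega> S = {P. \<exists>d>0. \<exists>\<rho>. 0 < \<rho> \<and> \<rho> < 1 \<and>
     holomorphic_near P (dom_prod \<Omega> S d \<rho>) \<and>
     (\<exists>\<delta>>0. \<forall>Z. rel_compact_in Z S \<longrightarrow> (\<exists>C>0.
        \<forall>(z, \<zeta>, \<eta>)\<in>dom_prod \<Omega> Z d \<rho>.
          cmod (P (z, \<zeta>, \<eta>)) \<le> C * exp (- \<delta> * maxnorm (\<eta> *s \<zeta>))))}"

definition symbols :: "'n::finite cotangent set \<Rightarrow> complex set \<Rightarrow> 'n symb set" where
  "symbols \<Omega> S = {P. d_eta P \<in> null_symbols \<Omega> S \<and> (\<exists>d>0. \<exists>\<rho>. 0 < \<rho> \<and> \<rho> < 1 \<and>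
     holomorphic_near P (dom_prod \<Omega> S d \<rho>) \<and>
     (\<forall>h>0. \<forall>Z. rel_compact_in Z S \<longrightarrow> (\<exists>C>0.
        \<forall>(z, \<zeta>, \<eta>)\<in>dom_prod \<Omega> Z d \<rho>.
          cmod (P (z, \<zeta>, \<eta>)) \<le> C * exp (h * maxnorm \<zeta>))))}"

definition cl_null_symbols :: "'n::finite cotangent set \<Rightarrow> complex set \<Rightarrow> 'n series set" where
  "cl_null_symbols \<Omega> S = {P. \<exists>d>0. \<exists>\<rho>. 0 < \<rho> \<and> \<rho> < 1 \<and>
     (\<forall>\<nu>. holomorphic_near (fps_nth P \<nu>) (dom_prod \<Omega> S d \<rho>)) \<and>
     (\<exists>A>0. \<forall>Z. \<forall>h>0. rel_compact_in Z S \<longrightarrow> (\<exists>C>0. \<forall>m.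
        \<forall>(z, \<zeta>, \<eta>)\<in>dom_prod \<Omega> Z d \<rho>.
          cmod (\<Sum>\<nu><m. fps_nth P \<nu> (z, \<zeta>, \<eta>))
            \<le> C * fact m * A ^ m * exp (h * maxnorm \<zeta>) / maxnorm (\<eta> *s \<zeta>) ^ m))}"

definition cl_symbols :: "'n::finite cotangent set \<Rightarrow> complex set \<Rightarrow> 'n series set" where
  "cl_symbols \<Omega> S = {P. series_d_eta P \<in> cl_null_symbols \<Omega> S \<and> (\<exists>d>0. \<exists>\<rho>. 0 < \<rho> \<and> \<rho> < 1 \<and>
     (\<forall>\<nu>. holomorphic_near (fps_nth P \<nu>) (dom_prod \<Omega> S d \<rho>)) \<and>
     (\<exists>A>0. \<forall>Z. \<forall>h>0. rel_compact_in Z S \<longrightarrow> (\<exists>C>0. \<forall>\<nu>.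
        \<forall>(z, \<zeta>, \<eta>)\<in>dom_prod \<Omega> Z d \<rho>.
          cmod (fps_nth P \<nu> (z, \<zeta>, \<eta>))
            \<le> C * fact \<nu> * A ^ \<nu> * exp (h * maxnorm \<zeta>) / maxnorm (\<eta> *s \<zeta>) ^ \<nu>)))}"

definition formal_null_symbols :: "'n::finite cotangent set \<Rightarrow> complex set \<Rightarrow> 'n series set" where
  "formal_null_symbols \<Omega> S = {P. \<exists>d>0. \<exists>\<rho>. 0 < \<rho> \<and> \<rho> < 1 \<and>
     (\<forall>\<nu>. holomorphic_near (fps_nth P \<nu>) (dom_star \<Omega> S d \<rho> (\<nu> + 1))) \<and>
     (\<exists>A. 0 < A \<and> A < 1 \<and> (\<forall>Z. \<forall>h>0. rel_compact_in Z S \<longrightarrow> (\<exists>C>0. \<forall>m.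
        \<forall>(z, \<zeta>, \<eta>)\<in>dom_star \<Omega> Z d \<rho> m.
          cmod (\<Sum>\<nu><m. fps_nth P \<nu> (z, \<zeta>, \<eta>)) \<le> C * A ^ m * exp (h * maxnorm \<zeta>))))}"

definition formal_symbols :: "'n::finite cotangent set \<Rightarrow> complex set \<Rightarrow> 'n series set" where
  "formal_symbols \<Omega> S = {P. series_d_eta P \<in> formal_null_symbols \<Omega> S \<and> (\<exists>d>0. \<exists>\<rho>. 0 < \<rho> \<and> \<rho> < 1 \<and>
     (\<forall>\<nu>. holomorphic_near (fps_nth P \<nu>) (dom_star \<Omega> S d \<rho> (\<nu> + 1))) \<and>
     (\<exists>A. 0 < A \<and> A < 1 \<and> (\<forall>Z. \<forall>h>0. rel_compact_in Z S \<longrightarrow> (\<exists>C>0. \<forall>\<nu>.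
        \<forall>(z, \<zeta>, \<eta>)\<in>dom_star \<Omega> Z d \<rho> (\<nu> + 1).
          cmod (fps_nth P \<nu> (z, \<zeta>, \<eta>)) \<le> C * A ^ \<nu> * exp (h * maxnorm \<zeta>)))))}"


section \<open>Inductive limits at a point\<close>

text \<open>Two objects have the same germ when they agree on the domain belonging to some smaller
  cone and sector and some \<open>d\<close>, \<open>\<rho>\<close>. All these domains shrink when \<open>\<Omega>\<close>, \<open>r\<close>, \<open>\<theta>\<close>,
  \<open>\<rho>\<close> decrease and \<open>d\<close> increases, so the system is directed.\<close>

definition symb_germ_eq :: "'n::finite cotangent \<Rightarrow> 'n symb \<Rightarrow> 'n symb \<Rightarrow> bool" where
  "symb_germ_eq z0 P Q \<longleftrightarrow> (\<exists>\<Omega>\<in>conic_nhds z0. \<exists>S\<in>sectors. \<exists>d>0. \<exists>\<rho>. 0 < \<rho> \<and> \<rho> < 1 \<and>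
     (\<forall>p\<in>dom_prod \<Omega> S d \<rho>. P p = Q p))"

definition cl_germ_eq :: "'n::finite cotangent \<Rightarrow> 'n series \<Rightarrow> 'n series \<Rightarrow> bool" where
  "cl_germ_eq z0 P Q \<longleftrightarrow> (\<exists>\<Omega>\<in>conic_nhds z0. \<exists>S\<in>sectors. \<exists>d>0. \<exists>\<rho>. 0 < \<rho> \<and> \<rho> < 1 \<and>
     (\<forall>\<nu>. \<forall>p\<in>dom_prod \<Omega> S d \<rho>. fps_nth P \<nu> p = fps_nth Q \<nu> p))"

definition formal_germ_eq :: "'n::finite cotangent \<Rightarrow> 'n series \<Rightarrow> 'n series \<Rightarrow> bool" where
  "formal_germ_eq z0 P Q \<longleftrightarrow> (\<exists>\<Omega>\<in>conic_nhds z0. \<exists>S\<in>sectors. \<exists>d>0. \<exists>\<rho>. 0 < \<rho> \<and> \<rho> < 1 \<and>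
     (\<forall>\<nu>. \<forall>p\<in>dom_star \<Omega> S d \<rho> (\<nu> + 1). fps_nth P \<nu> p = fps_nth Q \<nu> p))"

definition germ :: "('f \<Rightarrow> 'f \<Rightarrow> bool) \<Rightarrow> 'f \<Rightarrow> 'f set" where
  "germ E P = {Q. E P Q}"

text \<open>The germs are classes in the type of all functions (or series), not just in the space of
  representatives, so that the limit of a subsystem is literally a subset of the limit.\<close>

definition germs_at ::
    "'n::finite cotangent \<Rightarrow> ('f \<Rightarrow> 'f \<Rightarrow> bool) \<Rightarrow> ('n cotangent set \<Rightarrow> complex set \<Rightarrow> 'f set) \<Rightarrow> 'f set set" where
  "germs_at z0 E F = germ E ` (\<Union>\<Omega>\<in>conic_nhds z0. \<Union>S\<in>sectors. F \<Omega> S)"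

definition germ_module ::
    "('f::ab_group_add \<Rightarrow> 'f \<Rightarrow> bool) \<Rightarrow> (complex \<Rightarrow> 'f \<Rightarrow> 'f) \<Rightarrow> 'f set set \<Rightarrow> (complex, 'f set) module" where
  "germ_module E sc G =
     \<lparr>carrier = G, mult = undefined, one = undefined, zero = germ E 0,
      add = (\<lambda>X Y. \<Union>P\<in>X. \<Union>Q\<in>Y. germ E (P + Q)),
      smult = (\<lambda>c X. \<Union>P\<in>X. germ E (sc c P))\<rparr>"

text \<open>The map of germs induced by a map \<open>\<phi>\<close> of representatives; \<open>E\<close> is the germ relation on
  the target.\<close>

definition germ_map :: "('g \<Rightarrow> 'g \<Rightarrow> bool) \<Rightarrow> ('f \<Rightarrow> 'g) \<Rightarrow> 'f set \<Rightarrow> 'g set" where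
  "germ_map E \<phi> X = (\<Union>P\<in>X. germ E (\<phi> P))"

definition symb_scale :: "complex \<Rightarrow> 'n symb \<Rightarrow> 'n symb" where
  "symb_scale c P = (\<lambda>p. c * P p)"

definition series_scale :: "complex \<Rightarrow> 'n series \<Rightarrow> 'n series" where
  "series_scale c P = Abs_fps (\<lambda>\<nu>. symb_scale c (fps_nth P \<nu>))"

definition Symb :: "'n::finite cotangent \<Rightarrow> (complex, 'n symb set) module" where
  "Symb z0 = germ_module (symb_germ_eq z0) symb_scale (germs_at z0 (symb_germ_eq z0) symbols)"

definition Null :: "'n::finite cotangent \<Rightarrow> 'n symb set set" where
  "Null z0 = germs_at z0 (symb_germ_eq z0) null_symbols"

definition Symb_cl :: "'n::finite cotangent \<Rightarrow> (complex, 'n series set) module" where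
  "Symb_cl z0 = germ_module (cl_germ_eq z0) series_scale (germs_at z0 (cl_germ_eq z0) cl_symbols)"

definition Null_cl :: "'n::finite cotangent \<Rightarrow> 'n series set set" where
  "Null_cl z0 = germs_at z0 (cl_germ_eq z0) cl_null_symbols"

definition Symb_formal :: "'n::finite cotangent \<Rightarrow> (complex, 'n series set) module" where
  "Symb_formal z0 =
     germ_module (formal_germ_eq z0) series_scale (germs_at z0 (formal_germ_eq z0) formal_symbols)"

definition Null_formal :: "'n::finite cotangent \<Rightarrow> 'n series set set" where
  "Null_formal z0 = germs_at z0 (formal_germ_eq z0) formal_null_symbols"

text \<open>The inclusions: a function is a series concentrated in degree 0, and a classical series is
  restricted to the smaller domains.\<close>

definition incl_cl :: "'n::finite cotangent \<Rightarrow> 'n symb set \<Rightarrow> 'n series set" where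
  "incl_cl z0 = germ_map (cl_germ_eq z0) fps_const"

definition incl_formal :: "'n::finite cotangent \<Rightarrow> 'n series set \<Rightarrow> 'n series set" where
  "incl_formal z0 = germ_map (formal_germ_eq z0) (\<lambda>P. P)"

end

theory Submission
  imports Defs "HOL-Complex_Analysis.Complex_Analysis"
begin

text \<open>
  Write \<open>S, S\<^sub>c\<^sub>l, S\<^sub>f\<close> for the germs of symbols, classical formal symbols and formal symbols, and
  \<open>N, N\<^sub>c\<^sub>l, N\<^sub>f\<close> for the corresponding null germs. Everything follows from the chains of inclusions
  and two facts.

  (1) A symbol that is formally null is null: \<open>S \<inter> N\<^sub>f = N\<close> and \<open>S\<^sub>c\<^sub>l \<inter> N\<^sub>f = N\<^sub>c\<^sub>l\<close>
  (\<open>symbol_formally_null\<close>, \<open>cl_symbol_formally_null\<close>). A formal null series has partial sums of size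
  \<open>A\<^sup>m\<close> where \<open>\<parallel>\<eta> \<zeta>\<parallel> \<ge> m D\<close>. Choosing \<open>m\<close> as the integer part of \<open>\<parallel>\<eta> \<zeta>\<parallel> / D\<close> turns this into
  exponential decay in \<open>\<parallel>\<eta> \<zeta>\<parallel>\<close>. For a function this is the estimate of \<open>N\<close>, since the factor \<open>exp (h
  \<parallel>\<zeta>\<parallel>)\<close> is absorbed on relatively compact subsets of the sector. For a classical series a shorter
  partial sum differs from the optimally truncated one by terms of size \<open>\<nu>! A\<^sup>\<nu> / \<parallel>\<eta> \<zeta>\<parallel>\<^sup>\<nu>\<close> that
  decrease geometrically, and a longer one is estimated term by term.

  (2) \<open>S\<^sub>f = S + N\<^sub>f\<close> (\<open>formal_symbol_resummed\<close>). Fix a point \<open>\<eta>\<^sub>0\<close> of the sector. It suffices to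
  find a function \<open>q(z, \<zeta>)\<close>, independent of \<open>\<eta>\<close>, that is approximated geometrically by the partial
  sums of the series at \<open>\<eta>\<^sub>0\<close>: the partial sums at another \<open>\<eta>\<close> differ from those at \<open>\<eta>\<^sub>0\<close> by the
  integral of the partial sums of the \<open>\<eta>\<close>-derivative, which is null. The function \<open>q\<close> is constructed
  in the locale \<open>resummation\<close>. Let \<open>\<tau>\<close> be a normalised coordinate of \<open>\<zeta>\<close>, with positive real part
  near the given covector. The term \<open>p\<^sub>\<nu>\<close> is defined where \<open>Re \<tau>\<close> is at least of the order of \<open>R\<^sub>\<nu> =
  2 (\<nu> + 1) D\<close>. Represent it near \<open>Re \<tau> = R\<^sub>\<nu>\<close> by Cauchy's integral of \<open>p\<^sub>\<nu> exp (\<delta> (\<sigma> - \<tau>))\<close> over a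
  circle of radius \<open>\<epsilon> R\<^sub>\<nu>\<close> in the complex line through \<open>\<zeta>\<close>. The integral over the right arc
  continues analytically to all smaller \<open>Re \<tau>\<close>, and \<open>p\<^sub>\<nu>\<close> minus the integral over the left arc
  continues to all larger \<open>Re \<tau>\<close>; they agree in between and define a function \<open>q\<^sub>\<nu>\<close> on the whole
  cone. The first is of size \<open>e\<^sup>\<nu>\<close> with some \<open>e < 1\<close>, and where \<open>Re \<tau> \<ge> R\<^sub>\<nu>\<close> the difference \<open>q\<^sub>\<nu> -
  p\<^sub>\<nu>\<close> decays exponentially in \<open>Re \<tau>\<close> because of the factor \<open>exp (\<delta> (\<sigma> - \<tau>))\<close>. So \<open>q = \<Sum> q\<^sub>\<nu>\<close> does
  what is needed.

  Now (1) gives the injectivity of both maps of quotients, (2) the surjectivity of the second one,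
  and (2) followed by (1), applied to the difference of a classical symbol and the function attached
  to it, the surjectivity of the first one. The injectivity of the restriction of classical germs to
  the smaller domains of formal symbols is the identity theorem along the rays \<open>t \<mapsto> (z, t \<zeta>, \<eta>)\<close>.
\<close>


section \<open>Holomorphic functions of several variables\<close>

text \<open>The complex scalar multiplication on points \<open>(z, \<zeta>, \<eta>)\<close>.\<close>

definition point_scale :: "complex \<Rightarrow> 'n::finite point \<Rightarrow> 'n point" where
  "point_scale c p = (c *s fst p, c *s fst (snd p), c * snd (snd p))"

text \<open>Complex Frechet differentiability at a point; the derivative is real linear by definition and
  commutes with complex scalars.\<close>

definition holo_at :: "'n::finite symb \<Rightarrow> 'n point \<Rightarrow> bool" where
  "holo_at f p \<longleftrightarrow> (\<exists>D. (f has_derivative D) (at p) \<and> (\<forall>c v. D (point_scale c v) = c * D v))"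

lemma holomorphic_near_iff:
  "holomorphic_near P A \<longleftrightarrow> (\<exists>W. open W \<and> A \<subseteq> W \<and> (\<forall>p\<in>W. holo_at P p))"
proof -
  have "(\<forall>c z \<zeta> \<eta>. D (c *s z, c *s \<zeta>, c * \<eta>) = c * D (z, \<zeta>, \<eta>)) \<longleftrightarrow>
        (\<forall>c v. D (point_scale c v) = c * D v)" for D :: "'a symb"
    by (auto simp: point_scale_def)
  then show ?thesis
    unfolding holomorphic_near_def holo_at_def by simp
qed

lemma norm_vector_smult: "norm (c *s v) = cmod c * norm v" for v :: "complex^'n::finite"
  by (simp add: norm_vec_def norm_mult L2_set_def power_mult_distrib
      sum_distrib_left[symmetric] real_sqrt_mult)

lemma bounded_bilinear_vector_smult: "bounded_bilinear ((*s) :: complex \<Rightarrow> complex^'n::finite \<Rightarrow> _)"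
proof
  show "\<exists>K. \<forall>a b. norm ((a::complex) *s (b::complex^'n)) \<le> norm a * norm b * K"
    by (rule exI[of _ 1]) (simp add: norm_vector_smult)
qed (auto simp: vec_eq_iff algebra_simps)

lemma norm_point_scale: "norm (point_scale c v) = cmod c * norm v"
  by (cases v) (simp add: point_scale_def norm_Pair norm_vector_smult norm_mult power_mult_distrib
      distrib_left[symmetric] real_sqrt_mult)

lemma bounded_bilinear_point_scale: "bounded_bilinear (point_scale :: complex \<Rightarrow> 'n::finite point \<Rightarrow> _)"
proof
  show "\<exists>K. \<forall>a b. norm (point_scale a (b::'n point)) \<le> norm a * norm b * K"
    by (rule exI[of _ 1]) (simp add: norm_point_scale)
qed (auto simp: point_scale_def vec_eq_iff algebra_simps)

lemma point_scale_simps [simp]: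
  "point_scale 0 v = 0" "point_scale 1 v = v"
  by (auto simp: point_scale_def prod_eq_iff)

lemma holo_at_continuous: "holo_at f p \<Longrightarrow> isCont f p"
  unfolding holo_at_def using has_derivative_continuous by blast

lemma holo_at_const [intro!, simp]: "holo_at (\<lambda>_. c) p"
  unfolding holo_at_def by (rule exI[of _ "\<lambda>_. 0"]) auto

lemma holo_at_add: "holo_at f p \<Longrightarrow> holo_at g p \<Longrightarrow> holo_at (\<lambda>x. f x + g x) p"
  unfolding holo_at_def
  apply clarify
  subgoal for D D' by (intro exI[of _ "\<lambda>x. D x + D' x"] conjI has_derivative_add) (simp_all add:
    algebra_simps)
  done

lemma holo_at_sum: "(\<And>i. i \<in> I \<Longrightarrow> holo_at (f i) p) \<Longrightarrow> holo_at (\<lambda>x. \<Sum>i\<in>I. f i x) p"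
  by (induction I rule: infinite_finite_induct) (auto intro: holo_at_add)

lemma holo_at_mult: "holo_at f p \<Longrightarrow> holo_at g p \<Longrightarrow> holo_at (\<lambda>x. f x * g x) p"
  unfolding holo_at_def
  apply clarify
  subgoal for D D'
    by (intro exI[of _ "\<lambda>h. f p * D' h + D h * g p"] conjI has_derivative_mult)
       (simp_all add: algebra_simps)
  done

lemma holo_at_cmult: "holo_at f p \<Longrightarrow> holo_at (\<lambda>x. c * f x) p"
  by (intro holo_at_mult holo_at_const)

lemma holo_at_diff: "holo_at f p \<Longrightarrow> holo_at g p \<Longrightarrow> holo_at (\<lambda>x. f x - g x) p"
  using holo_at_add[of f p "\<lambda>x. -1 * g x"] holo_at_cmult[of g p "-1"] by simp

lemma holo_at_compose_field:
  assumes "holo_at f p" "(g has_field_derivative g') (at (f p))"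
  shows "holo_at (\<lambda>x. g (f x)) p"
proof -
  obtain D where D: "(f has_derivative D) (at p)" "\<And>c v. D (point_scale c v) = c * D v"
    using assms(1) unfolding holo_at_def by blast
  have "((\<lambda>x. g (f x)) has_derivative (\<lambda>x. g' * D x)) (at p)"
    using has_derivative_compose[OF D(1), of g "(*) g'"] assms(2)
    by (simp add: has_field_derivative_def)
  with D(2) show ?thesis unfolding holo_at_def by (intro exI[of _ "\<lambda>x. g' * D x"]) auto
qed

lemma holo_at_compose:
  assumes "(\<Phi> has_derivative D\<Phi>) (at p)" "\<And>c v. D\<Phi> (point_scale c v) = point_scale c (D\<Phi> v)"
    and "holo_at f (\<Phi> p)"
  shows "holo_at (\<lambda>x. f (\<Phi> x)) p"
proof -
  obtain D where D: "(f has_derivative D) (at (\<Phi> p))" "\<And>c v. D (point_scale c v) = c * D v"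
    using assms(3) unfolding holo_at_def by blast
  show ?thesis unfolding holo_at_def
    by (rule exI[of _ "\<lambda>x. D (D\<Phi> x)"]) (use has_derivative_compose[OF assms(1) D(1)] D(2) assms(2)
      in auto)
qed

lemma holo_at_cong:
  assumes "holo_at f p" "open U" "p \<in> U" "\<And>x. x \<in> U \<Longrightarrow> f x = g x"
  shows "holo_at g p"
  using assms(1) has_derivative_transform_within_open[of f _ p UNIV U g] assms(2-4)
  unfolding holo_at_def by blast

text \<open>Restriction to a complex line.\<close>

lemma has_field_derivative_line:
  assumes "(f has_derivative D) (at (p + point_scale \<kappa> v))" "\<And>c v. D (point_scale c v) = c * D v"
  shows "((\<lambda>\<mu>. f (p + point_scale \<mu> v)) has_field_derivative D v) (at \<kappa>)"
proof -
  interpret bounded_bilinear "point_scale :: complex \<Rightarrow> 'a point \<Rightarrow> _"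
    by (rule bounded_bilinear_point_scale)
  have "((\<lambda>\<mu>. p + point_scale \<mu> v) has_derivative (\<lambda>\<mu>. point_scale \<mu> v)) (at \<kappa>)"
    by (auto intro!: derivative_eq_intros bounded_linear_imp_has_derivative bounded_linear_left)
  from has_derivative_compose[OF this assms(1)] show ?thesis
    using assms(2) by (simp add: has_field_derivative_def mult_commute_abs)
qed

lemma holo_at_line:
  assumes "holo_at f (p + point_scale \<kappa> v)"
  shows "(\<lambda>\<mu>. f (p + point_scale \<mu> v)) field_differentiable (at \<kappa>)"
  using assms has_field_derivative_line unfolding holo_at_def field_differentiable_def by blast

lemma d_eta_eq:
  assumes "(P has_derivative D) (at (z, \<zeta>, \<eta>))" "\<And>c v. D (point_scale c v) = c * D v"
  shows "((\<lambda>w. P (z, \<zeta>, w)) has_field_derivative D (0, 0, 1)) (at \<eta>)"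
    and "d_eta P (z, \<zeta>, \<eta>) = D (0, 0, 1)"
proof -
  have eq: "(z, \<zeta>, 0) + point_scale w (0, 0, 1) = (z, \<zeta>, w)" for w
    by (simp add: point_scale_def)
  show 1: "((\<lambda>w. P (z, \<zeta>, w)) has_field_derivative D (0, 0, 1)) (at \<eta>)"
    using has_field_derivative_line[of P D "(z, \<zeta>, 0)" \<eta> "(0, 0, 1)"] assms by (simp add: eq)
  then show "d_eta P (z, \<zeta>, \<eta>) = D (0, 0, 1)"
    by (simp add: d_eta_def DERIV_imp_deriv)
qed

lemma d_eta_has_field_derivative:
  assumes "holo_at P (z, \<zeta>, \<eta>)"
  shows "((\<lambda>w. P (z, \<zeta>, w)) has_field_derivative d_eta P (z, \<zeta>, \<eta>)) (at \<eta>)"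
  using assms d_eta_eq unfolding holo_at_def by metis

lemma d_eta_linear:
  assumes "holo_at P p" "holo_at Q p"
  shows "d_eta (P + Q) p = d_eta P p + d_eta Q p"
proof -
  obtain z \<zeta> \<eta> where p: "p = (z, \<zeta>, \<eta>)" by (cases p)
  show ?thesis
    using DERIV_add[OF d_eta_has_field_derivative d_eta_has_field_derivative] assms
    by (auto simp: p d_eta_def plus_fun_def intro!: DERIV_imp_deriv)
qed

lemma d_eta_scale:
  assumes "holo_at P p"
  shows "d_eta (symb_scale c P) p = c * d_eta P p"
proof -
  obtain z \<zeta> \<eta> where p: "p = (z, \<zeta>, \<eta>)" by (cases p)
  show ?thesis
    using DERIV_cmult[OF d_eta_has_field_derivative, of P z \<zeta> \<eta> c] assms
    by (auto simp: p d_eta_def symb_scale_def intro!: DERIV_imp_deriv)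
qed

lemma d_eta_sum:
  assumes "\<And>i. i \<in> I \<Longrightarrow> holo_at (f i) p"
  shows "d_eta (\<lambda>x. \<Sum>i\<in>I. f i x) p = (\<Sum>i\<in>I. d_eta (f i) p)"
proof -
  obtain z \<zeta> \<eta> where p: "p = (z, \<zeta>, \<eta>)" by (cases p)
  show ?thesis
    unfolding p d_eta_def prod.case
    by (rule DERIV_imp_deriv, rule DERIV_sum)
       (use assms d_eta_has_field_derivative in \<open>force simp: p d_eta_def\<close>)
qed

text \<open>Cauchy's estimate for the total derivative.\<close>

lemma derivative_Cauchy_bound:
  assumes hol: "\<And>x. x \<in> ball p R \<Longrightarrow> holo_at f x" and B: "\<And>x. x \<in> ball p R \<Longrightarrow> cmod (f x) \<le> B"
    and R: "0 < R" and D: "(f has_derivative D) (at p)" "\<And>c v. D (point_scale c v) = c * D v"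
  shows "cmod (D v) \<le> 2 * B / R * norm v"
proof (cases "v = 0")
  case True
  have "D v = 0" using D(2)[of 0 v] True by (simp add: zero_prod_def[symmetric])
  then show ?thesis using True by simp
next
  case False
  define r where "r = R / (2 * norm v)"
  have r: "r > 0" using R False by (simp add: r_def)
  define g where "g = (\<lambda>\<mu>. f (p + point_scale \<mu> v))"
  have in_ball: "p + point_scale \<mu> v \<in> ball p R" if "\<mu> \<in> cball 0 r" for \<mu>
  proof -
    have "cmod \<mu> * norm v \<le> r * norm v" using that by (intro mult_right_mono) auto
    also have "\<dots> < R" using False R by (simp add: r_def)
    finally show ?thesis by (simp add: dist_norm norm_point_scale)
  qed
  have "g field_differentiable (at \<mu>)" if "\<mu> \<in> cball 0 r" for \<mu>
    unfolding g_def using hol[OF in_ball[OF that]] by (rule holo_at_line)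
  then have "g holomorphic_on cball 0 r"
    by (simp add: holomorphic_on_def field_differentiable_at_within)
  then have "norm ((deriv ^^ 1) g 0) \<le> fact 1 * B / r ^ 1"
    by (intro Cauchy_inequality holomorphic_on_imp_continuous_on)
       (use r B[OF in_ball] in \<open>auto intro: holomorphic_on_subset simp: g_def\<close>)
  moreover have "(g has_field_derivative D v) (at 0)"
    unfolding g_def using has_field_derivative_line[of f D p 0 v] D by simp
  ultimately have "cmod (D v) \<le> B / r" by (simp add: DERIV_imp_deriv)
  then show ?thesis using False by (simp add: r_def field_simps)
qed

text \<open>By Cauchy's estimate the derivatives of a uniformly convergent sequence of holomorphic
  functions converge uniformly on a smaller ball.\<close>

lemma holo_at_uniform_limit:
  assumes hol: "\<And>n x. x \<in> ball p R \<Longrightarrow> holo_at (F n) x"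
    and lim: "uniform_limit (ball p R) F f sequentially" and R: "0 < R"
  shows "holo_at f p"
proof -
  let ?S = "ball p (R/2)"
  have "\<forall>n x. \<exists>D. x \<in> ball p R \<longrightarrow> (F n has_derivative D) (at x) \<and> (\<forall>c v. D (point_scale c v) = c * D v)"
    using hol unfolding holo_at_def by blast
  then obtain D where D: "\<And>n x. x \<in> ball p R \<Longrightarrow> (F n has_derivative D n x) (at x)"
      "\<And>n x c v. x \<in> ball p R \<Longrightarrow> D n x (point_scale c v) = c * D n x v"
    by metis
  have sub: "ball x (R/2) \<subseteq> ball p R" if "x \<in> ?S" for x
  proof
    fix y assume "y \<in> ball x (R/2)"
    then show "y \<in> ball p R" using that dist_triangle[of p y x] unfolding mem_ball by linarith
  qed
  have sub': "x \<in> ball p R" if "x \<in> ?S" for x using that R by simp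
  have unif: "\<exists>M. \<forall>m\<ge>M. \<forall>n\<ge>M. \<forall>x\<in>?S. \<forall>h. cmod (D n x h - D m x h) \<le> e * norm h" if e: "e > 0" for e
  proof -
    have "uniformly_Cauchy_on (ball p R) F"
      using lim uniformly_convergent_on_def uniformly_convergent_Cauchy by blast
    then obtain M where M: "\<And>m n x. m \<ge> M \<Longrightarrow> n \<ge> M \<Longrightarrow> x \<in> ball p R \<Longrightarrow> cmod (F n x - F m x) < e * R / 4"
      unfolding uniformly_Cauchy_on_def dist_norm using e R by (meson divide_pos_pos mult_pos_pos
        zero_less_numeral)
    have "cmod (D n x h - D m x h) \<le> e * norm h" if "m \<ge> M" "n \<ge> M" "x \<in> ?S" for m n x h
    proof -
      have "cmod ((\<lambda>h. D n x h - D m x h) h) \<le> 2 * (e * R / 4) / (R/2) * norm h"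
      proof (rule derivative_Cauchy_bound)
        show "holo_at (\<lambda>x. F n x - F m x) y" if "y \<in> ball x (R/2)" for y
          using subsetD[OF sub[OF \<open>x \<in> ?S\<close>] that] by (intro holo_at_diff hol)
        show "cmod (F n y - F m y) \<le> e * R / 4" if "y \<in> ball x (R/2)" for y
          using M[of m n y] \<open>m \<ge> M\<close> \<open>n \<ge> M\<close> subsetD[OF sub[OF \<open>x \<in> ?S\<close>] that] by simp
        show "((\<lambda>x. F n x - F m x) has_derivative (\<lambda>h. D n x h - D m x h)) (at x)"
          using D(1) sub' \<open>x \<in> ?S\<close> by (intro has_derivative_diff) auto
        show "D n x (point_scale c v) - D m x (point_scale c v) = c * (D n x v - D m x v)" for c v
          using D(2) sub' \<open>x \<in> ?S\<close> by (simp add: algebra_simps)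
      qed (use R in auto)
      then show ?thesis using R by simp
    qed
    then show ?thesis by blast
  qed
  have conv: "\<exists>L. (\<lambda>n. D n x h) \<longlonglongrightarrow> L" if "x \<in> ?S" for x h
  proof -
    have "Cauchy (\<lambda>n. D n x h)"
    proof (rule metric_CauchyI)
      fix e :: real assume e: "e > 0"
      have h: "norm h + 1 > 0" by (simp add: add_nonneg_pos)
      then have pos: "e / (norm h + 1) > 0" using e by simp
      from unif[OF pos] obtain M where M0: "\<forall>m\<ge>M. \<forall>n\<ge>M. \<forall>x\<in>?S. \<forall>h'. cmod (D n x h' - D m x h') \<le>
        e / (norm h + 1) * norm h'"
        by (rule exE)
      have M: "cmod (D n x h - D m x h) \<le> e / (norm h + 1) * norm h" if "m \<ge> M" "n \<ge> M" for m n
        using M0[rule_format, OF that \<open>x \<in> ?S\<close>] .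
      have "e / (norm h + 1) * norm h < e"
        using e h by (simp add: divide_simps)
      then show "\<exists>M. \<forall>m\<ge>M. \<forall>n\<ge>M. dist (D m x h) (D n x h) < e"
      proof (intro exI[of _ M] allI impI)
        fix m n assume "M \<le> m" "M \<le> n"
        then show "dist (D m x h) (D n x h) < e"
          using M[of n m] \<open>e / (norm h + 1) * norm h < e\<close> unfolding dist_norm by linarith
      qed
    qed
    then show ?thesis by (simp add: Cauchy_convergent_iff convergent_def)
  qed
  then obtain G where G: "\<And>x h. x \<in> ?S \<Longrightarrow> (\<lambda>n. D n x h) \<longlonglongrightarrow> G x h" by metis
  have p: "p \<in> ?S" using R by simp
  have ev: "\<forall>\<^sub>F n in sequentially. \<forall>x\<in>?S. \<forall>h. norm (D n x h - G x h) \<le> e * norm h" if e: "e > 0" for e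
  proof -
    obtain M where M: "\<And>m n x h. m\<ge>M \<Longrightarrow> n\<ge>M \<Longrightarrow> x\<in>?S \<Longrightarrow> cmod (D n x h - D m x h) \<le> e * norm h"
      using unif[OF e] by blast
    have "norm (D n x h - G x h) \<le> e * norm h" if "n \<ge> M" "x \<in> ?S" for n x h
    proof (rule tendsto_upperbound)
      show "(\<lambda>m. norm (D n x h - D m x h)) \<longlonglongrightarrow> norm (D n x h - G x h)"
        by (intro tendsto_intros G that)
      show "\<forall>\<^sub>F m in sequentially. norm (D n x h - D m x h) \<le> e * norm h"
        using M that eventually_sequentially by blast
    qed simp
    then show ?thesis unfolding eventually_sequentially by blast
  qed
  have Dw: "(F n has_derivative D n x) (at x within ?S)" if "x \<in> ?S" for n x
    using D(1)[OF sub'[OF that]] by (rule has_derivative_at_withinI)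
  have flim: "(\<lambda>n. F n x) \<longlonglongrightarrow> f x" if "x \<in> ?S" for x
    using tendsto_uniform_limitI[OF lim sub'[OF that]] .
  obtain g where g: "\<forall>x\<in>?S. (\<lambda>n. F n x) \<longlonglongrightarrow> g x \<and> (g has_derivative G x) (at x within ?S)"
    using has_derivative_sequence[OF convex_ball Dw ev p flim[OF p]] by blast
  have "g x = f x" if "x \<in> ?S" for x using LIMSEQ_unique flim g that by blast
  moreover have "(g has_derivative G p) (at p)" using g p by (metis at_within_open open_ball)
  ultimately have "(f has_derivative G p) (at p)"
    using has_derivative_transform_within_open[of g "G p" p UNIV ?S f] p by auto
  moreover have "G p (point_scale c v) = c * G p v" for c v
    using LIMSEQ_unique[OF G[OF p]] tendsto_mult_left[OF G[OF p], of c v] D(2) sub' p by auto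
  ultimately show ?thesis unfolding holo_at_def by blast
qed

text \<open>A Riemann sum of mesh \<open>h\<close> misses the integral by at most the length of the interval times the
  oscillation of the integrand on intervals of length \<open>h\<close>.\<close>

lemma riemann_sum_error:
  fixes f :: "real \<Rightarrow> complex"
  assumes cont: "continuous_on {a..b} f" and ab: "a \<le> b" and n: "0 < n"
    and osc: "\<And>s t. s \<in> {a..b} \<Longrightarrow> t \<in> {a..b} \<Longrightarrow> \<bar>s - t\<bar> \<le> (b - a) / real n \<Longrightarrow> cmod (f s - f t) \<le> e"
  shows "cmod (integral {a..b} f - (\<Sum>k<n. of_real ((b - a) / real n) * f (a + real k * ((b - a) /
    real n))))
           \<le> (b - a) * e"
proof -
  define h where "h = (b - a) / real n"
  have h: "h \<ge> 0" "real n * h = b - a" using ab n by (auto simp: h_def)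
  have le: "a + real j * h \<le> b" if "j \<le> n" for j
    using mult_right_mono[of "real j" "real n" h] that h by simp
  have "cmod (integral {a..a + real j * h} f - (\<Sum>k<j. of_real h * f (a + real k * h))) \<le> real j * h * e"
    if "j \<le> n" for j
    using that
  proof (induction j)
    case 0
    then show ?case by simp
  next
    case (Suc j)
    let ?c = "a + real j * h" and ?d = "a + real (Suc j) * h"
    have sub: "{a..?d} \<subseteq> {a..b}" using le[OF Suc.prems] by auto
    have cd: "?c \<le> ?d" "a \<le> ?c" using h(1) by (auto simp: algebra_simps)
    have int: "f integrable_on {a..?d}"
      by (rule integrable_continuous_interval) (use cont sub continuous_on_subset in blast)
    have int': "f integrable_on {?c..?d}"
      by (rule integrable_continuous_interval) (use cont sub cd continuous_on_subset[of _ f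
        "{?c..?d}"] in auto)
    have "cmod (integral {?c..?d} (\<lambda>t. f t - f ?c)) \<le> e * (?d - ?c)"
    proof (rule integral_bound[OF cd(1)])
      show "continuous_on {?c..?d} (\<lambda>t. f t - f ?c)"
        by (intro continuous_intros) (use cont sub cd continuous_on_subset[of _ f "{?c..?d}"] in auto)
      show "cmod (f t - f ?c) \<le> e" if "t \<in> {?c..?d}" for t
      proof (rule osc)
        show "\<bar>t - ?c\<bar> \<le> (b - a) / real n"
          using that unfolding h_def[symmetric] by (auto simp: algebra_simps)
      qed (use that sub cd in auto)
    qed
    also have "integral {?c..?d} (\<lambda>t. f t - f ?c) = integral {?c..?d} f - of_real h * f ?c"
      using cd by (subst Henstock_Kurzweil_Integration.integral_diff[OF int'])
        (auto simp: scaleR_conv_of_real algebra_simps)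
    finally have 1: "cmod (integral {?c..?d} f - of_real h * f ?c) \<le> h * e" by (simp add: algebra_simps)
    have 2: "integral {a..?d} f = integral {a..?c} f + integral {?c..?d} f"
      using Henstock_Kurzweil_Integration.integral_combine[OF cd(2) cd(1) int] by simp
    have "integral {a..?d} f - (\<Sum>k<Suc j. of_real h * f (a + real k * h)) =
       (integral {a..?c} f - (\<Sum>k<j. of_real h * f (a + real k * h))) + (integral {?c..?d} f -
         of_real h * f ?c)"
      unfolding 2 by simp
    then have "cmod (integral {a..?d} f - (\<Sum>k<Suc j. of_real h * f (a + real k * h))) \<le>
      real j * h * e + h * e"
      using norm_triangle_mono[OF Suc.IH[OF Suc_leD[OF Suc.prems]] 1] by (simp only:)
    moreover have "real (Suc j) * h * e = real j * h * e + h * e" by (simp add: distrib_right)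
    ultimately show ?case by (simp only:)
  qed
  note bound = this[OF order_refl]
  have "a + real n * h = b" using h(2) by linarith
  with bound show ?thesis unfolding h_def[symmetric] h(2) by (simp only:)
qed

text \<open>An integral depending on a parameter is the uniform limit of its Riemann sums, which are
  holomorphic in the parameter.\<close>

lemma holo_at_integral:
  fixes g :: "'n::finite point \<Rightarrow> real \<Rightarrow> complex"
  assumes cont: "continuous_on (cball p R \<times> {a..b}) (\<lambda>(x, t). g x t)" and ab: "a \<le> b" and R: "0 < R"
    and hol: "\<And>t x. t \<in> {a..b} \<Longrightarrow> x \<in> ball p R \<Longrightarrow> holo_at (\<lambda>x. g x t) x"
  shows "holo_at (\<lambda>x. integral {a..b} (g x)) p"
proof -
  define F where "F = (\<lambda>n x. \<Sum>k<Suc n. of_real ((b - a) / real (Suc n)) * g x (a + real k * ((b - a)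
    / real (Suc n))))"
  have pt: "a + real k * ((b - a) / real (Suc n)) \<in> {a..b}" if "k < Suc n" for k n
  proof -
    have "real k * ((b - a) / real (Suc n)) \<le> real (Suc n) * ((b - a) / real (Suc n))"
      using that ab by (intro mult_right_mono) auto
    then show ?thesis using ab by auto
  qed
  have "holo_at (F n) x" if "x \<in> ball p R" for n x
    unfolding F_def by (intro holo_at_sum holo_at_cmult hol pt that) simp
  moreover have "uniform_limit (ball p R) F (\<lambda>x. integral {a..b} (g x)) sequentially"
  proof (rule uniform_limitI)
    fix e :: real assume e: "e > 0"
    define L where "L = b - a + 1"
    have L: "L > 0" using ab by (simp add: L_def)
    define e' where "e' = e / (2 * L)"
    have e': "e' > 0" using e L by (simp add: e'_def)
    have "(b - a) * e' \<le> L * e'" using e' by (intro mult_right_mono) (auto simp: L_def)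
    also have "\<dots> < e" using e L by (simp add: e'_def)
    finally have e'': "(b - a) * e' < e" .
    have "compact (cball p R \<times> {a..b})" by (intro compact_Times) auto
    then have "uniformly_continuous_on (cball p R \<times> {a..b}) (\<lambda>(x, t). g x t)"
      using cont compact_uniformly_continuous by blast
    then obtain d where d: "d > 0" "\<And>x y. x \<in> cball p R \<times> {a..b} \<Longrightarrow> y \<in> cball p R \<times> {a..b} \<Longrightarrow>
        dist y x < d \<Longrightarrow> dist ((\<lambda>(x, t). g x t) y) ((\<lambda>(x, t). g x t) x) < e'"
      using e' unfolding uniformly_continuous_on_def by metis
    obtain N where N: "(b - a) / d < real N" using reals_Archimedean2 by blast
    show "\<forall>\<^sub>F n in sequentially. \<forall>x\<in>ball p R. dist (F n x) (integral {a..b} (g x)) < e"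
      unfolding eventually_sequentially
    proof (intro exI[of _ N] allI impI ballI)
      fix n x assume n: "N \<le> n" and x: "x \<in> ball p R"
      have mesh: "(b - a) / real (Suc n) < d"
      proof -
        have "(b - a) / d < real (Suc n)" using N n by simp
        then show ?thesis using d(1) by (simp add: field_simps)
      qed
      have cx: "continuous_on {a..b} (g x)"
        using continuous_on_compose2[OF cont, of "{a..b}" "\<lambda>t. (x, t)"] x
        by (simp add: continuous_intros image_subset_iff)
      have "cmod (integral {a..b} (g x) - F n x) \<le> (b - a) * e'"
        unfolding F_def
      proof (rule riemann_sum_error[OF cx ab])
        fix s t assume "s \<in> {a..b}" "t \<in> {a..b}" "\<bar>s - t\<bar> \<le> (b - a) / real (Suc n)"
        then show "cmod (g x s - g x t) \<le> e'"
          using d(2)[of "(x, t)" "(x, s)"] x mesh by (auto simp: dist_Pair_Pair dist_real_def dist_norm)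
      qed simp
      then show "dist (F n x) (integral {a..b} (g x)) < e" using e'' by (simp add: dist_norm
        norm_minus_commute)
    qed
  qed
  ultimately show ?thesis using R by (rule holo_at_uniform_limit)
qed

lemma holo_at_translate: "holo_at f (x + v) \<Longrightarrow> holo_at (\<lambda>x. f (x + v)) x"
  by (rule holo_at_compose[where D\<Phi> = "\<lambda>h. h"]) (auto intro!: derivative_eq_intros)

text \<open>The partial derivative is holomorphic in all variables because Cauchy's formula represents it
  as an integral over a fixed circle.\<close>

lemma holo_at_d_eta:
  assumes "open W" "p \<in> W" "\<And>x. x \<in> W \<Longrightarrow> holo_at P x"
  shows "holo_at (d_eta P) p"
proof -
  obtain R where R: "R > 0" "ball p R \<subseteq> W" using assms openE by blast
  define r where "r = R / 4"
  have r: "r > 0" using R by (simp add: r_def)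
  define e :: "'a point" where "e = (0, 0, 1)"
  have ne: "norm e = 1" by (simp add: e_def norm_Pair)
  let ?c = "circlepath 0 r"
  define g where "g = (\<lambda>x t. P (x + point_scale (?c t) e) / (?c t)\<^sup>2 * vector_derivative ?c (at t) /
    (2 * of_real pi * \<i>))"
  have inW: "x + point_scale \<mu> e \<in> W" if "x \<in> cball p (R/2)" "cmod \<mu> \<le> r" for x \<mu>
  proof -
    have "norm (x + point_scale \<mu> e - p) \<le> norm (x - p) + cmod \<mu>"
      using norm_triangle_ineq[of "x - p" "point_scale \<mu> e"] by (simp add: norm_point_scale ne
        algebra_simps)
    also have "\<dots> < R" using that r R(1) by (simp add: dist_norm norm_minus_commute r_def)
    finally show ?thesis using R(2) by (auto simp: dist_norm norm_minus_commute)
  qed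
  have ct: "cmod (?c t) = r" for t
    using r by (simp add: circlepath norm_mult exp_eq_polar)
  have contP: "continuous_on W P"
    using assms(3) holo_at_continuous continuous_at_imp_continuous_on by blast
  have cont: "continuous_on (cball p (R/2) \<times> {0..1}) (\<lambda>(x, t). g x t)"
  proof -
    interpret bounded_bilinear "point_scale :: complex \<Rightarrow> 'a point \<Rightarrow> _"
      by (rule bounded_bilinear_point_scale)
    have c: "continuous_on A (\<lambda>y. ?c (snd y))" for A :: "('a point \<times> real) set"
      by (simp add: circlepath) (intro continuous_intros)
    have "?c t \<noteq> 0" for t using ct[of t] r by auto
    then have "continuous_on (cball p (R/2) \<times> {0..1}) (\<lambda>y. g (fst y) (snd y))"
      unfolding g_def vector_derivative_circlepath
      by (intro continuous_intros c continuous_on_compose2[OF contP] continuous_on)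
         (auto intro!: inW simp: ct)
    then show ?thesis by (simp add: case_prod_unfold)
  qed
  have "holo_at (\<lambda>x. integral {0..1} (g x)) p"
  proof (rule holo_at_integral[OF cont])
    fix t x assume "x \<in> ball p (R/2)"
    then have "holo_at (\<lambda>x. P (x + point_scale (?c t) e)) x"
      by (intro holo_at_translate assms(3) inW) (auto simp: ct)
    from holo_at_cmult[OF this, of "1 / (?c t)\<^sup>2 * vector_derivative ?c (at t) / (2 * of_real pi * \<i>)"]
    show "holo_at (\<lambda>x. g x t) x" by (simp add: g_def algebra_simps)
  qed (use R in auto)
  then show ?thesis
  proof (rule holo_at_cong)
    show "open (ball p (R/2))" "p \<in> ball p (R/2)" using R by auto
    fix x assume x: "x \<in> ball p (R/2)"
    let ?f = "\<lambda>\<mu>. P (x + point_scale \<mu> e)"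
    have xW: "x \<in> W" using inW[of x 0] x r by simp
    have "?f field_differentiable (at \<mu>)" if "\<mu> \<in> cball 0 r" for \<mu>
      using x that by (intro holo_at_line assms(3) inW) auto
    then have h: "?f holomorphic_on cball 0 r"
      by (simp add: holomorphic_on_def field_differentiable_at_within)
    have 1: "(?f has_field_derivative (1 / (2 * of_real pi * \<i>) * contour_integral ?c (\<lambda>u. ?f u /
      (u-0)^2))) (at 0)"
      using r by (intro Cauchy_derivative_integral_circlepath holomorphic_on_imp_continuous_on
          h holomorphic_on_subset[OF h]) auto
    obtain D where D: "(P has_derivative D) (at x)" "\<And>c v. D (point_scale c v) = c * D v"
      using assms(3)[OF xW] unfolding holo_at_def by blast
    have 2: "(?f has_field_derivative D e) (at 0)"
      using has_field_derivative_line[of P D x 0 e] D by simp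
    obtain z \<zeta> \<eta> where zz: "x = (z, \<zeta>, \<eta>)" by (cases x)
    have "d_eta P x = D e"
      unfolding zz e_def by (rule d_eta_eq(2)[OF D(1)[unfolded zz] D(2)])
    also have "\<dots> = 1 / (2 * of_real pi * \<i>) * contour_integral ?c (\<lambda>u. ?f u / (u-0)^2)"
      by (rule DERIV_unique[OF 2 1])
    also have "\<dots> = integral {0..1} (g x)"
      unfolding contour_integral_integral g_def integral_divide by simp
    finally show "integral {0..1} (g x) = d_eta P x" ..
  qed
qed


section \<open>Cones, sectors and domains\<close>

lemma component_le_maxnorm: "cmod (z $ i) \<le> maxnorm z" for z :: "complex^'n::finite"
  unfolding maxnorm_def by (rule Max_ge) auto

lemma maxnorm_attained: "\<exists>i. maxnorm z = cmod (z $ i)" for z :: "complex^'n::finite"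
proof -
  have "maxnorm z \<in> range (\<lambda>i. cmod (z $ i))" unfolding maxnorm_def by (rule Max_in) auto
  then show ?thesis by blast
qed

lemma maxnorm_nonneg [simp]: "0 \<le> maxnorm z" for z :: "complex^'n::finite"
  using maxnorm_attained[of z] by auto

lemma maxnorm_le_norm: "maxnorm z \<le> norm z" for z :: "complex^'n::finite"
  using maxnorm_attained[of z] by (metis Finite_Cartesian_Product.norm_nth_le)

lemma norm_le_maxnorm: "norm z \<le> real CARD('n) * maxnorm z" for z :: "complex^'n::finite"
proof -
  have "norm z \<le> (\<Sum>i\<in>UNIV. cmod (z $ i))"
    unfolding norm_vec_def by (rule L2_set_le_sum) auto
  also have "\<dots> \<le> (\<Sum>i\<in>(UNIV::'n set). maxnorm z)"
    by (intro sum_mono component_le_maxnorm)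
  finally show ?thesis by simp
qed

lemma maxnorm_scale: "maxnorm (c *s z) = cmod c * maxnorm z" for z :: "complex^'n::finite"
proof (rule antisym)
  obtain i where "maxnorm (c *s z) = cmod ((c *s z) $ i)" using maxnorm_attained by blast
  then show "maxnorm (c *s z) \<le> cmod c * maxnorm z"
    by (simp add: norm_mult mult_left_mono component_le_maxnorm)
  obtain j where "maxnorm z = cmod (z $ j)" using maxnorm_attained by blast
  then show "cmod c * maxnorm z \<le> maxnorm (c *s z)"
    using component_le_maxnorm[of "c *s z" j] by (simp add: norm_mult)
qed

lemma scaleR_eq_smult: "c *\<^sub>R z = complex_of_real c *s z" for z :: "complex^'n::finite"
  by (simp add: vec_eq_iff scaleR_conv_of_real[where 'a=complex])

lemma maxnorm_scaleR: "maxnorm (c *\<^sub>R z) = \<bar>c\<bar> * maxnorm z" for z :: "complex^'n::finite"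
  by (simp add: scaleR_eq_smult maxnorm_scale)

lemma maxnorm_pos_iff: "0 < maxnorm z \<longleftrightarrow> z \<noteq> 0" for z :: "complex^'n::finite"
proof
  show "z \<noteq> 0" if "0 < maxnorm z" using that maxnorm_le_norm[of z] by auto
  show "0 < maxnorm z" if "z \<noteq> 0"
    using that norm_le_maxnorm[of z] maxnorm_nonneg[of z] by (smt (verit) mult_eq_0_iff norm_eq_zero
      norm_ge_zero)
qed

lemma thicken_mono:
  assumes "\<Omega> \<subseteq> \<Omega>'" "\<rho> \<le> \<rho>'"
  shows "thicken \<Omega> \<rho> \<subseteq> thicken \<Omega>' \<rho>'"
  unfolding thicken_def
proof (rule closure_mono, clarify)
  fix z \<zeta> z' \<zeta>' :: "complex^'a"
  assume *: "(z, \<zeta>) \<in> \<Omega>" "maxnorm z' \<le> \<rho>" "maxnorm \<zeta>' \<le> \<rho> * maxnorm \<zeta>"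
  have "\<rho> * maxnorm \<zeta> \<le> \<rho>' * maxnorm \<zeta>" using assms(2) by (intro mult_right_mono) auto
  then show "\<exists>za \<zeta>'' z'' \<zeta>'''. (z + z', \<zeta> + \<zeta>') = (za + z'', \<zeta>'' + \<zeta>''') \<and> (za, \<zeta>'') \<in> \<Omega>' \<and>
      maxnorm z'' \<le> \<rho>' \<and> maxnorm \<zeta>''' \<le> \<rho>' * maxnorm \<zeta>''"
    using * assms by (intro exI[of _ z] exI[of _ \<zeta>] exI[of _ z'] exI[of _ \<zeta>']) auto
qed

lemma subset_thicken:
  assumes "0 \<le> \<rho>"
  shows "\<Omega> \<subseteq> thicken \<Omega> \<rho>"
proof -
  have z: "maxnorm (0::complex^'a) = 0" using maxnorm_pos_iff[of "0::complex^'a"] maxnorm_nonneg[of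
    "0::complex^'a"] by simp
  have "\<Omega> \<subseteq> {(z + z', \<zeta> + \<zeta>') | z \<zeta> z' \<zeta>'. (z, \<zeta>) \<in> \<Omega> \<and> maxnorm z' \<le> \<rho> \<and> maxnorm \<zeta>' \<le> \<rho> * maxnorm \<zeta>}"
  proof clarify
    fix a b assume "(a, b) \<in> \<Omega>"
    then show "\<exists>z \<zeta> z' \<zeta>'. (a, b) = (z + z', \<zeta> + \<zeta>') \<and> (z, \<zeta>) \<in> \<Omega> \<and> maxnorm z' \<le> \<rho> \<and>
      maxnorm \<zeta>' \<le> \<rho> * maxnorm \<zeta>"
      using assms by (intro exI[of _ a] exI[of _ b] exI[of _ 0]) (auto simp: z)
  qed
  then show ?thesis unfolding thicken_def using closure_subset by blast
qed

lemma thicken_conic: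
  assumes "fibre_conic \<Omega>" "(z, \<zeta>) \<in> thicken \<Omega> \<rho>" "0 < c"
  shows "(z, c *\<^sub>R \<zeta>) \<in> thicken \<Omega> \<rho>"
proof -
  let ?A = "{(z + z', \<zeta> + \<zeta>') | z \<zeta> z' \<zeta>'. (z, \<zeta>) \<in> \<Omega> \<and> maxnorm z' \<le> \<rho> \<and> maxnorm \<zeta>' \<le> \<rho> * maxnorm \<zeta>}"
  let ?f = "\<lambda>(z::complex^'a, \<zeta>::complex^'a). (z, c *\<^sub>R \<zeta>)"
  have "?f ` ?A \<subseteq> ?A"
  proof clarify
    fix z \<zeta> z' \<zeta>' :: "complex^'a"
    assume *: "(z, \<zeta>) \<in> \<Omega>" "maxnorm z' \<le> \<rho>" "maxnorm \<zeta>' \<le> \<rho> * maxnorm \<zeta>"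
    have "(z, c *\<^sub>R \<zeta>) \<in> \<Omega>" using * assms unfolding fibre_conic_def by blast
    moreover have "maxnorm (c *\<^sub>R \<zeta>') \<le> \<rho> * maxnorm (c *\<^sub>R \<zeta>)"
      using mult_left_mono[OF *(3), of c] assms(3) by (simp add: maxnorm_scaleR algebra_simps)
    ultimately show "\<exists>za \<zeta>'' z'' \<zeta>'''. (z + z', c *\<^sub>R (\<zeta> + \<zeta>')) = (za + z'', \<zeta>'' + \<zeta>''') \<and> (za, \<zeta>'') \<in> \<Omega> \<and>
        maxnorm z'' \<le> \<rho> \<and> maxnorm \<zeta>''' \<le> \<rho> * maxnorm \<zeta>''"
      using *(2) by (intro exI[of _ z] exI[of _ "c *\<^sub>R \<zeta>"] exI[of _ z'] exI[of _ "c *\<^sub>R \<zeta>'"])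
        (auto simp: scaleR_add_right)
  qed
  then have "?f ` closure ?A \<subseteq> closure ?A"
    by (intro image_closure_subset order_trans[OF _ closure_subset])
       (auto intro!: continuous_intros simp only: case_prod_unfold closed_closure)
  then show ?thesis using assms(2) unfolding thicken_def by blast
qed

lemma dom_prod_mono:
  assumes "\<Omega> \<subseteq> \<Omega>'" "U \<subseteq> U'" "0 \<le> d'" "d' \<le> d" "\<rho> \<le> \<rho>'" "\<rho>' \<le> 1"
  shows "dom_prod \<Omega> U d \<rho> \<subseteq> dom_prod \<Omega>' U' d' \<rho>'"
proof -
  have "d' * (1 - \<rho>') \<le> d * (1 - \<rho>)" using assms by (intro mult_mono) auto
  then show ?thesis using thicken_mono[OF assms(1,5)] assms(2) unfolding dom_prod_def by auto
qed

lemma dom_star_mono: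
  assumes "\<Omega> \<subseteq> \<Omega>'" "U \<subseteq> U'" "0 \<le> d'" "d' \<le> d" "\<rho> \<le> \<rho>'" "\<rho>' \<le> 1" "m' \<le> m"
  shows "dom_star \<Omega> U d \<rho> m \<subseteq> dom_star \<Omega>' U' d' \<rho>' m'"
proof -
  have "d' * (1 - \<rho>') \<le> d * (1 - \<rho>)" using assms by (intro mult_mono) auto
  then have "real m' * (d' * (1 - \<rho>')) \<le> real m * (d * (1 - \<rho>))" using assms by (intro mult_mono) auto
  then show ?thesis using thicken_mono[OF assms(1,5)] assms(2) unfolding dom_star_def by auto
qed

lemma dom_star_subset_dom_prod:
  assumes "U \<subseteq> cball 0 1" "1 \<le> m" "0 \<le> d" "\<rho> \<le> 1"
  shows "dom_star \<Omega> U d \<rho> m \<subseteq> dom_prod \<Omega> U d \<rho>"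
proof (clarsimp simp: dom_star_def dom_prod_def)
  fix \<zeta> :: "complex^'a" and \<eta>
  assume *: "\<eta> \<in> U" "real m * (d * (1 - \<rho>)) \<le> maxnorm (\<eta> *s \<zeta>)"
  have "d * (1 - \<rho>) \<le> real m * (d * (1 - \<rho>))"
    using assms by (intro mult_right_mono[of 1 "real m", simplified]) auto
  also have "\<dots> \<le> cmod \<eta> * maxnorm \<zeta>" using * by (simp add: maxnorm_scale)
  also have "\<dots> \<le> 1 * maxnorm \<zeta>" using assms(1) *(1) by (intro mult_right_mono) auto
  finally show "d * (1 - \<rho>) \<le> maxnorm \<zeta>" by simp
qed

lemma conic_nhds_Int:
  assumes "\<Omega>1 \<in> conic_nhds z0" "\<Omega>2 \<in> conic_nhds z0"
  shows "\<Omega>1 \<inter> \<Omega>2 \<in> conic_nhds z0"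
  using assms unfolding conic_nhds_def fibre_conic_def relcompact_mod_scaling_def
  by auto

lemma sectors_Int:
  assumes "S1 \<in> sectors" "S2 \<in> sectors"
  shows "S1 \<inter> S2 \<in> sectors"
proof -
  obtain r1 t1 r2 t2 where *: "S1 = sector r1 t1" "0 < r1" "r1 < 1/2" "0 < t1" "t1 < 1/2"
      "S2 = sector r2 t2" "0 < r2" "r2 < 1/2" "0 < t2" "t2 < 1/2"
    using assms unfolding sectors_def by auto
  have "S1 \<inter> S2 = sector (min r1 r2) (min t1 t2)" using * by (auto simp: sector_def)
  then show ?thesis using * unfolding sectors_def by (auto simp: min_def)
qed

text \<open>A sector in Cartesian coordinates; openness and convexity are read off from this form.\<close>

lemma sector_eq:
  assumes "0 < \<theta>" "\<theta> < 1/2"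
  shows "sector r \<theta> = {\<eta>. cmod \<eta> < r \<and> \<bar>Im \<eta>\<bar> < tan (\<theta> / 4) * Re \<eta>}"
proof -
  define \<phi> where "\<phi> = \<theta> / 4"
  have \<phi>: "0 < \<phi>" "\<phi> < pi / 2" using assms pi_gt3 by (auto simp: \<phi>_def)
  have t: "tan \<phi> > 0" using \<phi> by (simp add: tan_gt_zero)
  have "(0 < cmod \<eta> \<and> \<bar>Arg \<eta>\<bar> < \<phi>) \<longleftrightarrow> \<bar>Im \<eta>\<bar> < tan \<phi> * Re \<eta>" for \<eta>
  proof (cases "\<eta> = 0")
    case False
    define a where "a = Arg \<eta>"
    have a: "- pi < a" "a \<le> pi" using Arg_bounded[of \<eta>] by (auto simp: a_def)
    have eta: "\<eta> = rcis (cmod \<eta>) a" by (simp add: a_def rcis_cmod_Arg)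
    have re: "Re \<eta> = cmod \<eta> * cos a" "Im \<eta> = cmod \<eta> * sin a" using eta by (metis Re_rcis, metis
      Im_rcis eta)
    have pos: "cmod \<eta> > 0" using False by simp
    have "\<bar>Im \<eta>\<bar> < tan \<phi> * Re \<eta> \<longleftrightarrow> cmod \<eta> * \<bar>sin a\<bar> < cmod \<eta> * (tan \<phi> * cos a)"
      unfolding re using pos by (simp add: abs_mult algebra_simps)
    also have "\<dots> \<longleftrightarrow> \<bar>sin a\<bar> < tan \<phi> * cos a" using pos by simp
    also have "\<dots> \<longleftrightarrow> \<bar>a\<bar> < \<phi>"
    proof
      assume h: "\<bar>sin a\<bar> < tan \<phi> * cos a"
      then have c: "cos a > 0" using t by (smt (verit) zero_less_mult_iff)
      have "\<bar>a\<bar> < pi/2"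
      proof (rule ccontr)
        assume "\<not> \<bar>a\<bar> < pi/2"
        then have "cos \<bar>a\<bar> \<le> 0" using a cos_monotone_0_pi_le[of "pi/2" "\<bar>a\<bar>"] by auto
        then show False using c by (simp add: cos_abs_real)
      qed
      moreover have "\<bar>tan a\<bar> < tan \<phi>" using h c by (simp add: tan_def abs_divide field_simps)
      ultimately have "tan \<bar>a\<bar> < tan \<phi>" "\<bar>a\<bar> < pi/2" by (auto simp: abs_if split: if_splits)
      then show "\<bar>a\<bar> < \<phi>" using \<phi> tan_mono_lt_eq[of "\<bar>a\<bar>" \<phi>] by auto
    next
      assume h: "\<bar>a\<bar> < \<phi>"
      then have "tan \<bar>a\<bar> < tan \<phi>" using \<phi> tan_mono_lt_eq[of "\<bar>a\<bar>" \<phi>] by auto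
      moreover have "\<bar>tan a\<bar> = tan \<bar>a\<bar>"
        using h \<phi> tan_pos_pi2_le[of "\<bar>a\<bar>"] by (auto simp: abs_if split: if_splits)
      moreover have c: "cos a > 0" using h \<phi> by (intro cos_gt_zero_pi) auto
      ultimately show "\<bar>sin a\<bar> < tan \<phi> * cos a" by (simp add: tan_def abs_divide field_simps)
    qed
    finally show ?thesis using pos by (simp add: a_def)
  qed auto
  then show ?thesis unfolding sector_def \<phi>_def[symmetric] by blast
qed

lemma
  assumes "S \<in> sectors"
  shows sectors_open: "open S" and sectors_convex: "convex S" and sectors_zero: "0 \<notin> S"
    and sectors_norm: "\<eta> \<in> S \<Longrightarrow> 0 < cmod \<eta> \<and> cmod \<eta> < 1/2"
    and sectors_Re: "\<eta> \<in> S \<Longrightarrow> cmod \<eta> / 2 \<le> Re \<eta>"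
proof -
  obtain r t where *: "S = sector r t" "0 < r" "r < 1/2" "0 < t" "t < 1/2"
    using assms unfolding sectors_def by auto
  have S: "S = ball 0 r \<inter> {\<eta>. Im \<eta> - tan (t/4) * Re \<eta> < 0} \<inter> {\<eta>. - Im \<eta> - tan (t/4) * Re \<eta> < 0}"
    unfolding *(1) sector_eq[OF *(4,5)] by auto
  show "open S" unfolding S by (intro open_Int open_Collect_less open_ball continuous_intros)
  have lin: "linear (\<lambda>\<eta>. Im \<eta> - c * Re \<eta>)" "linear (\<lambda>\<eta>. - Im \<eta> - c * Re \<eta>)" for c
    by (auto intro!: linearI simp: algebra_simps)
  have half: "convex {\<eta>. f \<eta> < 0}" if "linear f" for f :: "complex \<Rightarrow> real"
    using convex_linear_vimage[OF that convex_real_interval(4)[of 0]] by (simp add: vimage_def)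
  show "convex S" unfolding S by (intro convex_Int half lin convex_ball)
  show "0 \<notin> S" by (simp add: * sector_def)
  show "0 < cmod \<eta> \<and> cmod \<eta> < 1/2" if "\<eta> \<in> S" using that * by (auto simp: sector_def)
  show "cmod \<eta> / 2 \<le> Re \<eta>" if "\<eta> \<in> S"
  proof -
    have "t/4 < pi/4" using * pi_gt3 by auto
    then have "tan (t/4) < tan (pi/4)" using * pi_gt3 by (intro tan_monotone) auto
    then have "tan (t/4) < 1" by (simp add: tan_45)
    moreover have i: "\<bar>Im \<eta>\<bar> < tan (t/4) * Re \<eta>" using that *(1) sector_eq[OF *(4,5)] by auto
    moreover have "tan (t/4) > 0" using * pi_gt3 by (intro tan_gt_zero) auto
    ultimately have "Re \<eta> > 0" "tan (t/4) * Re \<eta> \<le> Re \<eta>"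
      by (smt (verit) zero_less_mult_iff, smt (verit) mult_left_le_one_le zero_less_mult_iff)
    then show ?thesis using i cmod_le[of \<eta>] by linarith
  qed
qed

text \<open>A relatively compact subset \<open>Z\<close> of a sector can be surrounded by discs of a fixed radius that
  stay in a relatively compact subset and away from \<open>0\<close>. These discs serve for Cauchy's estimate in
  \<open>\<eta>\<close>.\<close>

lemma sector_shrink:
  assumes "S \<in> sectors" "rel_compact_in Z S"
  obtains s Z' where "0 < s" "rel_compact_in Z' S"
    "\<And>\<eta> w. \<eta> \<in> Z \<Longrightarrow> w \<in> cball \<eta> s \<Longrightarrow> w \<in> Z' \<and> cmod \<eta> / 2 \<le> cmod w"
proof -
  have K: "compact (closure Z)" "closure Z \<subseteq> S" using assms unfolding rel_compact_in_def by auto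
  obtain e where e: "e > 0" "(\<Union>x\<in>closure Z. cball x e) \<subseteq> S"
    using compact_subset_open_imp_cball_epsilon_subset[OF K(1) sectors_open[OF assms(1)] K(2)] by blast
  define Z' where "Z' = (\<Union>x\<in>closure Z. cball x (e/2))"
  have Z'eq: "Z' = {x + y | x y. x \<in> closure Z \<and> y \<in> cball 0 (e/2)}"
    unfolding Z'_def by (auto simp: dist_norm norm_minus_commute) (metis add.commute diff_add_cancel
      norm_minus_commute)
  have cZ: "compact Z'" unfolding Z'eq by (intro compact_sums K) auto
  have Z'S: "Z' \<subseteq> S" using e unfolding Z'_def by force
  have rc: "rel_compact_in Z' S"
    unfolding rel_compact_in_def using cZ Z'S by (simp add: compact_imp_closed closure_closed)
  show thesis
  proof (rule that[OF _ rc])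
    show "0 < e/2" using e by simp
    fix \<eta> w assume \<eta>: "\<eta> \<in> Z" and w: "w \<in> cball \<eta> (e/2)"
    have c: "\<eta> \<in> closure Z" using \<eta> closure_subset by auto
    have "0 \<notin> cball \<eta> e" using e(2) c sectors_zero[OF assms(1)] by blast
    then have "cmod \<eta> > e" by simp
    moreover have "cmod \<eta> \<le> cmod w + e/2"
      using norm_triangle_ineq4[of w "w - \<eta>"] w by (simp add: dist_norm norm_minus_commute)
    ultimately show "w \<in> Z' \<and> cmod \<eta> / 2 \<le> cmod w" using w c unfolding Z'_def by auto
  qed
qed

lemma rel_compact_lower_bound:
  assumes "S \<in> sectors" "rel_compact_in Z S"
  obtains c where "0 < c" "\<And>\<eta>. \<eta> \<in> Z \<Longrightarrow> c \<le> cmod \<eta>"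
proof -
  obtain s Z' where s: "0 < s" "rel_compact_in Z' S"
    "\<And>\<eta> w. \<eta> \<in> Z \<Longrightarrow> w \<in> cball \<eta> s \<Longrightarrow> w \<in> Z' \<and> cmod \<eta> / 2 \<le> cmod w"
    using sector_shrink[OF assms] by metis
  have "s \<le> cmod \<eta>" if "\<eta> \<in> Z" for \<eta>
  proof (rule ccontr)
    assume "\<not> s \<le> cmod \<eta>"
    then have "0 \<in> cball \<eta> s" by simp
    then have "0 \<in> Z'" using s(3) that by blast
    then show False using s(2) sectors_zero[OF assms(1)] closure_subset unfolding rel_compact_in_def
      by blast
  qed
  then show ?thesis using that s(1) by blast
qed

lemma rel_compact_in_mono: "rel_compact_in Z S \<Longrightarrow> S \<subseteq> S' \<Longrightarrow> rel_compact_in Z S'"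
  unfolding rel_compact_in_def by blast

lemma rel_compact_in_subset: "rel_compact_in Z S \<Longrightarrow> Z \<subseteq> S"
  unfolding rel_compact_in_def using closure_subset by blast

section \<open>A chart of cones about a covector\<close>

text \<open>A linear coordinate \<open>coord \<zeta> = u \<zeta>\<^sub>i\<close> on the fibre with \<open>coord w = 1\<close>. For a suitable index
  \<open>i\<close> and \<open>u\<close> of modulus \<open>1\<close> every nonzero covector is a positive multiple of such a \<open>w\<close>. The point
  \<open>a\<close> is the base point.\<close>

locale cone_chart =
  fixes a w :: "complex^'n::finite" and i :: 'n and u :: complex
  assumes u: "cmod u = 1" and w: "u * w $ i = 1"
begin

definition coord :: "complex^'n \<Rightarrow> complex" where "coord \<zeta> = u * \<zeta> $ i"

text \<open>A basis of conic neighbourhoods of the ray through \<open>(a, w)\<close>. The positive multiple of \<open>w\<close> with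
  which \<open>\<zeta>\<close> is compared is \<open>Re (coord \<zeta>)\<close>; the inequality forces it to be positive.\<close>

definition cone :: "real \<Rightarrow> (complex^'n) \<times> (complex^'n) \<Rightarrow> bool" where
  "cone k p \<longleftrightarrow> norm (fst p - a) < k \<and>
     norm (snd p - Re (coord (snd p)) *\<^sub>R w) < k * Re (coord (snd p))"

lemma coord_w [simp]: "coord w = 1" using w by (simp add: coord_def)

lemma coord_le: "cmod (coord \<zeta>) \<le> maxnorm \<zeta>"
  using u by (simp add: coord_def norm_mult component_le_maxnorm)

lemma coord_le_norm: "cmod (coord \<zeta>) \<le> norm \<zeta>"
  using coord_le maxnorm_le_norm order_trans by blast

lemma coord_linear [simp]:
  "coord (\<zeta> + \<zeta>') = coord \<zeta> + coord \<zeta>'" "coord (\<zeta> - \<zeta>') = coord \<zeta> - coord \<zeta>'"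
  "coord (c *s \<zeta>) = c * coord \<zeta>" "coord (b *\<^sub>R \<zeta>) = of_real b * coord \<zeta>" "coord 0 = 0"
  by (simp_all add: coord_def algebra_simps scaleR_conv_of_real[where 'a=complex])

lemma bounded_linear_coord: "bounded_linear coord"
  by (rule bounded_linear_intro[of _ 1]) (simp_all add: coord_le_norm scaleR_conv_of_real[where
    'a=complex])

lemmas coord_cont [continuous_intros] = bounded_linear.continuous_on[OF bounded_linear_coord]

lemma norm_w: "1 \<le> norm w"
  using coord_le_norm[of w] by simp

lemma cone_Re: "cone k p \<Longrightarrow> 0 < k \<Longrightarrow> 0 < Re (coord (snd p))"
  unfolding cone_def by (smt (verit) mult_nonneg_nonpos norm_ge_zero)

lemma open_cone: "open {p. cone k p}"
  unfolding cone_def by (intro open_Collect_conj open_Collect_less continuous_intros)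

lemma cone_conic: "cone k (z, \<zeta>) \<Longrightarrow> 0 < c \<Longrightarrow> cone k (z, c *\<^sub>R \<zeta>)"
proof -
  assume *: "cone k (z, \<zeta>)" "0 < c"
  have "c *\<^sub>R \<zeta> - (c * Re (coord \<zeta>)) *\<^sub>R w = c *\<^sub>R (\<zeta> - Re (coord \<zeta>) *\<^sub>R w)" by (simp add: algebra_simps)
  then have "norm (c *\<^sub>R \<zeta> - (c * Re (coord \<zeta>)) *\<^sub>R w) = c * norm (\<zeta> - Re (coord \<zeta>) *\<^sub>R w)"
    using *(2) by simp
  then show ?thesis using * by (simp add: cone_def)
qed

lemma cone_in_conic_nhds:
  assumes "0 < k" "0 < t"
  shows "{p. cone k p} \<in> conic_nhds (a, t *\<^sub>R w)"
  unfolding conic_nhds_def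
proof (intro CollectI conjI)
  show "open {p. cone k p}" by (rule open_cone)
  show "fibre_conic {p. cone k p}" unfolding fibre_conic_def using cone_conic by simp
  show "cone k (a, t *\<^sub>R w)" using assms by (simp add: cone_def)
  show "relcompact_mod_scaling {p. cone k p}"
    unfolding relcompact_mod_scaling_def
  proof (intro exI conjI)
    show "compact (cball a k \<times> cball w k)" by (intro compact_Times) auto
    show "\<forall>(z, \<zeta>)\<in>{p. cone k p}. \<exists>c>0. (z, c *\<^sub>R \<zeta>) \<in> cball a k \<times> cball w k"
    proof
      fix p assume "p \<in> {p. cone k p}"
      then obtain z \<zeta> where p: "p = (z, \<zeta>)" and c: "cone k (z, \<zeta>)" by (cases p) auto
      define t where "t = Re (coord \<zeta>)"
      have t: "t > 0" using cone_Re[OF c assms(1)] by (simp add: t_def)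
      have "cone k (z, (1/t) *\<^sub>R \<zeta>)" using cone_conic[OF c, of "1/t"] t by simp
      moreover have "Re (coord ((1/t) *\<^sub>R \<zeta>)) = 1" using t by (simp add: t_def)
      ultimately have "(z, (1/t) *\<^sub>R \<zeta>) \<in> cball a k \<times> cball w k"
        by (simp add: cone_def dist_norm norm_minus_commute)
      then show "case p of (z, \<zeta>) \<Rightarrow> \<exists>c>0. (z, c *\<^sub>R \<zeta>) \<in> cball a k \<times> cball w k"
        unfolding p prod.case using t by (intro exI[of _ "1/t"]) auto
    qed
  qed
qed

text \<open>An open conic set that meets the ray contains all positive multiples of the vectors near \<open>w\<close>,
  for all base points near \<open>a\<close>.\<close>

lemma open_conic_absorbs:
  assumes "open \<Omega>" "fibre_conic \<Omega>" "(a, t *\<^sub>R w) \<in> \<Omega>" "0 < t"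
  obtains k where "0 < k" "\<And>z v b. norm (z - a) < k \<Longrightarrow> norm (v - w) < k \<Longrightarrow> 0 < b \<Longrightarrow> (z, b *\<^sub>R v) \<in> \<Omega>"
proof -
  obtain e where e: "e > 0" "ball (a, t *\<^sub>R w) e \<subseteq> \<Omega>" using assms openE by blast
  define k where "k = min (e/2) (e / (2*t))"
  have k: "k > 0" using e assms by (simp add: k_def)
  have "(z, b *\<^sub>R v) \<in> \<Omega>" if "norm (z - a) < k" "norm (v - w) < k" "0 < b" for z v b
  proof -
    have "norm (t *\<^sub>R v - t *\<^sub>R w) = t * norm (v - w)" using assms(4) by (simp flip: scaleR_diff_right)
    also have "\<dots> < t * (e / (2*t))" using that(2) assms(4) by (intro mult_strict_left_mono) (auto
      simp: k_def)
    finally have "norm (t *\<^sub>R v - t *\<^sub>R w) < e/2" using assms(4) by simp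
    moreover have "norm (z - a) < e/2" using that by (simp add: k_def)
    ultimately have "norm ((z, t *\<^sub>R v) - (a, t *\<^sub>R w)) < e"
      using norm_Pair_le[of "z - a" "t *\<^sub>R v - t *\<^sub>R w"] by simp
    then have "(z, t *\<^sub>R v) \<in> ball (a, t *\<^sub>R w) e" unfolding mem_ball dist_norm by (simp only:
      norm_minus_commute)
    then have "(z, t *\<^sub>R v) \<in> \<Omega>" using e(2) by blast
    then have "(z, (b/t) *\<^sub>R (t *\<^sub>R v)) \<in> \<Omega>" using assms that unfolding fibre_conic_def by (meson
      divide_pos_pos)
    then show ?thesis using assms(4) by simp
  qed
  then show ?thesis using that k by blast
qed

text \<open>The thickened cones \<open>\<Omega>\<^sub>\<rho>\<close> are closed; away from the zero section they are nevertheless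
  contained in a given open cone if \<open>\<Omega>\<close> and \<open>\<rho>\<close> are small.\<close>

lemma thicken_cone:
  assumes k0: "0 < k0"
  obtains k \<rho> where "0 < k" "0 < \<rho>" "\<rho> < 1"
    "\<And>z \<zeta>. (z, \<zeta>) \<in> thicken {p. cone k p} \<rho> \<Longrightarrow> \<zeta> \<noteq> 0 \<Longrightarrow> cone k0 (z, \<zeta>)"
proof -
  define M N where "M = norm w" and "N = real CARD('n)"
  have M: "M \<ge> 1" using norm_w by (simp add: M_def)
  have N: "N \<ge> 1" by (simp add: N_def Suc_leI)
  define k' where "k' = k0 / 2"
  define k where "k = min 1 k' / 4"
  define \<rho> where "\<rho> = k / (N * (M+1)^2)"
  have k: "0 < k" "k \<le> 1/4" "4 * k \<le> k'" "0 < k'" using k0 by (auto simp: k_def k'_def)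
  have MM: "1 \<le> (M+1)^2" using M by (intro one_le_power) simp
  have den: "1 \<le> N * (M+1)^2" using N MM mult_mono[of 1 N 1 "(M+1)^2"] by simp
  have \<rho>: "0 < \<rho>" "\<rho> < 1"
    using k den unfolding \<rho>_def by (auto simp: divide_simps)
  have N\<rho>: "N * \<rho> = k / (M+1)^2" using N by (simp add: \<rho>_def)
  have N\<rho>k: "N * \<rho> \<le> k" unfolding N\<rho> using MM k by (simp add: divide_simps)
  define C where "C = {p::(complex^'n)\<times>(complex^'n). norm (fst p - a) \<le> k' \<and>
     norm (snd p - Re (coord (snd p)) *\<^sub>R w) \<le> k' * Re (coord (snd p))}"
  have "closed C" unfolding C_def by (intro closed_Collect_conj closed_Collect_le continuous_intros)
  moreover have "(z + z', \<zeta> + \<zeta>') \<in> C" if c: "cone k (z, \<zeta>)" and z': "maxnorm z' \<le> \<rho>" and \<zeta>':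
    "maxnorm \<zeta>' \<le> \<rho> * maxnorm \<zeta>"
    for z z' \<zeta> \<zeta>'
  proof -
    define t where "t = Re (coord \<zeta>)"
    have t: "t > 0" using cone_Re[OF c k(1)] by (simp add: t_def)
    have c1: "norm (z - a) < k" and c2: "norm (\<zeta> - t *\<^sub>R w) < k * t" using c by (auto simp: cone_def
      t_def)
    have "norm z' \<le> N * \<rho>" using norm_le_maxnorm[of z'] z' N by (smt (verit) N_def mult_left_mono)
    then have 1: "norm (z + z' - a) \<le> k'"
      using c1 N\<rho>k k norm_triangle_ineq[of "z - a" z'] by (simp add: algebra_simps)
    have "norm \<zeta> \<le> k * t + t * M"
      using norm_triangle_ineq[of "\<zeta> - t *\<^sub>R w" "t *\<^sub>R w"] c2 t by (simp add: M_def)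
    also have "\<dots> \<le> (M + 1) * t" using k t by (simp add: algebra_simps)
    finally have n\<zeta>: "norm \<zeta> \<le> (M+1) * t" .
    have "norm \<zeta>' \<le> N * maxnorm \<zeta>'" using norm_le_maxnorm[of \<zeta>'] by (simp add: N_def)
    also have "\<dots> \<le> N * (\<rho> * maxnorm \<zeta>)" using \<zeta>' N by (intro mult_left_mono) auto
    also have "\<dots> \<le> N * (\<rho> * ((M+1) * t))"
      using n\<zeta> maxnorm_le_norm[of \<zeta>] N \<rho> by (intro mult_left_mono) auto
    also have "\<dots> = (N * \<rho>) * (M+1) * t" by simp
    also have "\<dots> = k / (M+1) * t" unfolding N\<rho> using M by (simp add: power2_eq_square)
    finally have n\<zeta>': "norm \<zeta>' \<le> k / (M+1) * t" .
    define s where "s = Re (coord \<zeta>')"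
    have s: "\<bar>s\<bar> \<le> norm \<zeta>'" unfolding s_def using abs_Re_le_cmod[of "coord \<zeta>'"] coord_le_norm[of \<zeta>']
      by linarith
    have "k / (M+1) * t \<le> k * t" using k t M by (intro mult_right_mono) (auto simp: divide_simps)
    moreover have "k * t \<le> 1/4 * t" using k t by (intro mult_right_mono) auto
    ultimately have s2: "\<bar>s\<bar> \<le> t / 4" using s n\<zeta>' by linarith
    have split: "\<zeta> + \<zeta>' - (t + s) *\<^sub>R w = (\<zeta> - t *\<^sub>R w) + (\<zeta>' - s *\<^sub>R w)" by (simp add: algebra_simps)
    have "norm (\<zeta> + \<zeta>' - (t + s) *\<^sub>R w) \<le> k * t + (norm \<zeta>' + \<bar>s\<bar> * M)"
      using norm_triangle_ineq[of "\<zeta> - t *\<^sub>R w" "\<zeta>' - s *\<^sub>R w"] norm_triangle_ineq4[of \<zeta>' "s *\<^sub>R w"] c2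
      unfolding M_def norm_scaleR split by linarith
    also have "norm \<zeta>' + \<bar>s\<bar> * M \<le> norm \<zeta>' * (M + 1)"
      using mult_right_mono[OF s, of M] M by (simp add: algebra_simps)
    also have "\<dots> \<le> k / (M+1) * t * (M+1)" using n\<zeta>' M by (intro mult_right_mono) auto
    also have "\<dots> = k * t" using M by simp
    finally have "norm (\<zeta> + \<zeta>' - (t + s) *\<^sub>R w) \<le> 2 * (k * t)" by simp
    also have "\<dots> \<le> k' * (t + s)"
    proof -
      have "2 * k * t \<le> k' / 2 * t" using k t by (intro mult_right_mono) auto
      moreover have "k' * (t/2) \<le> k' * (t + s)" using k s2 t by (intro mult_left_mono) auto
      ultimately show ?thesis by simp
    qed
    finally show ?thesis using 1 by (simp add: C_def t_def s_def)
  qed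
  ultimately have sub: "thicken {p. cone k p} \<rho> \<subseteq> C"
    unfolding thicken_def by (intro closure_minimal) auto
  show thesis
  proof (rule that[OF k(1) \<rho>])
    fix z \<zeta> assume "(z, \<zeta>) \<in> thicken {p. cone k p} \<rho>" and nz: "\<zeta> \<noteq> 0"
    then have C: "norm (z - a) \<le> k'" "norm (\<zeta> - Re (coord \<zeta>) *\<^sub>R w) \<le> k' * Re (coord \<zeta>)"
      using sub by (auto simp: C_def)
    have "Re (coord \<zeta>) \<noteq> 0" using C(2) nz by auto
    moreover have "k' * Re (coord \<zeta>) \<ge> 0" using C(2) norm_ge_zero order_trans by blast
    ultimately have "Re (coord \<zeta>) > 0" using k(4) by (simp add: zero_le_mult_iff)
    then have "k' * Re (coord \<zeta>) < k0 * Re (coord \<zeta>)"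
      using k0 by (intro mult_strict_right_mono) (auto simp: k'_def)
    moreover have "k' < k0" using k0 by (simp add: k'_def)
    ultimately show "cone k0 (z, \<zeta>)" using C unfolding cone_def fst_conv snd_conv by linarith
  qed
qed

lemma cone_estimates:
  assumes c: "cone k (z, \<zeta>)" and k: "0 < k" "k \<le> 1"
  defines "\<tau> \<equiv> coord \<zeta>"
  shows "0 < Re \<tau>" "\<bar>Im \<tau>\<bar> \<le> k * Re \<tau>" "Re \<tau> \<le> maxnorm \<zeta>" "maxnorm \<zeta> \<le> (norm w + 1) * Re \<tau>"
    "norm (z - a) < k" "norm ((1 / \<tau>) *s \<zeta> - w) \<le> k * (1 + norm w)"
proof -
  define t where "t = Re \<tau>"
  show "0 < Re \<tau>" using cone_Re[OF c k(1)] by (simp add: \<tau>_def)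
  then have t: "t > 0" by (simp add: t_def)
  have c1: "norm (z - a) < k" and c2: "norm (\<zeta> - t *\<^sub>R w) < k * t" using c by (auto simp: cone_def
    t_def \<tau>_def)
  show "norm (z - a) < k" by (rule c1)
  have 1: "cmod (\<tau> - t) < k * t" using coord_le_norm[of "\<zeta> - t *\<^sub>R w"] c2 by (simp add: \<tau>_def)
  then show "\<bar>Im \<tau>\<bar> \<le> k * Re \<tau>" using abs_Im_le_cmod[of "\<tau> - t"] by (simp add: t_def)
  show "Re \<tau> \<le> maxnorm \<zeta>" using complex_Re_le_cmod[of \<tau>] coord_le[of \<zeta>] by (simp add: \<tau>_def)
  have "norm \<zeta> \<le> k * t + t * norm w"
    using norm_triangle_ineq[of "\<zeta> - t *\<^sub>R w" "t *\<^sub>R w"] c2 t by simp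
  also have "\<dots> \<le> (norm w + 1) * t" using k t by (simp add: algebra_simps)
  finally show "maxnorm \<zeta> \<le> (norm w + 1) * Re \<tau>" using maxnorm_le_norm[of \<zeta>] by (simp add: t_def)
  have \<tau>t: "t \<le> cmod \<tau>" unfolding t_def by (rule complex_Re_le_cmod)
  then have nz: "\<tau> \<noteq> 0" using t by auto
  have "(1 / \<tau>) *s \<zeta> - w = (1 / \<tau>) *s ((\<zeta> - t *\<^sub>R w) - (\<tau> - t) *s w)"
    using nz by (simp add: vec_eq_iff field_simps scaleR_conv_of_real[where 'a=complex])
  then have "norm ((1 / \<tau>) *s \<zeta> - w) = norm ((\<zeta> - t *\<^sub>R w) - (\<tau> - t) *s w) / cmod \<tau>"
    by (simp only: norm_vector_smult norm_divide norm_one) simp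
  also have "\<dots> \<le> (k * t * (1 + norm w)) / t"
  proof (rule frac_le)
    show "norm ((\<zeta> - t *\<^sub>R w) - (\<tau> - t) *s w) \<le> k * t * (1 + norm w)"
      using norm_triangle_ineq4[of "\<zeta> - t *\<^sub>R w" "(\<tau> - t) *s w"] c2
        mult_right_mono[OF less_imp_le[OF 1] norm_ge_zero[of w]]
      unfolding norm_vector_smult distrib_left mult_1_right by linarith
  qed (use t k \<tau>t in auto)
  finally show "norm ((1 / \<tau>) *s \<zeta> - w) \<le> k * (1 + norm w)" using t by simp
qed

end

lemma cone_chart_exists:
  fixes z0 :: "'n::finite cotangent"
  assumes "snd z0 \<noteq> 0"
  obtains w i u t where "cone_chart w i u" "0 < t" "z0 = (fst z0, t *\<^sub>R w)"
proof -
  obtain i where i: "maxnorm (snd z0) = cmod (snd z0 $ i)" using maxnorm_attained by blast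
  define t where "t = maxnorm (snd z0)"
  have t: "t > 0" using assms by (simp add: t_def maxnorm_pos_iff)
  define w where "w = (1/t) *\<^sub>R snd z0"
  have "cmod (w $ i) = 1" using t i by (simp add: w_def t_def norm_mult)
  moreover from this have "w $ i \<noteq> 0" by auto
  ultimately have "cone_chart w i (inverse (w $ i))"
    by unfold_locales (auto simp: norm_inverse)
  moreover have "z0 = (fst z0, t *\<^sub>R w)" using t by (simp add: w_def)
  ultimately show ?thesis using that t by blast
qed

lemma conic_nhds_nonempty: "snd z0 \<noteq> 0 \<Longrightarrow> conic_nhds z0 \<noteq> {}" for z0 :: "'n::finite cotangent"
proof -
  assume "snd z0 \<noteq> 0"
  then obtain w i u t where c: "cone_chart w i u" "0 < t" "z0 = (fst z0, t *\<^sub>R w)"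
    by (rule cone_chart_exists)
  show ?thesis using cone_chart.cone_in_conic_nhds[OF c(1) zero_less_one c(2), of "fst z0"] c(3) by auto
qed

lemma sectors_nonempty: "sectors \<noteq> {}"
  unfolding sectors_def by (auto intro!: exI[of _ "1/4"])


section \<open>Resummation of a formal symbol\<close>

text \<open>The data are the terms \<open>p \<nu>\<close> of a formal symbol, frozen at \<open>\<eta> = \<eta>0\<close>: \<open>p \<nu>\<close> is holomorphic
  where \<open>\<parallel>\<zeta>\<parallel> \<ge> (\<nu> + 1) D\<close> in a cone, and bounded by \<open>A\<^sup>\<nu>\<close> up to infra-exponential factors.\<close>

locale resummation = cone_chart a w i u
  for a w :: "complex^'n::finite" and i :: 'n and u :: complex +
  fixes p :: "nat \<Rightarrow> 'n symb" and \<eta>0 :: complex and D A k0 :: real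
  assumes D: "0 < D" and A: "0 < A" "A < 1" and k0: "0 < k0" "k0 \<le> 1"
    and holo_p: "\<And>\<nu> z \<zeta>. cone k0 (z, \<zeta>) \<Longrightarrow> real (\<nu> + 1) * D \<le> maxnorm \<zeta> \<Longrightarrow> holo_at (p \<nu>) (z, \<zeta>, \<eta>0)"
    and bound_p: "\<And>h. 0 < h \<Longrightarrow> \<exists>C>0. \<forall>\<nu> z \<zeta>. cone k0 (z, \<zeta>) \<longrightarrow> real (\<nu> + 1) * D \<le> maxnorm \<zeta> \<longrightarrow>
       cmod (p \<nu> (z, \<zeta>, \<eta>0)) \<le> C * A ^ \<nu> * exp (h * maxnorm \<zeta>)"
begin

text \<open>The constants: \<open>\<epsilon>\<close> is the radius of the circle around \<open>1\<close> on which Cauchy's formula is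
  applied, \<open>k\<close> the opening of the smaller cone \<open>U\<close>, so small that \<open>U\<close> multiplied by this disc lies
  in the original cone. The rate \<open>l\<close> is half of the available decay, \<open>A = exp (- 2 l)\<close>; the other
  half pays for the growth of the Cauchy kernel, and \<open>\<delta>\<close> is chosen accordingly.\<close>

definition M :: real where "M = norm w"
definition \<epsilon> :: real where "\<epsilon> = k0 / (8 * (1 + M))"
definition k :: real where "k = \<epsilon> / 16"
definition l :: real where "l = - ln A / 2"
definition \<delta> :: real where "\<delta> = l / (8 * D)"
definition R :: "nat \<Rightarrow> real" where "R \<nu> = 2 * real (\<nu> + 1) * D"
definition tau :: "'n point \<Rightarrow> complex" where "tau x = coord (fst (snd x))"
definition U :: "'n point set" where "U = {x. cone k (fst x, fst (snd x))}"
definition arc :: "real \<Rightarrow> complex" where "arc = circlepath 1 \<epsilon>"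
text \<open>The integrand: \<open>p \<nu>\<close> on the complex ray through \<open>\<zeta>\<close>, at the point of this ray whose coordinate
  is \<open>R \<nu> s\<close>, times an exponential factor which is \<open>1\<close> at \<open>s = tau / R \<nu>\<close> and small when \<open>Re tau\<close> is
  large.\<close>

definition kern :: "nat \<Rightarrow> 'n point \<Rightarrow> complex \<Rightarrow> complex" where
  "kern \<nu> x s = p \<nu> (fst x, (complex_of_real (R \<nu>) * s / tau x) *s fst (snd x), \<eta>0) * exp (of_real \<delta>
    * (of_real (R \<nu>) * s - tau x))"
text \<open>Cauchy's integrand on the circle, pulled back to the unit interval. The parameters \<open>t \<le> 1/4\<close>
  and \<open>t \<ge> 3/4\<close> form the right arc, \<open>1/4 \<le> t \<le> 3/4\<close> the left arc; \<open>JR\<close> and \<open>JL\<close> are the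
  corresponding integrals.\<close>

definition g :: "nat \<Rightarrow> 'n point \<Rightarrow> real \<Rightarrow> complex" where
  "g \<nu> x t = kern \<nu> x (arc t) / (arc t - tau x / of_real (R \<nu>)) * vector_derivative arc (at t) / (2
    * of_real pi * \<i>)"
definition JR :: "nat \<Rightarrow> 'n point \<Rightarrow> complex" where
  "JR \<nu> x = integral {0..1/4} (g \<nu> x) + integral {3/4..1} (g \<nu> x)"
definition JL :: "nat \<Rightarrow> 'n point \<Rightarrow> complex" where
  "JL \<nu> x = integral {1/4..3/4} (g \<nu> x)"
definition pfix :: "nat \<Rightarrow> 'n point \<Rightarrow> complex" where
  "pfix \<nu> x = p \<nu> (fst x, fst (snd x), \<eta>0)"
text \<open>The two branches agree near the seam \<open>Re tau = R \<nu>\<close> (lemma \<open>overlap\<close>).\<close>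

definition q :: "nat \<Rightarrow> 'n symb" where
  "q \<nu> x = (if Re (tau x) < R \<nu> then JR \<nu> x else pfix \<nu> x - JL \<nu> x)"

lemma par_facts: "1 \<le> M" "0 < \<epsilon>" "\<epsilon> \<le> 1/16" "0 < k" "k \<le> \<epsilon>/16" "k \<le> k0" "k \<le> 1" "0 < l" "0 < \<delta>" "0 < R \<nu>"
  "2 * k * (1 + M) + \<epsilon> * M < k0 / 2" "A = exp (- 2 * l)"
proof -
  show M: "1 \<le> M" using norm_w by (simp add: M_def)
  show e: "0 < \<epsilon>" using M k0 by (simp add: \<epsilon>_def)
  have "2 * k0 \<le> 1 + M" using M k0 by simp
  then show e': "\<epsilon> \<le> 1/16" using M by (simp add: \<epsilon>_def divide_simps)
  show "0 < k" "k \<le> \<epsilon>/16" "k \<le> 1" using e e' by (auto simp: k_def)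
  have "k0 / (8 * N) * N = k0 / 8" if "0 < N" for N using that by simp
  from this[of "1 + M"] have eM: "\<epsilon> * (1 + M) = k0 / 8" using M by (simp only: \<epsilon>_def)
  have "\<epsilon> * 1 \<le> \<epsilon> * (1 + M)" using e M by (intro mult_left_mono) auto
  then show "k \<le> k0" using eM k0 by (simp add: k_def)
  have "2 * k * (1 + M) = k0 / 64" using eM by (simp add: k_def)
  moreover have "\<epsilon> * M \<le> \<epsilon> * (1 + M)" using e by (intro mult_left_mono) auto
  ultimately show "2 * k * (1 + M) + \<epsilon> * M < k0 / 2" using eM k0 by linarith
  show l: "0 < l" using A by (simp add: l_def)
  then show "0 < \<delta>" using D by (simp add: \<delta>_def)
  show "0 < R \<nu>" using D by (simp add: R_def)
  show "A = exp (- 2 * l)" using A by (simp add: l_def)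
qed

lemma U_facts:
  assumes "x \<in> U"
  shows "0 < Re (tau x)" "\<bar>Im (tau x)\<bar> \<le> \<epsilon> / 16 * Re (tau x)" "tau x \<noteq> 0"
    "Re (tau x) \<le> maxnorm (fst (snd x))" "maxnorm (fst (snd x)) \<le> (M + 1) * Re (tau x)"
    "norm (fst x - a) < k" "norm ((1 / tau x) *s fst (snd x) - w) \<le> k * (1 + M)"
proof -
  have c: "cone k (fst x, fst (snd x))" using assms by (simp add: U_def)
  note e = cone_estimates[OF c par_facts(4) par_facts(7), folded tau_def M_def]
  show "0 < Re (tau x)" "Re (tau x) \<le> maxnorm (fst (snd x))"
    "maxnorm (fst (snd x)) \<le> (M + 1) * Re (tau x)"
    "norm (fst x - a) < k" "norm ((1 / tau x) *s fst (snd x) - w) \<le> k * (1 + M)"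
    using e by auto
  show "\<bar>Im (tau x)\<bar> \<le> \<epsilon> / 16 * Re (tau x)" using e(2) by (simp add: k_def)
  show "tau x \<noteq> 0" using e(1) by auto
qed

lemma cone_k_k0: "x \<in> U \<Longrightarrow> cone k0 (fst x, fst (snd x))"
proof -
  assume x: "x \<in> U"
  have "k * Re (tau x) \<le> k0 * Re (tau x)" using par_facts(6) U_facts(1)[OF x] by (intro
    mult_right_mono) auto
  then show ?thesis using x par_facts(6) by (auto simp: U_def cone_def tau_def)
qed

lemma open_U: "open U"
proof -
  have "U = (\<lambda>x. (fst x, fst (snd x))) -` {p. cone k p}" by (auto simp: U_def)
  moreover have "open ((\<lambda>x. (fst x, fst (snd x))) -` {p. cone k p} :: 'n point set)"
    by (intro open_vimage open_cone continuous_intros)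
  ultimately show ?thesis by simp
qed

lemma tau_cont [continuous_intros]: "continuous_on V tau"
  unfolding tau_def by (intro continuous_intros)

text \<open>For \<open>s\<close> in the disc of radius \<open>\<epsilon>\<close> around \<open>1\<close>, the point of the complex ray through \<open>\<zeta>\<close> with
  coordinate \<open>R \<nu> s\<close> lies in the domain of \<open>p \<nu>\<close>.\<close>

lemma disc_facts:
  fixes \<nu> :: nat
  assumes x: "x \<in> U" and s: "cmod (s - 1) \<le> \<epsilon>"
  defines "\<zeta> \<equiv> (complex_of_real (R \<nu>) * s / tau x) *s fst (snd x)"
  shows "cone k0 (fst x, \<zeta>)" "real (\<nu> + 1) * D \<le> maxnorm \<zeta>" "maxnorm \<zeta> \<le> 2 * R \<nu> * (M + 1)"
proof -
  define \<omega> where "\<omega> = (1 / tau x) *s fst (snd x)"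
  have \<zeta>: "\<zeta> = R \<nu> *\<^sub>R (s *s \<omega>)" by (simp add: \<zeta>_def \<omega>_def scaleR_eq_smult)
  have c\<omega>: "coord \<omega> = 1" using U_facts(3)[OF x] by (simp add: \<omega>_def tau_def)
  have \<omega>w: "norm (\<omega> - w) \<le> k * (1 + M)" using U_facts(7)[OF x] by (simp add: \<omega>_def)
  have Rs: "\<bar>Re s - 1\<bar> \<le> \<epsilon>" "\<bar>Im s\<bar> \<le> \<epsilon>" using s abs_Re_le_cmod[of "s - 1"] abs_Im_le_cmod[of
    "s - 1"] by auto
  have Re_s: "1/2 \<le> Re s" using Rs par_facts(3) by linarith
  have s_le: "cmod s \<le> 2" using s norm_triangle_ineq[of "s - 1" 1] par_facts(3) by simp
  have s_ge: "1/2 \<le> cmod s" using Re_s complex_Re_le_cmod[of s] by linarith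
  have s_im: "cmod (s - of_real (Re s)) \<le> \<epsilon>" using Rs(2) by (simp add: cmod_def)
  have "s *s \<omega> - Re s *\<^sub>R w = s *s (\<omega> - w) + (s - of_real (Re s)) *s w"
    by (simp add: scaleR_eq_smult vec_eq_iff algebra_simps)
  then have "norm (s *s \<omega> - Re s *\<^sub>R w) \<le> cmod s * norm (\<omega> - w) + cmod (s - of_real (Re s)) * M"
    using norm_triangle_ineq[of "s *s (\<omega> - w)" "(s - of_real (Re s)) *s w"] by (simp only:
      norm_vector_smult M_def)
  also have "\<dots> \<le> 2 * (k * (1 + M)) + \<epsilon> * M"
    using s_le \<omega>w s_im par_facts(1,2,4) by (intro add_mono mult_mono) auto
  also have "\<dots> < k0 / 2" using par_facts(11) by (simp only: mult.assoc)
  also have "\<dots> \<le> k0 * Re s" using Re_s k0 by simp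
  finally have "cone k0 (fst x, s *s \<omega>)"
    using U_facts(6)[OF x] par_facts(6) by (simp add: cone_def c\<omega>)
  then show "cone k0 (fst x, \<zeta>)" unfolding \<zeta> using cone_conic par_facts(10) by blast
  have mz: "maxnorm \<zeta> = R \<nu> * (cmod s * maxnorm \<omega>)"
    using par_facts(10)[of \<nu>] by (simp add: \<zeta> maxnorm_scaleR maxnorm_scale)
  have "1 \<le> maxnorm \<omega>" using coord_le[of \<omega>] c\<omega> by simp
  then have "1/2 * 1 \<le> cmod s * maxnorm \<omega>" using s_ge by (intro mult_mono) auto
  then have "R \<nu> * (1/2) \<le> maxnorm \<zeta>" unfolding mz using par_facts(10)[of \<nu>] by (intro
    mult_left_mono) auto
  moreover have "real (\<nu> + 1) * D = R \<nu> * (1/2)" by (simp add: R_def)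
  ultimately show "real (\<nu> + 1) * D \<le> maxnorm \<zeta>" by simp
  have "norm \<omega> \<le> k * (1 + M) + M" using norm_triangle_ineq[of "\<omega> - w" w] \<omega>w by (simp add: M_def)
  also have "k * (1 + M) \<le> 1" using par_facts(11) k0 par_facts(1,2) mult_nonneg_nonneg[of \<epsilon> M] by linarith
  finally have "maxnorm \<omega> \<le> M + 1" using maxnorm_le_norm[of \<omega>] by simp
  then have "cmod s * maxnorm \<omega> \<le> 2 * (M + 1)" using s_le by (intro mult_mono) auto
  then have "maxnorm \<zeta> \<le> R \<nu> * (2 * (M + 1))" unfolding mz using par_facts(10)[of \<nu>] by (intro
    mult_left_mono) auto
  then show "maxnorm \<zeta> \<le> 2 * R \<nu> * (M + 1)" by (simp only: mult_ac)
qed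

lemma arc_eq: "arc t = 1 + of_real \<epsilon> * exp (2 * of_real pi * \<i> * of_real t)"
  by (simp add: arc_def circlepath)

lemma arc_Re: "Re (arc t) = 1 + \<epsilon> * cos (2 * pi * t)"
  by (simp add: arc_eq Re_exp)

lemma arc_norm: "cmod (arc t - 1) = \<epsilon>"
  using par_facts(2) by (simp add: arc_eq norm_mult)

lemma arc_deriv: "vector_derivative arc (at t) =
  2 * of_real pi * \<i> * of_real \<epsilon> * exp (2 * of_real pi * \<i> * of_real t)"
  by (simp add: arc_def vector_derivative_circlepath)

lemma arc_cont [continuous_intros]: "continuous_on V f \<Longrightarrow> continuous_on V (\<lambda>y. arc (f y))"
  unfolding arc_eq by (intro continuous_intros)

lemma holo_tau: "holo_at tau x"
proof -
  have "bounded_linear (\<lambda>v::'n point. coord (fst (snd v)))"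
    using bounded_linear_compose[OF bounded_linear_coord bounded_linear_compose[OF
      bounded_linear_fst bounded_linear_snd]] .
  then show ?thesis unfolding holo_at_def tau_def
    by (intro exI[of _ "\<lambda>v. coord (fst (snd v))"] conjI bounded_linear_imp_has_derivative)
       (auto simp: point_scale_def)
qed

lemma holo_at_ray:
  assumes "tau x \<noteq> 0" "holo_at f (fst x, (c / tau x) *s fst (snd x), \<eta>0)"
  shows "holo_at (\<lambda>x. f (fst x, (c / tau x) *s fst (snd x), \<eta>0)) x"
proof (rule holo_at_compose[where f = f])
  have bl: "bounded_linear (\<lambda>v::'n point. coord (fst (snd v)))"
    using bounded_linear_compose[OF bounded_linear_coord bounded_linear_compose[OF
      bounded_linear_fst bounded_linear_snd]] .
  have 1: "(tau has_derivative (\<lambda>v. coord (fst (snd v)))) (at x)"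
    unfolding tau_def by (rule bounded_linear_imp_has_derivative[OF bl])
  have "((\<lambda>t. c / t) has_field_derivative - (c / (tau x)\<^sup>2)) (at (tau x))"
    using assms(1) by (auto intro!: derivative_eq_intros simp: power2_eq_square)
  then have 2: "((\<lambda>x. c / tau x) has_derivative (\<lambda>v. - (c / (tau x)\<^sup>2) * coord (fst (snd v)))) (at x)"
    using has_derivative_compose[OF 1, of "\<lambda>t. c / t" "(*) (- (c / (tau x)\<^sup>2))"]
    by (simp add: has_field_derivative_def)
  have 3: "((\<lambda>x::'n point. fst (snd x)) has_derivative (\<lambda>v. fst (snd v))) (at x)"
    by (intro derivative_intros)
  have 4: "((\<lambda>x. (c / tau x) *s fst (snd x)) has_derivative
     (\<lambda>v. (c / tau x) *s fst (snd v) + (- (c / (tau x)\<^sup>2) * coord (fst (snd v))) *s fst (snd x))) (at x)"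
    by (rule bounded_bilinear.FDERIV[OF bounded_bilinear_vector_smult 2 3])
  show "((\<lambda>x. (fst x, (c / tau x) *s fst (snd x), \<eta>0)) has_derivative
     (\<lambda>v. (fst v, (c / tau x) *s fst (snd v) + (- (c / (tau x)\<^sup>2) * coord (fst (snd v))) *s fst (snd
       x), 0))) (at x)"
    by (intro has_derivative_Pair 4 derivative_intros)
qed (auto simp: point_scale_def vec_eq_iff algebra_simps assms(2))

lemma holo_kern:
  assumes "x \<in> U" "cmod (s - 1) \<le> \<epsilon>"
  shows "holo_at (\<lambda>x. kern \<nu> x s) x"
  unfolding kern_def
proof (intro holo_at_mult holo_at_ray)
  show "tau x \<noteq> 0" using U_facts assms by blast
  show "holo_at (p \<nu>) (fst x, (complex_of_real (R \<nu>) * s / tau x) *s fst (snd x), \<eta>0)"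
    by (intro holo_p disc_facts assms)
  show "holo_at (\<lambda>x. exp (of_real \<delta> * (of_real (R \<nu>) * s - tau x))) x"
    by (rule holo_at_compose_field[where g = exp]) (auto intro!: holo_at_cmult holo_at_diff holo_tau
      DERIV_exp)
qed

lemma holo_integral_g:
  assumes V: "open V" "V \<subseteq> U" "x \<in> V" and bc: "b \<le> c"
    and nz: "\<And>x t. x \<in> V \<Longrightarrow> t \<in> {b..c} \<Longrightarrow> arc t \<noteq> tau x / of_real (R \<nu>)"
  shows "holo_at (\<lambda>x. integral {b..c} (g \<nu> x)) x"
proof -
  obtain r where r: "r > 0" "cball x r \<subseteq> V" using V(1,3) open_contains_cball by blast
  show ?thesis
  proof (rule holo_at_integral[OF _ bc r(1)])
    let ?X = "cball x r \<times> {b..c}"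
    let ?\<Phi> = "\<lambda>y. (fst (fst y), (complex_of_real (R \<nu>) * arc (snd y) / tau (fst y)) *s fst (snd (fst
      y)), \<eta>0)"
    have XU: "fst y \<in> U" "fst y \<in> V" if "y \<in> ?X" for y using that r V by auto
    have tnz: "tau (fst y) \<noteq> 0" if "y \<in> ?X" for y using XU[OF that] U_facts by blast
    have ct: "continuous_on ?X (\<lambda>y. tau (fst y))"
      by (intro continuous_on_compose2[OF tau_cont] continuous_intros) auto
    have c\<Phi>: "continuous_on ?X ?\<Phi>"
      by (intro continuous_intros ct bounded_bilinear.continuous_on[OF bounded_bilinear_vector_smult])
         (use tnz in auto)
    have "isCont (p \<nu>) (?\<Phi> y)" if "y \<in> ?X" for y
      by (intro holo_at_continuous holo_p disc_facts XU[OF that]) (simp_all add: arc_norm)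
    then have "continuous_on (?\<Phi> ` ?X) (p \<nu>)" by (intro continuous_at_imp_continuous_on) blast
    then have cp: "continuous_on ?X (\<lambda>y. p \<nu> (?\<Phi> y))"
      using continuous_on_compose[OF c\<Phi>] by (simp add: o_def)
    have "continuous_on ?X (\<lambda>y. g \<nu> (fst y) (snd y))"
      unfolding g_def kern_def arc_deriv
      by (intro continuous_intros cp ct) (use par_facts(10)[of \<nu>] nz XU in auto)
    then show "continuous_on ?X (\<lambda>(x, t). g \<nu> x t)" by (simp add: case_prod_unfold)
  next
    fix t y assume t: "t \<in> {b..c}" and "y \<in> ball x r"
    then have "y \<in> cball x r" by simp
    then have y: "y \<in> V" "y \<in> U" using r(2) V(2) by blast+
    have "holo_at (\<lambda>x. arc t - (1 / of_real (R \<nu>)) * tau x) y"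
      by (intro holo_at_diff holo_at_const holo_at_cmult holo_tau)
    then have "holo_at (\<lambda>x. inverse (arc t - (1 / of_real (R \<nu>)) * tau x)) y"
      by (rule holo_at_compose_field[OF _ DERIV_inverse]) (use nz[OF y(1) t] in auto)
    then have "holo_at (\<lambda>x. (vector_derivative arc (at t) / (2 * of_real pi * \<i>)) *
        (kern \<nu> x (arc t) * inverse (arc t - (1 / of_real (R \<nu>)) * tau x))) y"
      by (intro holo_at_cmult holo_at_mult holo_kern y) (simp add: arc_norm)
    then show "holo_at (\<lambda>x. g \<nu> x t) y" by (simp add: g_def field_simps)
  qed
qed

text \<open>The points \<open>tau / R \<nu>\<close> lie in a narrow sector around the positive axis. So they stay away from
  the right arc unless their real part exceeds \<open>1\<close> noticeably, and from the left arc unless it is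
  noticeably below \<open>1\<close>.\<close>

lemma away_right:
  assumes x: "x \<in> U" and a: "Re (tau x) \<le> R \<nu> * (1 + \<epsilon>/4)" and t: "1 \<le> Re (arc t)"
  shows "\<epsilon> / 4 \<le> cmod (arc t - tau x / of_real (R \<nu>))"
proof (rule ccontr)
  define b where "b = tau x / of_real (R \<nu>)"
  have R: "R \<nu> > 0" by (rule par_facts)
  assume "\<not> ?thesis"
  then have lt: "cmod (arc t - b) < \<epsilon>/4" by (simp add: b_def)
  have b: "Re b \<le> 1 + \<epsilon>/4" "\<bar>Im b\<bar> \<le> \<epsilon>/16 * Re b"
    using a U_facts(2)[OF x] R by (auto simp: b_def divide_simps mult.commute)
  have "\<epsilon>/16 * Re b \<le> \<epsilon>/16 * 2" using b(1) par_facts(2,3) by (intro mult_left_mono) auto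
  then have "\<bar>Im (arc t)\<bar> < \<epsilon>/2" "Re (arc t) < 1 + \<epsilon>/2"
    using lt abs_Im_le_cmod[of "arc t - b"] abs_Re_le_cmod[of "arc t - b"] b
    unfolding minus_complex.sel by linarith+
  then have "cmod (arc t - 1) < \<epsilon>"
    using cmod_le[of "arc t - 1"] t unfolding minus_complex.sel one_complex.sel by linarith
  then show False using arc_norm by simp
qed

lemma away_left:
  assumes x: "x \<in> U" and a: "R \<nu> * (1 - \<epsilon>/4) \<le> Re (tau x)" and t: "Re (arc t) \<le> 1"
  shows "\<epsilon> / 4 \<le> cmod (arc t - tau x / of_real (R \<nu>))"
proof (rule ccontr)
  define b where "b = tau x / of_real (R \<nu>)"
  have R: "R \<nu> > 0" by (rule par_facts)
  assume "\<not> ?thesis"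
  then have lt: "cmod (arc t - b) < \<epsilon>/4" by (simp add: b_def)
  have b: "1 - \<epsilon>/4 \<le> Re b" "\<bar>Im b\<bar> \<le> \<epsilon>/16 * Re b"
    using a U_facts(2)[OF x] R by (auto simp: b_def divide_simps mult.commute)
  have "Re b \<le> 2" using lt abs_Re_le_cmod[of "arc t - b"] t par_facts(3) by simp
  then have "\<epsilon>/16 * Re b \<le> \<epsilon>/16 * 2" using par_facts(2,3) by (intro mult_left_mono) auto
  then have "\<bar>Im (arc t)\<bar> < \<epsilon>/2" "Re (arc t) > 1 - \<epsilon>/2"
    using lt abs_Im_le_cmod[of "arc t - b"] abs_Re_le_cmod[of "arc t - b"] b
    unfolding minus_complex.sel by linarith+
  then have "cmod (arc t - 1) < \<epsilon>"
    using cmod_le[of "arc t - 1"] t unfolding minus_complex.sel one_complex.sel by linarith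
  then show False using arc_norm by simp
qed

lemma arc_right: "t \<in> {0..1/4} \<union> {3/4..1} \<Longrightarrow> 1 \<le> Re (arc t)"
proof -
  assume t: "t \<in> {0..1/4} \<union> {3/4..1}"
  have "0 \<le> cos (2 * pi * t)"
  proof (cases "t \<le> 1/4")
    case True
    then have "2 * pi * t \<le> 2 * pi * (1/4)" by (intro mult_left_mono) auto
    moreover have "0 \<le> 2 * pi * t" using t by auto
    ultimately show ?thesis using pi_gt_zero by (intro cos_ge_zero) linarith+
  next
    case False
    then have t': "3/4 \<le> t" "t \<le> 1" using t by auto
    have "2 * pi * t \<le> 2 * pi * 1" "2 * pi * (3/4) \<le> 2 * pi * t"
      by (intro mult_left_mono t'; simp)+
    then have "0 \<le> cos (2 * pi - 2 * pi * t)"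
      using pi_gt_zero by (intro cos_ge_zero) linarith+
    then show ?thesis by (simp add: cos_2pi_minus)
  qed
  then show ?thesis using par_facts(2) by (simp add: arc_Re)
qed

lemma arc_left: "t \<in> {1/4..3/4} \<Longrightarrow> Re (arc t) \<le> 1"
proof -
  assume t: "t \<in> {1/4..3/4}"
  then have t': "1/4 \<le> t" "t \<le> 3/4" by auto
  have "2 * pi * t \<le> 2 * pi * (3/4)" "2 * pi * (1/4) \<le> 2 * pi * t"
    by (intro mult_left_mono t'; simp)+
  then have "0 \<le> cos (2 * pi * t - pi)"
    by (intro cos_ge_zero) linarith+
  then have "cos (2 * pi * t) \<le> 0" by (simp add: cos_diff)
  then show ?thesis using par_facts(2) by (simp add: arc_Re mult_nonneg_nonpos)
qed

lemma holo_JR: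
  assumes "x \<in> U" "Re (tau x) < R \<nu> * (1 + \<epsilon>/4)"
  shows "holo_at (JR \<nu>) x"
proof -
  let ?V = "U \<inter> {x. Re (tau x) < R \<nu> * (1 + \<epsilon>/4)}"
  have V: "open ?V" by (intro open_Int open_U open_Collect_less continuous_intros)
  have nz: "arc t \<noteq> tau x / of_real (R \<nu>)" if "x \<in> ?V" "t \<in> {0..1/4} \<union> {3/4..1}" for x t
    using away_right[of x \<nu> t] arc_right[OF that(2)] that(1) par_facts(2) by auto
  show ?thesis unfolding JR_def[abs_def]
    by (intro holo_at_add holo_integral_g[OF V]) (use assms nz in auto)
qed

lemma holo_JL:
  assumes "x \<in> U" "R \<nu> * (1 - \<epsilon>/4) < Re (tau x)"
  shows "holo_at (JL \<nu>) x"
proof -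
  let ?V = "U \<inter> {x. R \<nu> * (1 - \<epsilon>/4) < Re (tau x)}"
  have V: "open ?V" by (intro open_Int open_U open_Collect_less continuous_intros)
  have nz: "arc t \<noteq> tau x / of_real (R \<nu>)" if "x \<in> ?V" "t \<in> {1/4..3/4}" for x t
    using away_left[of x \<nu> t] arc_left[OF that(2)] that(1) par_facts(2) by auto
  show ?thesis unfolding JL_def[abs_def]
    by (intro holo_integral_g[OF V]) (use assms nz in auto)
qed

lemma g_continuous:
  assumes x: "x \<in> U" and nz: "\<And>t. t \<in> {b..c} \<Longrightarrow> arc t \<noteq> tau x / of_real (R \<nu>)"
  shows "continuous_on {b..c} (g \<nu> x)"
proof -
  let ?\<Phi> = "\<lambda>t. (fst x, (complex_of_real (R \<nu>) * arc t / tau x) *s fst (snd x), \<eta>0)"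
  have c\<Phi>: "continuous_on {b..c} ?\<Phi>"
    by (intro continuous_intros bounded_bilinear.continuous_on[OF bounded_bilinear_vector_smult])
       (use U_facts(3)[OF x] in auto)
  have "isCont (p \<nu>) (?\<Phi> t)" for t
    by (intro holo_at_continuous holo_p disc_facts x) (simp_all add: arc_norm)
  then have "continuous_on (?\<Phi> ` {b..c}) (p \<nu>)" by (intro continuous_at_imp_continuous_on) blast
  then have cp: "continuous_on {b..c} (\<lambda>t. p \<nu> (?\<Phi> t))"
    using continuous_on_compose[OF c\<Phi>] by (simp add: o_def)
  show ?thesis
    unfolding g_def kern_def arc_deriv
    by (intro continuous_intros cp) (use nz in auto)
qed

text \<open>On the overlap of the two regions Cauchy's integral formula for the full circle applies.\<close>

lemma overlap:
  assumes x: "x \<in> U" and a: "R \<nu> * (1 - \<epsilon>/4) < Re (tau x)" "Re (tau x) < R \<nu> * (1 + \<epsilon>/4)"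
  shows "JR \<nu> x + JL \<nu> x = pfix \<nu> x"
proof -
  define b where "b = tau x / of_real (R \<nu>)"
  have R: "R \<nu> > 0" by (rule par_facts)
  have b: "Re b < 1 + \<epsilon>/4" "1 - \<epsilon>/4 < Re b" "\<bar>Im b\<bar> \<le> \<epsilon>/16 * Re b"
    using a U_facts(2)[OF x] R by (auto simp: b_def divide_simps mult.commute)
  have "\<epsilon>/16 * Re b \<le> \<epsilon>/16 * 2" using b(1) par_facts(2,3) by (intro mult_left_mono) auto
  then have b1: "cmod (b - 1) < \<epsilon>" using cmod_le[of "b - 1"] b
    unfolding minus_complex.sel one_complex.sel by linarith
  have nz: "arc t \<noteq> b" for t using arc_norm[of t] b1 by auto
  have "kern \<nu> x field_differentiable at s within cball 1 \<epsilon>" if "s \<in> cball 1 \<epsilon>" for s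
  proof -
    let ?v = "(0, (complex_of_real (R \<nu>) / tau x) *s fst (snd x), 0) :: 'n point"
    have line: "(fst x, 0, \<eta>0) + point_scale s ?v =
      (fst x, (complex_of_real (R \<nu>) * s / tau x) *s fst (snd x), \<eta>0)" for s
      by (simp add: point_scale_def mult.commute)
    have "holo_at (p \<nu>) ((fst x, 0, \<eta>0) + point_scale s ?v)"
      unfolding line by (intro holo_p disc_facts x) (use that in \<open>auto simp: dist_norm
        norm_minus_commute\<close>)
    then have "(\<lambda>s. p \<nu> (fst x, (complex_of_real (R \<nu>) * s / tau x) *s fst (snd x), \<eta>0))
      field_differentiable (at s)"
      using holo_at_line[of "p \<nu>" "(fst x, 0, \<eta>0)" s ?v] unfolding line by blast
    then have "kern \<nu> x field_differentiable at s"
      unfolding kern_def[abs_def]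
      by (intro derivative_intros) (auto intro!: derivative_intros field_differentiable_compose[of _
        _ exp, unfolded o_def] field_differentiable_within_exp)
    then show ?thesis by (rule field_differentiable_at_within)
  qed
  then have "kern \<nu> x holomorphic_on cball 1 \<epsilon>" by (simp add: holomorphic_on_def)
  from Cauchy_integral_circlepath_simple[OF this b1]
  have "((\<lambda>u. kern \<nu> x u / (u - b)) has_contour_integral 2 * of_real pi * \<i> * kern \<nu> x b) arc"
    by (simp add: arc_def)
  then have "((\<lambda>t. kern \<nu> x (arc t) / (arc t - b) * vector_derivative arc (at t)) has_integral 2 *
    of_real pi * \<i> * kern \<nu> x b) {0..1}"
    by (simp add: has_contour_integral)
  from has_integral_divide[OF this, of "2 * of_real pi * \<i>"]
  have "(g \<nu> x has_integral kern \<nu> x b) {0..1}" by (simp add: g_def[abs_def] b_def)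
  then have int: "integral {0..1} (g \<nu> x) = kern \<nu> x b" by (rule integral_unique)
  have io: "g \<nu> x integrable_on {c..e}" for c e
    by (intro integrable_continuous_interval g_continuous x) (use nz in \<open>auto simp: b_def\<close>)
  have "integral {0..1} (g \<nu> x) = integral {0..1/4} (g \<nu> x) + (integral {1/4..3/4} (g \<nu> x) +
    integral {3/4..1} (g \<nu> x))"
    using Henstock_Kurzweil_Integration.integral_combine[of 0 "1/4" 1 "g \<nu> x"]
      Henstock_Kurzweil_Integration.integral_combine[of "1/4" "3/4" 1 "g \<nu> x"] io by simp
  then have "JR \<nu> x + JL \<nu> x = kern \<nu> x b" using int by (simp add: JR_def JL_def)
  also have "\<dots> = pfix \<nu> x"
    using R U_facts(3)[OF x] by (simp add: kern_def pfix_def b_def)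
  finally show ?thesis .
qed

lemma holo_pfix:
  assumes x: "x \<in> U" and "R \<nu> / 2 \<le> Re (tau x)"
  shows "holo_at (pfix \<nu>) x"
  unfolding pfix_def[abs_def]
proof (rule holo_at_compose[where f = "p \<nu>" and D\<Phi> = "\<lambda>v. (fst v, fst (snd v), 0)"])
  show "((\<lambda>x. (fst x, fst (snd x), \<eta>0)) has_derivative (\<lambda>v. (fst v, fst (snd v), 0))) (at x)"
    by (intro derivative_intros)
  show "holo_at (p \<nu>) (fst x, fst (snd x), \<eta>0)"
  proof (intro holo_p cone_k_k0 x)
    have "real (\<nu> + 1) * D = R \<nu> / 2" by (simp add: R_def)
    then show "real (\<nu> + 1) * D \<le> maxnorm (fst (snd x))" using assms(2) U_facts(4)[OF x] by linarith
  qed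
qed (auto simp: point_scale_def)

lemma holo_q:
  assumes x: "x \<in> U"
  shows "holo_at (q \<nu>) x"
proof (cases "Re (tau x) < R \<nu> * (1 + \<epsilon>/4)")
  case True
  let ?V = "U \<inter> {x. Re (tau x) < R \<nu> * (1 + \<epsilon>/4)}"
  have V: "open ?V" by (intro open_Int open_U open_Collect_less continuous_intros)
  show ?thesis
  proof (rule holo_at_cong[OF holo_JR[OF x True] V])
    fix y assume y: "y \<in> ?V"
    have "R \<nu> * (1 - \<epsilon>/4) < R \<nu>" using par_facts(2) par_facts(10)[of \<nu>] by simp
    then show "JR \<nu> y = q \<nu> y" using overlap[of y \<nu>] y by (auto simp: q_def algebra_simps)
  qed (use x True in auto)
next
  case False
  have RR: "R \<nu> < R \<nu> * (1 + \<epsilon>/4)" "R \<nu> * (1 - \<epsilon>/4) < R \<nu>" "0 < R \<nu>" using par_facts(2)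
    par_facts(10)[of \<nu>] by simp_all
  have lt: "R \<nu> < Re (tau x)" using False RR by linarith
  let ?V = "U \<inter> {x. R \<nu> < Re (tau x)}"
  have V: "open ?V" by (intro open_Int open_U open_Collect_less continuous_intros)
  have "holo_at (\<lambda>x. pfix \<nu> x - JL \<nu> x) x"
    using False RR by (intro holo_at_diff holo_pfix holo_JL x) linarith+
  then show ?thesis
    by (rule holo_at_cong[OF _ V]) (use x lt in \<open>auto simp: q_def\<close>)
qed

text \<open>Up to a constant the integrand for \<open>p \<nu>\<close> is at most \<open>A\<^sup>\<nu> exp (l (\<nu> + 1)) exp (- \<delta> Re tau)\<close>,
  and \<open>A exp l = exp (- l)\<close>.\<close>

lemma JR_JL_bound:
  obtains C where "0 < C"
    "\<And>\<nu> x. x \<in> U \<Longrightarrow> Re (tau x) \<le> R \<nu> * (1 + \<epsilon>/4) \<Longrightarrow>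
      cmod (JR \<nu> x) \<le> C * exp (- l) ^ \<nu> * exp (- \<delta> * Re (tau x))"
    "\<And>\<nu> x. x \<in> U \<Longrightarrow> R \<nu> * (1 - \<epsilon>/4) \<le> Re (tau x) \<Longrightarrow>
      cmod (JL \<nu> x) \<le> C * exp (- l) ^ \<nu> * exp (- \<delta> * Re (tau x))"
proof -
  define h where "h = l / (8 * D * (M + 1))"
  have h: "h > 0" using par_facts(1,8) D by (simp add: h_def)
  obtain C1 where C1: "C1 > 0" "\<And>\<nu> z \<zeta>. cone k0 (z, \<zeta>) \<Longrightarrow> real (\<nu> + 1) * D \<le> maxnorm \<zeta> \<Longrightarrow>
       cmod (p \<nu> (z, \<zeta>, \<eta>0)) \<le> C1 * A ^ \<nu> * exp (h * maxnorm \<zeta>)"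
    using bound_p[OF h] by blast
  define B where "B = (\<lambda>\<nu> x. C1 * exp l * exp (- l) ^ \<nu> * exp (- \<delta> * Re (tau x)))"
  have kern: "cmod (kern \<nu> x s) \<le> B \<nu> x" if x: "x \<in> U" and s: "cmod (s - 1) \<le> \<epsilon>" for \<nu> x s
  proof -
    let ?\<zeta> = "(complex_of_real (R \<nu>) * s / tau x) *s fst (snd x)"
    have R: "R \<nu> > 0" by (rule par_facts)
    have "Re s \<le> 2" using s abs_Re_le_cmod[of "s - 1"] par_facts(3) by simp
    then have "\<delta> * (R \<nu> * Re s - Re (tau x)) \<le> \<delta> * (R \<nu> * 2 - Re (tau x))"
      using R par_facts(9) by (intro mult_left_mono diff_right_mono) auto
    then have 1: "cmod (exp (of_real \<delta> * (of_real (R \<nu>) * s - tau x))) \<le> exp (\<delta> * (R \<nu> * 2 - Re (tau x)))"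
      by (simp add: norm_exp_eq_Re)
    note df = disc_facts[OF x s, of \<nu>]
    have "cmod (p \<nu> (fst x, ?\<zeta>, \<eta>0)) \<le> C1 * A ^ \<nu> * exp (h * maxnorm ?\<zeta>)"
      by (intro C1 df)
    also have "\<dots> \<le> C1 * A ^ \<nu> * exp (h * (2 * R \<nu> * (M + 1)))"
      using df(3) h C1 A by (intro mult_left_mono) auto
    finally have "cmod (kern \<nu> x s) \<le> (C1 * A ^ \<nu> * exp (h * (2 * R \<nu> * (M + 1)))) * exp (\<delta> * (R \<nu> *
      2 - Re (tau x)))"
      unfolding kern_def norm_mult using 1 by (intro mult_mono) (use C1 A in auto)
    also have "\<dots> = B \<nu> x"
    proof -
      have aux: "l / (8 * D * K) * (2 * (2 * n * D) * K) = l * n / 2" if "0 < K" for K n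
        using that D by (simp add: field_simps)
      have aux': "l / (8 * D) * (2 * n * D * 2) = l * n / 2" for n
        using D by (simp add: field_simps)
      have 1: "h * (2 * R \<nu> * (M + 1)) = l * real (\<nu> + 1) / 2"
        unfolding h_def R_def by (rule aux) (use par_facts(1) in linarith)
      have 2: "\<delta> * (R \<nu> * 2) = l * real (\<nu> + 1) / 2"
        unfolding \<delta>_def R_def by (rule aux')
      have 3: "A ^ \<nu> = exp (real \<nu> * (- 2 * l))" 
        using arg_cong[OF par_facts(12), of "\<lambda>x. x ^ \<nu>"] exp_of_nat_mult[of \<nu> "- 2 * l"] by (rule
          trans[OF _ sym])
      have 4: "exp (- l) ^ \<nu> = exp (real \<nu> * (- l))" unfolding exp_of_nat_mult ..
      have "exp (real \<nu> * (- 2 * l)) * exp (l * real (\<nu> + 1) / 2) * exp (l * real (\<nu> + 1) / 2 - \<delta> *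
        Re (tau x))
          = exp l * exp (real \<nu> * (- l)) * exp (- \<delta> * Re (tau x))"
        unfolding exp_add[symmetric] by (simp add: algebra_simps)
      then show ?thesis unfolding B_def right_diff_distrib 1 2 3 4 by (simp only: mult.assoc)
    qed
    finally show ?thesis .
  qed
  have g: "cmod (g \<nu> x t) \<le> 4 * B \<nu> x" if x: "x \<in> U" and far:
    "\<epsilon>/4 \<le> cmod (arc t - tau x / of_real (R \<nu>))" for \<nu> x t
  proof -
    have "cmod (vector_derivative arc (at t) / (2 * of_real pi * \<i>)) = \<epsilon>"
      using par_facts(2) by (simp add: arc_deriv norm_mult norm_divide)
    then have "cmod (g \<nu> x t) = cmod (kern \<nu> x (arc t)) / cmod (arc t - tau x / of_real (R \<nu>)) * \<epsilon>"
      unfolding g_def by (simp only: times_divide_eq_right[symmetric] norm_mult norm_divide)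
    also have "\<dots> \<le> B \<nu> x / (\<epsilon>/4) * \<epsilon>"
      using kern[OF x, of "arc t" \<nu>] far par_facts(2) by (intro mult_right_mono frac_le) (auto simp:
        arc_norm B_def C1 less_imp_le)
    finally show ?thesis using par_facts(2) by simp
  qed
  have B0: "0 \<le> B \<nu> x" for \<nu> x using C1 by (simp add: B_def)
  have int: "cmod (integral {b..c} (g \<nu> x)) \<le> 4 * B \<nu> x * (c - b)"
    if x: "x \<in> U" and bc: "b \<le> c" and far: "\<And>t. t \<in> {b..c} \<Longrightarrow>
      \<epsilon>/4 \<le> cmod (arc t - tau x / of_real (R \<nu>))" for \<nu> x b c
  proof (rule integral_bound[OF bc])
    show "continuous_on {b..c} (g \<nu> x)"
      by (rule g_continuous[OF x]) (use far par_facts(2) in force)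
  qed (use g x far in auto)
  show thesis
  proof (rule that[of "4 * (C1 * exp l)"])
    fix \<nu> x assume x: "x \<in> U"
    { assume "Re (tau x) \<le> R \<nu> * (1 + \<epsilon>/4)"
      then have far: "\<epsilon>/4 \<le> cmod (arc t - tau x / of_real (R \<nu>))" if "t \<in> {0..1/4} \<union> {3/4..1}" for t
        using away_right[OF x _ arc_right[OF that]] by blast
      have "cmod (JR \<nu> x) \<le> 4 * B \<nu> x * (1/4 - 0) + 4 * B \<nu> x * (1 - 3/4)"
        unfolding JR_def by (intro order_trans[OF norm_triangle_ineq] add_mono int x) (use far in auto)
      also have "\<dots> \<le> 4 * B \<nu> x" using B0[of \<nu> x] by simp
      finally show "cmod (JR \<nu> x) \<le> 4 * (C1 * exp l) * exp (- l) ^ \<nu> * exp (- \<delta> * Re (tau x))"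
        by (simp add: B_def) }
    { assume "R \<nu> * (1 - \<epsilon>/4) \<le> Re (tau x)"
      then have far: "\<epsilon>/4 \<le> cmod (arc t - tau x / of_real (R \<nu>))" if "t \<in> {1/4..3/4}" for t
        using away_left[OF x _ arc_left[OF that]] by blast
      have "cmod (JL \<nu> x) \<le> 4 * B \<nu> x * (3/4 - 1/4)"
        unfolding JL_def by (intro int x) (use far in auto)
      also have "\<dots> \<le> 4 * B \<nu> x" using B0[of \<nu> x] by simp
      finally show "cmod (JL \<nu> x) \<le> 4 * (C1 * exp l) * exp (- l) ^ \<nu> * exp (- \<delta> * Re (tau x))"
        by (simp add: B_def) }
  qed (use C1 in auto)
qed

theorem resummation:
  obtains Q B L where "0 < B" "B < 1" "0 < L"
    "\<And>z \<zeta> \<eta>. cone k (z, \<zeta>) \<Longrightarrow> holo_at Q (z, \<zeta>, \<eta>)"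
    "\<And>z \<zeta> \<eta> \<eta>'. Q (z, \<zeta>, \<eta>) = Q (z, \<zeta>, \<eta>')"
    "\<And>h. 0 < h \<Longrightarrow> \<exists>C>0. \<forall>m z \<zeta> \<eta>. cone k (z, \<zeta>) \<longrightarrow> real m * L \<le> maxnorm \<zeta> \<longrightarrow>
       cmod (Q (z, \<zeta>, \<eta>) - (\<Sum>\<nu><m. p \<nu> (z, \<zeta>, \<eta>0))) \<le> C * B ^ m * exp (h * maxnorm \<zeta>)"
proof -
  obtain C1 where C1: "0 < C1"
    "\<And>\<nu> x. x \<in> U \<Longrightarrow> Re (tau x) \<le> R \<nu> * (1 + \<epsilon>/4) \<Longrightarrow>
      cmod (JR \<nu> x) \<le> C1 * exp (- l) ^ \<nu> * exp (- \<delta> * Re (tau x))"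
    "\<And>\<nu> x. x \<in> U \<Longrightarrow> R \<nu> * (1 - \<epsilon>/4) \<le> Re (tau x) \<Longrightarrow>
      cmod (JL \<nu> x) \<le> C1 * exp (- l) ^ \<nu> * exp (- \<delta> * Re (tau x))"
    using JR_JL_bound by metis
  define e where "e = exp (- l)"
  have e: "0 < e" "e < 1" using par_facts(8) by (auto simp: e_def)
  have RR: "R \<nu> \<le> R \<nu> * (1 + \<epsilon>/4)" "R \<nu> * (1 - \<epsilon>/4) \<le> R \<nu>" for \<nu> using par_facts(2) par_facts(10)[of
    \<nu>] by simp_all
  have JL: "cmod (JL \<nu> x) \<le> C1 * e ^ \<nu> * exp (- \<delta> * Re (tau x))" if "x \<in> U" "R \<nu> \<le> Re (tau x)" for \<nu> x
    using C1(3)[OF that(1), of \<nu>] RR(2)[of \<nu>] that(2) by (simp add: e_def)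
  have exp1: "C1 * e ^ \<nu> * exp (- \<delta> * Re (tau x)) \<le> C1 * e ^ \<nu>" if "x \<in> U" for \<nu> x
    using U_facts(1)[OF that] par_facts(9) C1(1) e mult_left_mono[of "exp (- \<delta> * Re (tau x))" 1
      "C1 * e ^ \<nu>"] by simp
  have q1: "cmod (q \<nu> x) \<le> C1 * e ^ \<nu>" if "x \<in> U" "Re (tau x) < R \<nu>" for \<nu> x
    using C1(2)[OF that(1), of \<nu>] RR(1)[of \<nu>] that(2) exp1[OF that(1), of \<nu>] by (simp add: q_def e_def)
  define Q where "Q = (\<lambda>x. \<Sum>\<nu>. q \<nu> x)"
  have R_large: "\<forall>\<^sub>F \<nu> in sequentially. T < R \<nu>" for T
  proof -
    obtain N where N: "T / (2 * D) < real N" using reals_Archimedean2 by blast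
    have "T < R \<nu>" if "N \<le> \<nu>" for \<nu>
    proof -
      have "T / (2 * D) < real (\<nu> + 1)" using N that by simp
      then show ?thesis using D by (simp add: R_def field_simps)
    qed
    then show ?thesis unfolding eventually_sequentially by blast
  qed
  have sum_e: "summable (\<lambda>\<nu>. C1 * e ^ \<nu>)" using e by (intro summable_mult summable_geometric) auto
  have summ: "summable (\<lambda>\<nu>. q \<nu> x)" if x: "x \<in> U" for x
    by (rule summable_comparison_test_ev[OF _ sum_e])
       (use R_large[of "Re (tau x)"] q1[OF x] in \<open>auto elim: eventually_mono\<close>)
  have holo_Q: "holo_at Q x" if x: "x \<in> U" for x
  proof -
    have V: "open (U \<inter> {y. Re (tau y) < Re (tau x) + 1})" by (intro open_Int open_U
      open_Collect_less continuous_intros)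
    have "x \<in> U \<inter> {y. Re (tau y) < Re (tau x) + 1}" using x by simp
    then obtain r where r: "r > 0" "ball x r \<subseteq> U \<inter> {y. Re (tau y) < Re (tau x) + 1}" by (rule openE[OF V])
    have "uniform_limit (ball x r) (\<lambda>n y. \<Sum>\<nu><n. q \<nu> y) (\<lambda>y. \<Sum>\<nu>. q \<nu> y) sequentially"
    proof (rule Weierstrass_m_test_ev[OF _ sum_e])
      show "\<forall>\<^sub>F \<nu> in sequentially. \<forall>y\<in>ball x r. norm (q \<nu> y) \<le> C1 * e ^ \<nu>"
        using R_large[of "Re (tau x) + 1"]
      proof eventually_elim
        case (elim \<nu>)
        then show ?case using r(2) q1[of _ \<nu>] by (auto intro!: q1)
      qed
    qed
    then show ?thesis unfolding Q_def
      by (rule holo_at_uniform_limit[rotated]) (use r in \<open>auto intro!: holo_at_sum holo_q\<close>)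
  qed
  define b where "b = exp (- l / 4)"
  have b: "0 < b" "b < 1" using par_facts(8) by (auto simp: b_def)
  have eb: "e \<le> b" using par_facts(8) by (simp add: e_def b_def)
  have "exp (- 2 * l) \<le> e" using par_facts(8) by (simp add: e_def)
  with par_facts(12) have Ae: "A \<le> e" by (rule ord_eq_le_trans)
  define L where "L = 2 * D * (M + 1)"
  have L: "L > 0" using D par_facts(1) by (simp add: L_def)
  have est: "\<exists>C>0. \<forall>m z \<zeta> \<eta>. cone k (z, \<zeta>) \<longrightarrow> real m * L \<le> maxnorm \<zeta> \<longrightarrow>
       cmod (Q (z, \<zeta>, \<eta>) - (\<Sum>\<nu><m. p \<nu> (z, \<zeta>, \<eta>0))) \<le> C * b ^ m * exp (h * maxnorm \<zeta>)" if h: "h > 0" for h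
  proof -
    obtain Ch where Ch: "Ch > 0" "\<And>\<nu> z \<zeta>. cone k0 (z, \<zeta>) \<Longrightarrow> real (\<nu> + 1) * D \<le> maxnorm \<zeta> \<Longrightarrow>
       cmod (p \<nu> (z, \<zeta>, \<eta>0)) \<le> Ch * A ^ \<nu> * exp (h * maxnorm \<zeta>)"
      using bound_p[OF h] by blast
    define C where "C = (2 * C1 + Ch) / (1 - e)"
    have "cmod (Q x - (\<Sum>\<nu><m. pfix \<nu> x)) \<le> C * b ^ m * exp (h * maxnorm (fst (snd x)))"
      if x: "x \<in> U" and m: "real m * L \<le> maxnorm (fst (snd x))" for m x
    proof -
      define E where "E = exp (h * maxnorm (fst (snd x)))"
      have E: "1 \<le> E" using h by (simp add: E_def)
      have "real m * (2 * D) * (M + 1) \<le> (M + 1) * Re (tau x)" using m U_facts(5)[OF x] by (simp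
        add: L_def mult_ac)
      then have tau_m: "real m * (2 * D) \<le> Re (tau x)" using par_facts(1) by (simp add: mult.commute)
      \<comment> \<open>The terms with \<open>\<nu> < m\<close> differ from \<open>p \<nu>\<close> by a left arc, exponentially small in \<open>m\<close>.\<close>
      have head: "cmod (q \<nu> x - pfix \<nu> x) \<le> C1 * e ^ \<nu> * b ^ m" if "\<nu> < m" for \<nu>
      proof -
        have "real (\<nu> + 1) * (2 * D) \<le> real m * (2 * D)" using that D by (intro mult_right_mono) auto
        then have le: "R \<nu> \<le> Re (tau x)" using tau_m by (simp add: R_def mult_ac)
        then have "cmod (q \<nu> x - pfix \<nu> x) = cmod (JL \<nu> x)" by (simp add: q_def)
        also have "\<dots> \<le> C1 * e ^ \<nu> * exp (- \<delta> * Re (tau x))" by (rule JL[OF x le])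
        also have "\<dots> \<le> C1 * e ^ \<nu> * b ^ m"
        proof (intro mult_left_mono)
          have "\<delta> * (real m * (2 * D)) \<le> \<delta> * Re (tau x)" using tau_m par_facts(9) by (intro
            mult_left_mono) auto
          moreover have "\<delta> * (real m * (2 * D)) = real m * (l / 4)" using D by (simp add: \<delta>_def
            field_simps)
          ultimately have "exp (- \<delta> * Re (tau x)) \<le> exp (real m * (- l / 4))" by simp
          then show "exp (- \<delta> * Re (tau x)) \<le> b ^ m" unfolding b_def exp_of_nat_mult .
        qed (use C1 e in auto)
        finally show ?thesis .
      qed
      \<comment> \<open>This bound holds for all \<open>\<nu>\<close> and is summed over \<open>\<nu> \<ge> m\<close>.\<close>
      have tail: "cmod (q \<nu> x) \<le> (C1 + Ch) * E * e ^ \<nu>" for \<nu>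
      proof (cases "Re (tau x) < R \<nu>")
        case True
        have "C1 * e ^ \<nu> * 1 \<le> C1 * e ^ \<nu> * E" using E C1 e by (intro mult_left_mono) auto
        moreover have "0 \<le> Ch * E * e ^ \<nu>" using Ch E e by simp
        ultimately show ?thesis using q1[OF x True] by (simp add: algebra_simps)
      next
        case False
        then have le: "R \<nu> \<le> Re (tau x)" by simp
        have "real (\<nu> + 1) * D \<le> R \<nu>" using D by (simp add: R_def)
        then have "cmod (pfix \<nu> x) \<le> Ch * A ^ \<nu> * E"
          unfolding pfix_def E_def using le U_facts(4)[OF x] by (intro Ch cone_k_k0 x) linarith
        also have "\<dots> \<le> Ch * e ^ \<nu> * E"
          using Ch E Ae A by (intro mult_right_mono mult_left_mono power_mono) auto
        finally have 1: "cmod (pfix \<nu> x) \<le> Ch * e ^ \<nu> * E" .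
        have "cmod (JL \<nu> x) \<le> C1 * e ^ \<nu>" using JL[OF x le] exp1[OF x, of \<nu>] by linarith
        also have "\<dots> \<le> C1 * e ^ \<nu> * E" using E C1 e by simp
        finally have "cmod (pfix \<nu> x) + cmod (JL \<nu> x) \<le> Ch * e ^ \<nu> * E + C1 * e ^ \<nu> * E" using 1 by
          linarith
        then show ?thesis using False norm_triangle_ineq4[of "pfix \<nu> x" "JL \<nu> x"] by (simp add:
          q_def algebra_simps)
      qed
      have split: "Q x = (\<Sum>\<nu>. q (\<nu> + m) x) + (\<Sum>\<nu><m. q \<nu> x)"
        unfolding Q_def by (rule suminf_split_initial_segment[OF summ[OF x]])
      have "cmod (\<Sum>\<nu><m. q \<nu> x - pfix \<nu> x) \<le> (\<Sum>\<nu><m. C1 * b ^ m * e ^ \<nu>)"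
        by (rule sum_norm_le) (use head in \<open>auto simp: mult_ac\<close>)
      also have "\<dots> = C1 * b ^ m * (\<Sum>\<nu><m. e ^ \<nu>)" by (simp add: sum_distrib_left)
      also have "\<dots> \<le> C1 * b ^ m * (1 / (1 - e))"
        using e C1 b by (intro mult_left_mono) (auto simp: sum_gp_strict divide_simps)
      finally have 1: "cmod (\<Sum>\<nu><m. q \<nu> x - pfix \<nu> x) \<le> C1 * b ^ m * (1 / (1 - e))" .
      have ge: "(\<lambda>\<nu>. (C1 + Ch) * E * e ^ (\<nu> + m)) sums ((C1 + Ch) * E * e ^ m * (1 / (1 - e)))"
        using sums_mult[OF geometric_sums[of e], of "(C1 + Ch) * E * e ^ m"] e by (simp add:
          power_add mult_ac)
      have "cmod (\<Sum>\<nu>. q (\<nu> + m) x) \<le> (\<Sum>\<nu>. (C1 + Ch) * E * e ^ (\<nu> + m))"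
        by (rule norm_suminf_le[OF tail sums_summable[OF ge]])
      also have "\<dots> = (C1 + Ch) * E * e ^ m * (1 / (1 - e))" using ge by (rule sums_unique[symmetric])
      also have "\<dots> \<le> (C1 + Ch) * E * b ^ m * (1 / (1 - e))"
        using eb e C1 Ch E by (intro mult_right_mono mult_left_mono power_mono) auto
      finally have 2: "cmod (\<Sum>\<nu>. q (\<nu> + m) x) \<le> (C1 + Ch) * E * b ^ m * (1 / (1 - e))" .
      have "Q x - (\<Sum>\<nu><m. pfix \<nu> x) = (\<Sum>\<nu>. q (\<nu> + m) x) + (\<Sum>\<nu><m. q \<nu> x - pfix \<nu> x)"
        by (simp add: split sum_subtractf)
      then have "cmod (Q x - (\<Sum>\<nu><m. pfix \<nu> x)) \<le>
        (C1 + Ch) * E * b ^ m * (1 / (1 - e)) + C1 * b ^ m * (1 / (1 - e))"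
        using norm_triangle_ineq[of "\<Sum>\<nu>. q (\<nu> + m) x" "\<Sum>\<nu><m. q \<nu> x - pfix \<nu> x"] 1 2 by simp
      also have "C1 * b ^ m * (1 / (1 - e)) \<le> C1 * E * b ^ m * (1 / (1 - e))"
        using E C1 b e by (intro mult_right_mono) auto
      also have "(C1 + Ch) * E * b ^ m * (1 / (1 - e)) + C1 * E * b ^ m * (1 / (1 - e)) = C * b ^ m * E"
        by (simp add: C_def add_divide_distrib algebra_simps)
      finally show ?thesis by (simp add: E_def)
    qed
    moreover have "C > 0" using C1 Ch e by (simp add: C_def)
    ultimately show ?thesis by (intro exI[of _ C]) (auto simp: U_def pfix_def)
  qed
  have indep: "q \<nu> (z, \<zeta>, \<eta>) = q \<nu> (z, \<zeta>, \<eta>')" for \<nu> z \<zeta> \<eta> \<eta>'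
    by (simp add: q_def JR_def JL_def pfix_def g_def[abs_def] kern_def tau_def)
  show thesis
  proof (rule that[OF b L _ _ est])
    show "holo_at Q (z, \<zeta>, \<eta>)" if "cone k (z, \<zeta>)" for z \<zeta> \<eta>
      by (rule holo_Q) (use that in \<open>simp add: U_def\<close>)
    show "Q (z, \<zeta>, \<eta>) = Q (z, \<zeta>, \<eta>')" for z \<zeta> \<eta> \<eta>'
      unfolding Q_def using indep[of _ z \<zeta> \<eta> \<eta>'] by presburger
  qed
qed

end


section \<open>Spaces of series defined by growth conditions\<close>

text \<open>The common shape of all growth conditions: there is a constant \<open>A\<close> in \<open>I\<close> such that on every
  relatively compact \<open>Z\<close> and for every \<open>h > 0\<close> the functions \<open>f m\<close> are bounded by a multiple of the
  weight \<open>w A h m\<close> on \<open>D Z m\<close>.\<close>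

definition growth ::
  "(real \<Rightarrow> real \<Rightarrow> nat \<Rightarrow> 'n::finite point \<Rightarrow> real) \<Rightarrow> real set \<Rightarrow> (complex set \<Rightarrow> nat \<Rightarrow> 'n point set) \<Rightarrow>
   complex set \<Rightarrow> (nat \<Rightarrow> 'n symb) \<Rightarrow> bool" where
  "growth w I D S f \<longleftrightarrow> (\<exists>A\<in>I. \<forall>Z. \<forall>h>0. rel_compact_in Z S \<longrightarrow>
     (\<exists>C>0. \<forall>m. \<forall>p\<in>D Z m. cmod (f m p) \<le> C * w A h m p))"

lemma growthI:
  assumes "A \<in> I"
    and "\<And>Z h. 0 < h \<Longrightarrow> rel_compact_in Z S \<Longrightarrow> \<exists>C>0. \<forall>m. \<forall>p\<in>D Z m. cmod (f m p) \<le> C * w A h m p"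
  shows "growth w I D S f"
  unfolding growth_def using assms by (intro bexI[of _ A]) auto

lemma growthD:
  assumes "growth w I D S f"
  shows "\<exists>A. A \<in> I \<and> (\<forall>Z. \<forall>h>0. rel_compact_in Z S \<longrightarrow> (\<exists>C>0. \<forall>m. \<forall>p\<in>D Z m. cmod (f m p) \<le> C * w A h m p))"
  using assms unfolding growth_def by (simp only: Bex_def)

lemma growth_mono:
  assumes "growth w I D S f" "S' \<subseteq> S" "\<And>Z m. D' Z m \<subseteq> D Z m"
  shows "growth w I D' S' f"
  using assms(1) rel_compact_in_mono[OF _ assms(2)] assms(3) unfolding growth_def by (meson subsetD)

lemma growth_cong:
  assumes "growth w I D S f" "\<And>Z m p. rel_compact_in Z S \<Longrightarrow> p \<in> D Z m \<Longrightarrow> f m p = g m p"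
  shows "growth w I D S g"
  using assms unfolding growth_def by metis

lemma growth_add:
  assumes "growth w I D S f" "growth w I D S g"
    and dir: "\<And>A B. A \<in> I \<Longrightarrow> B \<in> I \<Longrightarrow> \<exists>C\<in>I. \<forall>h m p. w A h m p \<le> w C h m p \<and> w B h m p \<le> w C h m p"
  shows "growth w I D S (\<lambda>m p. f m p + g m p)"
proof -
  obtain A where A: "A \<in> I" "\<And>Z h. h > 0 \<Longrightarrow> rel_compact_in Z S \<Longrightarrow>
    \<exists>C>0. \<forall>m. \<forall>p\<in>D Z m. cmod (f m p) \<le> C * w A h m p"
    using assms(1) unfolding growth_def by blast
  obtain B where B: "B \<in> I" "\<And>Z h. h > 0 \<Longrightarrow> rel_compact_in Z S \<Longrightarrow>
    \<exists>C>0. \<forall>m. \<forall>p\<in>D Z m. cmod (g m p) \<le> C * w B h m p"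
    using assms(2) unfolding growth_def by blast
  obtain E where E: "E \<in> I" "\<And>h m p. w A h m p \<le> w E h m p" "\<And>h m p. w B h m p \<le> w E h m p"
    using dir[OF A(1) B(1)] by blast
  show ?thesis unfolding growth_def
  proof (intro bexI[OF _ E(1)] allI impI)
    fix Z h assume hZ: "(h::real) > 0" "rel_compact_in Z S"
    obtain C1 C2 where C: "C1 > 0" "\<And>m p. p \<in> D Z m \<Longrightarrow> cmod (f m p) \<le> C1 * w A h m p"
        "C2 > 0" "\<And>m p. p \<in> D Z m \<Longrightarrow> cmod (g m p) \<le> C2 * w B h m p"
      using A(2)[OF hZ] B(2)[OF hZ] by blast
    have "cmod (f m p + g m p) \<le> (C1 + C2) * w E h m p" if "p \<in> D Z m" for m p
    proof -
      have "C1 * w A h m p \<le> C1 * w E h m p" "C2 * w B h m p \<le> C2 * w E h m p"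
        using E C by (intro mult_left_mono; simp)+
      then show ?thesis
        using C(2)[OF that] C(4)[OF that] norm_triangle_ineq[of "f m p" "g m p"] unfolding
          distrib_right by linarith
    qed
    then show "\<exists>C>0. \<forall>m. \<forall>p\<in>D Z m. cmod (f m p + g m p) \<le> C * w E h m p"
      using C by (intro exI[of _ "C1 + C2"]) auto
  qed
qed

lemma growth_scale:
  assumes "growth w I D S f" and w: "\<And>A h m p. A \<in> I \<Longrightarrow> 0 \<le> w A h m p"
  shows "growth w I D S (\<lambda>m p. c * f m p)"
proof -
  obtain A where A: "A \<in> I" "\<And>Z h. h > 0 \<Longrightarrow> rel_compact_in Z S \<Longrightarrow>
    \<exists>C>0. \<forall>m. \<forall>p\<in>D Z m. cmod (f m p) \<le> C * w A h m p"
    using assms(1) unfolding growth_def by blast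
  show ?thesis unfolding growth_def
  proof (intro bexI[OF _ A(1)] allI impI)
    fix Z h assume hZ: "(h::real) > 0" "rel_compact_in Z S"
    obtain C where C: "C > 0" "\<And>m p. p \<in> D Z m \<Longrightarrow> cmod (f m p) \<le> C * w A h m p"
      using A(2)[OF hZ] by blast
    have "cmod (c * f m p) \<le> ((cmod c + 1) * C) * w A h m p" if "p \<in> D Z m" for m p
    proof -
      have "cmod (c * f m p) \<le> (cmod c + 1) * cmod (f m p)" unfolding norm_mult by (intro
        mult_right_mono) auto
      also have "\<dots> \<le> (cmod c + 1) * (C * w A h m p)" using C(2)[OF that] by (intro mult_left_mono) auto
      finally show ?thesis by (simp only: mult.assoc)
    qed
    then show "\<exists>C>0. \<forall>m. \<forall>p\<in>D Z m. cmod (c * f m p) \<le> C * w A h m p"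
      using C by (intro exI[of _ "(cmod c + 1) * C"] conjI) (auto intro!: mult_pos_pos add_nonneg_pos)
  qed
qed

lemma growth_zero:
  assumes "I \<noteq> {}" and w: "\<And>A h m p. A \<in> I \<Longrightarrow> 0 \<le> w A h m p"
  shows "growth w I D S (\<lambda>m p. 0)"
proof -
  obtain A where "A \<in> I" using assms(1) by blast
  then show ?thesis unfolding growth_def
    by (intro bexI[of _ A] allI impI exI[of _ "1::real"] conjI ballI) (simp_all add: w)
qed

text \<open>The sum of the terms of a series with indices in \<open>J m\<close>. The cases of interest are partial
  sums, \<open>J m = {..<m}\<close>, single terms, \<open>J m = {m}\<close>, and the term of degree \<open>0\<close>, \<open>J m = {0}\<close>.\<close>

definition partial :: "(nat \<Rightarrow> nat set) \<Rightarrow> 'n::finite series \<Rightarrow> nat \<Rightarrow> 'n symb" where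
  "partial J P m p = (\<Sum>\<nu>\<in>J m. fps_nth P \<nu> p)"

lemma series_scale_nth [simp]: "fps_nth (series_scale c P) \<nu> p = c * fps_nth P \<nu> p"
  by (simp add: series_scale_def symb_scale_def)

lemma partial_linear:
  "partial J (P + Q) = (\<lambda>m p. partial J P m p + partial J Q m p)"
  "partial J (series_scale c P) = (\<lambda>m p. c * partial J P m p)"
  "partial J 0 = (\<lambda>m p. 0)"
  by (simp_all add: fun_eq_iff partial_def sum.distrib sum_distrib_left)

lemma holomorphic_near_subset: "holomorphic_near P B \<Longrightarrow> A \<subseteq> B \<Longrightarrow> holomorphic_near P A"
  unfolding holomorphic_near_def by (meson subset_trans)

lemma holomorphic_near_holo_at: "holomorphic_near P A \<Longrightarrow> p \<in> A \<Longrightarrow> holo_at P p"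
  unfolding holomorphic_near_iff by blast

lemma holomorphic_near_d_eta: "holomorphic_near P A \<Longrightarrow> holomorphic_near (d_eta P) A"
  unfolding holomorphic_near_iff using holo_at_d_eta by metis

lemma holomorphic_near_add: "holomorphic_near P A \<Longrightarrow> holomorphic_near Q A \<Longrightarrow> holomorphic_near (P + Q) A"
  unfolding holomorphic_near_iff plus_fun_def
  apply clarify
  subgoal for V W by (rule exI[of _ "V \<inter> W"]) (auto intro: holo_at_add)
  done

lemma holomorphic_near_scale: "holomorphic_near P A \<Longrightarrow> holomorphic_near (symb_scale c P) A"
  unfolding holomorphic_near_iff symb_scale_def using holo_at_cmult by blast

lemma holomorphic_near_zero: "holomorphic_near 0 A"
  unfolding holomorphic_near_iff zero_fun_def using open_UNIV by blast

lemma common_params: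
  fixes d1 d2 \<rho>1 \<rho>2 :: real
  assumes "0 < d1" "0 < d2" "0 < \<rho>1" "\<rho>1 < 1" "0 < \<rho>2" "\<rho>2 < 1"
  obtains d \<rho> where "0 < d" "0 < \<rho>" "\<rho> < 1" "d1 \<le> d" "d2 \<le> d" "\<rho> \<le> \<rho>1" "\<rho> \<le> \<rho>2"
  using that[of "max d1 d2" "min \<rho>1 \<rho>2"] assms by auto

text \<open>All representatives of germs at \<open>z0\<close>.\<close>

definition total_at :: "'n::finite cotangent \<Rightarrow> ('n cotangent set \<Rightarrow> complex set \<Rightarrow> 'f set) \<Rightarrow> 'f set" where
  "total_at z0 F = (\<Union>\<Omega>\<in>conic_nhds z0. \<Union>S\<in>sectors. F \<Omega> S)"

text \<open>The three kinds of symbols treated uniformly. The term of index \<open>\<nu>\<close> of a series is holomorphic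
  near \<open>H \<Omega> S d \<rho> \<nu>\<close>. Null series satisfy the growth condition with the sums over \<open>JN\<close>, the weight
  \<open>wN\<close> and the domains \<open>DN\<close>; symbols satisfy the one with \<open>JS\<close>, \<open>wS\<close>, \<open>DS\<close>, and their \<open>\<eta>\<close>-derivative
  is null. The axioms \<open>DN_move\<close> and \<open>wN_move\<close> say that the null condition survives a displacement of
  \<open>\<eta>\<close> that at most halves \<open>cmod \<eta>\<close>, at the expense of doubling \<open>d\<close> and changing \<open>A\<close>; they make
  Cauchy's estimate in \<open>\<eta>\<close> possible.\<close>

locale symbol_kind =
  fixes H :: "'n::finite cotangent set \<Rightarrow> complex set \<Rightarrow> real \<Rightarrow> real \<Rightarrow> nat \<Rightarrow> 'n point set"
    and I :: "real set"
    and JN :: "nat \<Rightarrow> nat set" and wN :: "real \<Rightarrow> real \<Rightarrow> nat \<Rightarrow> 'n point \<Rightarrow> real"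
    and DN :: "'n cotangent set \<Rightarrow> real \<Rightarrow> real \<Rightarrow> complex set \<Rightarrow> nat \<Rightarrow> 'n point set"
    and JS :: "nat \<Rightarrow> nat set" and wS :: "real \<Rightarrow> real \<Rightarrow> nat \<Rightarrow> 'n point \<Rightarrow> real"
    and DS :: "'n cotangent set \<Rightarrow> real \<Rightarrow> real \<Rightarrow> complex set \<Rightarrow> nat \<Rightarrow> 'n point set"
  assumes H_mono: "\<And>\<Omega> \<Omega>' U U' d d' \<rho> \<rho>' \<nu>. \<lbrakk>\<Omega>' \<subseteq> \<Omega>; U' \<subseteq> U; 0 < d; d \<le> d'; \<rho>' \<le> \<rho>; \<rho> < 1\<rbrakk> \<Longrightarrow>
    H \<Omega>' U' d' \<rho>' \<nu> \<subseteq> H \<Omega> U d \<rho> \<nu>"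
    and DN_mono: "\<And>\<Omega> \<Omega>' U d d' \<rho> \<rho>' m. \<lbrakk>\<Omega>' \<subseteq> \<Omega>; 0 < d; d \<le> d'; \<rho>' \<le> \<rho>; \<rho> < 1\<rbrakk> \<Longrightarrow>
      DN \<Omega>' d' \<rho>' U m \<subseteq> DN \<Omega> d \<rho> U m"
    and DS_mono: "\<And>\<Omega> \<Omega>' U d d' \<rho> \<rho>' m. \<lbrakk>\<Omega>' \<subseteq> \<Omega>; 0 < d; d \<le> d'; \<rho>' \<le> \<rho>; \<rho> < 1\<rbrakk> \<Longrightarrow>
      DS \<Omega>' d' \<rho>' U m \<subseteq> DS \<Omega> d \<rho> U m"
    and JN_dom: "\<And>\<Omega> d \<rho> Z S m \<nu>. \<lbrakk>Z \<subseteq> S; 0 < d; \<rho> < 1; \<nu> \<in> JN m\<rbrakk> \<Longrightarrow> DN \<Omega> d \<rho> Z m \<subseteq> H \<Omega> S d \<rho> \<nu>"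
    and I_ne: "I \<noteq> {}"
    and wN_nonneg: "\<And>A h m p. A \<in> I \<Longrightarrow> 0 \<le> wN A h m p"
    and wS_nonneg: "\<And>A h m p. A \<in> I \<Longrightarrow> 0 \<le> wS A h m p"
    and wN_dir: "\<And>A B. A \<in> I \<Longrightarrow> B \<in> I \<Longrightarrow> \<exists>C\<in>I. \<forall>h m p. wN A h m p \<le> wN C h m p \<and> wN B h m p \<le> wN C h m p"
    and wS_dir: "\<And>A B. A \<in> I \<Longrightarrow> B \<in> I \<Longrightarrow> \<exists>C\<in>I. \<forall>h m p. wS A h m p \<le> wS C h m p \<and> wS B h m p \<le> wS C h m p"
    and DN_move: "\<And>\<Omega> d \<rho> Z Z' m z \<zeta> \<eta> w. \<lbrakk>(z, \<zeta>, \<eta>) \<in> DN \<Omega> (2 * d) \<rho> Z m; w \<in> Z';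
      cmod \<eta> / 2 \<le> cmod w; 0 < d; \<rho> < 1\<rbrakk>
         \<Longrightarrow> (z, \<zeta>, w) \<in> DN \<Omega> d \<rho> Z' m"
    and DN_eta: "\<And>\<Omega> d \<rho> Z m z \<zeta> \<eta>. (z, \<zeta>, \<eta>) \<in> DN \<Omega> d \<rho> Z m \<Longrightarrow> \<eta> \<in> Z"
    and wN_move: "\<And>A. A \<in> I \<Longrightarrow> \<exists>A'\<in>I. \<forall>h m z \<zeta> \<eta> w. \<eta> \<noteq> 0 \<longrightarrow> cmod \<eta> / 2 \<le> cmod w \<longrightarrow>
      wN A h m (z, \<zeta>, w) \<le> wN A' h m (z, \<zeta>, \<eta>)"
    and null_growth_symbol: "\<And>\<Omega> d \<rho> S P. \<lbrakk>S \<in> sectors; 0 < d; 0 < \<rho>; \<rho> < 1;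
      growth wN I (DN \<Omega> d \<rho>) S (partial JN P)\<rbrakk>
         \<Longrightarrow> growth wS I (DS \<Omega> d \<rho>) S (partial JS P)"
begin

definition holo_on :: "'n cotangent set \<Rightarrow> complex set \<Rightarrow> real \<Rightarrow> real \<Rightarrow> 'n series \<Rightarrow> bool" where
  "holo_on \<Omega> S d \<rho> P \<longleftrightarrow> (\<forall>\<nu>. holomorphic_near (fps_nth P \<nu>) (H \<Omega> S d \<rho> \<nu>))"

text \<open>The defining conditions with fixed \<open>d\<close> and \<open>\<rho>\<close>. In \<open>symbol_at\<close> the same \<open>d\<close> and \<open>\<rho>\<close> serve for
  the symbol and its derivative; lemma \<open>syms_eq\<close> shows that this is no restriction.\<close>

definition null_at :: "'n cotangent set \<Rightarrow> complex set \<Rightarrow> real \<Rightarrow> real \<Rightarrow> 'n series \<Rightarrow> bool" where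
  "null_at \<Omega> S d \<rho> P \<longleftrightarrow> holo_on \<Omega> S d \<rho> P \<and> growth wN I (DN \<Omega> d \<rho>) S (partial JN P)"

definition symbol_at :: "'n cotangent set \<Rightarrow> complex set \<Rightarrow> real \<Rightarrow> real \<Rightarrow> 'n series \<Rightarrow> bool" where
  "symbol_at \<Omega> S d \<rho> P \<longleftrightarrow> holo_on \<Omega> S d \<rho> P \<and> growth wS I (DS \<Omega> d \<rho>) S (partial JS P) \<and>
     growth wN I (DN \<Omega> d \<rho>) S (partial JN (series_d_eta P))"

definition nulls :: "'n cotangent set \<Rightarrow> complex set \<Rightarrow> 'n series set" where
  "nulls \<Omega> S = {P. \<exists>d>0. \<exists>\<rho>. 0 < \<rho> \<and> \<rho> < 1 \<and> null_at \<Omega> S d \<rho> P}"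

definition syms :: "'n cotangent set \<Rightarrow> complex set \<Rightarrow> 'n series set" where
  "syms \<Omega> S = {P. series_d_eta P \<in> nulls \<Omega> S \<and> (\<exists>d>0. \<exists>\<rho>. 0 < \<rho> \<and> \<rho> < 1 \<and>
     holo_on \<Omega> S d \<rho> P \<and> growth wS I (DS \<Omega> d \<rho>) S (partial JS P))}"

text \<open>Equality of germs.\<close>

definition geq :: "'n cotangent \<Rightarrow> 'n series \<Rightarrow> 'n series \<Rightarrow> bool" where
  "geq z0 P Q \<longleftrightarrow> (\<exists>\<Omega>\<in>conic_nhds z0. \<exists>S\<in>sectors. \<exists>d>0. \<exists>\<rho>. 0 < \<rho> \<and> \<rho> < 1 \<and>
     (\<forall>\<nu>. \<forall>p\<in>H \<Omega> S d \<rho> \<nu>. fps_nth P \<nu> p = fps_nth Q \<nu> p))"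

context
  fixes \<Omega> \<Omega>' :: "'n cotangent set" and S S' :: "complex set" and d d' \<rho> \<rho>' :: real
  assumes shrink: "\<Omega>' \<subseteq> \<Omega>" "S' \<subseteq> S" "0 < d" "d \<le> d'" "\<rho>' \<le> \<rho>" "\<rho> < 1"
begin

lemma holo_on_mono: "holo_on \<Omega> S d \<rho> P \<Longrightarrow> holo_on \<Omega>' S' d' \<rho>' P"
  unfolding holo_on_def using holomorphic_near_subset H_mono[OF shrink] by blast

lemma growth_N_mono: "growth wN I (DN \<Omega> d \<rho>) S f \<Longrightarrow> growth wN I (DN \<Omega>' d' \<rho>') S' f"
  by (erule growth_mono[OF _ shrink(2) DN_mono[OF shrink(1,3-6)]])

lemma growth_S_mono: "growth wS I (DS \<Omega> d \<rho>) S f \<Longrightarrow> growth wS I (DS \<Omega>' d' \<rho>') S' f"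
  by (erule growth_mono[OF _ shrink(2) DS_mono[OF shrink(1,3-6)]])

lemma null_at_mono: "null_at \<Omega> S d \<rho> P \<Longrightarrow> null_at \<Omega>' S' d' \<rho>' P"
  unfolding null_at_def using holo_on_mono growth_N_mono by blast

lemma symbol_at_mono: "symbol_at \<Omega> S d \<rho> P \<Longrightarrow> symbol_at \<Omega>' S' d' \<rho>' P"
  unfolding symbol_at_def using holo_on_mono growth_N_mono growth_S_mono by blast

end

lemma holo_on_d_eta: "holo_on \<Omega> S d \<rho> P \<Longrightarrow> holo_on \<Omega> S d \<rho> (series_d_eta P)"
  unfolding holo_on_def series_d_eta_def by (simp add: holomorphic_near_d_eta)

lemma syms_eq: "syms \<Omega> S = {P. \<exists>d>0. \<exists>\<rho>. 0 < \<rho> \<and> \<rho> < 1 \<and> symbol_at \<Omega> S d \<rho> P}" (is "_ = ?R")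
proof (intro equalityI subsetI)
  fix P assume "P \<in> syms \<Omega> S"
  then obtain d1 \<rho>1 d2 \<rho>2 where *: "0 < d1" "0 < \<rho>1" "\<rho>1 < 1" "null_at \<Omega> S d1 \<rho>1 (series_d_eta P)"
    "0 < d2" "0 < \<rho>2" "\<rho>2 < 1" "holo_on \<Omega> S d2 \<rho>2 P" "growth wS I (DS \<Omega> d2 \<rho>2) S (partial JS P)"
    unfolding syms_def nulls_def by blast
  obtain d \<rho> where c: "0 < d" "0 < \<rho>" "\<rho> < 1" "d1 \<le> d" "d2 \<le> d" "\<rho> \<le> \<rho>1" "\<rho> \<le> \<rho>2"
    using common_params[OF *(1,5,2,3,6,7)] by blast
  have "symbol_at \<Omega> S d \<rho> P"
    unfolding symbol_at_def
  proof (intro conjI)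
    show "holo_on \<Omega> S d \<rho> P" by (rule holo_on_mono[OF order_refl order_refl *(5) c(5,7) *(7,8)])
    show "growth wS I (DS \<Omega> d \<rho>) S (partial JS P)" by (rule growth_S_mono[OF order_refl order_refl
      *(5) c(5,7) *(7,9)])
    show "growth wN I (DN \<Omega> d \<rho>) S (partial JN (series_d_eta P))"
      using null_at_mono[OF order_refl order_refl *(1) c(4,6) *(3,4)] by (simp add: null_at_def)
  qed
  then show "P \<in> ?R" using c by blast
next
  fix P assume "P \<in> ?R"
  then obtain d \<rho> where *: "0 < d" "0 < \<rho>" "\<rho> < 1" "symbol_at \<Omega> S d \<rho> P" by blast
  then have "null_at \<Omega> S d \<rho> (series_d_eta P)" by (simp add: null_at_def symbol_at_def holo_on_d_eta)
  then show "P \<in> syms \<Omega> S" using * unfolding syms_def nulls_def symbol_at_def by blast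
qed

lemma partial_d_eta:
  assumes "holo_on \<Omega> S d \<rho> P" "p \<in> DN \<Omega> d \<rho> Z m" "Z \<subseteq> S" "0 < d" "\<rho> < 1"
  shows "\<And>\<nu>. \<nu> \<in> JN m \<Longrightarrow> holo_at (fps_nth P \<nu>) p"
    and "partial JN (series_d_eta P) m p = d_eta (partial JN P m) p"
proof -
  show 1: "holo_at (fps_nth P \<nu>) p" if "\<nu> \<in> JN m" for \<nu>
    using assms JN_dom[OF assms(3,4,5) that] holomorphic_near_holo_at unfolding holo_on_def by blast
  have "d_eta (partial JN P m) p = (\<Sum>\<nu>\<in>JN m. d_eta (fps_nth P \<nu>) p)"
    unfolding partial_def[abs_def] by (rule d_eta_sum[OF 1])
  then show "partial JN (series_d_eta P) m p = d_eta (partial JN P m) p"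
    by (simp add: partial_def series_d_eta_def)
qed

lemma holo_on_add: "holo_on \<Omega> S d \<rho> P \<Longrightarrow> holo_on \<Omega> S d \<rho> Q \<Longrightarrow> holo_on \<Omega> S d \<rho> (P + Q)"
  by (simp add: holo_on_def holomorphic_near_add)

lemma holo_on_scale: "holo_on \<Omega> S d \<rho> P \<Longrightarrow> holo_on \<Omega> S d \<rho> (series_scale c P)"
  by (simp add: holo_on_def holomorphic_near_scale series_scale_def)

lemma null_at_add: "null_at \<Omega> S d \<rho> P \<Longrightarrow> null_at \<Omega> S d \<rho> Q \<Longrightarrow> null_at \<Omega> S d \<rho> (P + Q)"
  unfolding null_at_def partial_linear by (intro conjI holo_on_add growth_add[OF _ _ wN_dir]) blast+

lemma null_at_scale: "null_at \<Omega> S d \<rho> P \<Longrightarrow> null_at \<Omega> S d \<rho> (series_scale c P)"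
  unfolding null_at_def partial_linear by (intro conjI holo_on_scale growth_scale[OF _ wN_nonneg]) blast+

lemma null_at_zero: "null_at \<Omega> S d \<rho> 0"
  unfolding null_at_def partial_linear holo_on_def
  by (intro conjI growth_zero[OF I_ne wN_nonneg]) (simp_all add: holomorphic_near_zero)

lemma symbol_at_add:
  assumes "symbol_at \<Omega> S d \<rho> P" "symbol_at \<Omega> S d \<rho> Q" "0 < d" "\<rho> < 1"
  shows "symbol_at \<Omega> S d \<rho> (P + Q)"
  unfolding symbol_at_def
proof (intro conjI)
  have hP: "holo_on \<Omega> S d \<rho> P" and hQ: "holo_on \<Omega> S d \<rho> Q" using assms by (auto simp: symbol_at_def)
  show "holo_on \<Omega> S d \<rho> (P + Q)" by (rule holo_on_add[OF hP hQ])
  show "growth wS I (DS \<Omega> d \<rho>) S (partial JS (P + Q))"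
    unfolding partial_linear by (rule growth_add[OF _ _ wS_dir]) (use assms(1,2) in \<open>simp_all add:
      symbol_at_def\<close>)
  have "growth wN I (DN \<Omega> d \<rho>) S (\<lambda>m p. partial JN (series_d_eta P) m p + partial JN (series_d_eta
    Q) m p)"
    by (rule growth_add[OF _ _ wN_dir]) (use assms(1,2) in \<open>simp_all add: symbol_at_def\<close>)
  then show "growth wN I (DN \<Omega> d \<rho>) S (partial JN (series_d_eta (P + Q)))"
  proof (rule growth_cong)
    fix Z m p assume Z: "rel_compact_in Z S" and p: "p \<in> DN \<Omega> d \<rho> Z m"
    note ZS = rel_compact_in_subset[OF Z]
    show "partial JN (series_d_eta P) m p + partial JN (series_d_eta Q) m p =
      partial JN (series_d_eta (P + Q)) m p"
      using partial_d_eta(1)[OF hP p ZS assms(3,4)] partial_d_eta(1)[OF hQ p ZS assms(3,4)]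
      by (simp add: partial_def series_d_eta_def d_eta_linear sum.distrib)
  qed
qed

lemma symbol_at_scale:
  assumes "symbol_at \<Omega> S d \<rho> P" "0 < d" "\<rho> < 1"
  shows "symbol_at \<Omega> S d \<rho> (series_scale c P)"
  unfolding symbol_at_def
proof (intro conjI)
  have hP: "holo_on \<Omega> S d \<rho> P" using assms by (auto simp: symbol_at_def)
  show "holo_on \<Omega> S d \<rho> (series_scale c P)" by (rule holo_on_scale[OF hP])
  show "growth wS I (DS \<Omega> d \<rho>) S (partial JS (series_scale c P))"
    unfolding partial_linear by (rule growth_scale[OF _ wS_nonneg]) (use assms(1) in \<open>simp_all add:
      symbol_at_def\<close>)
  have "growth wN I (DN \<Omega> d \<rho>) S (\<lambda>m p. c * partial JN (series_d_eta P) m p)"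
    by (rule growth_scale[OF _ wN_nonneg]) (use assms(1) in \<open>simp_all add: symbol_at_def\<close>)
  then show "growth wN I (DN \<Omega> d \<rho>) S (partial JN (series_d_eta (series_scale c P)))"
  proof (rule growth_cong)
    fix Z m p assume Z: "rel_compact_in Z S" and p: "p \<in> DN \<Omega> d \<rho> Z m"
    note ZS = rel_compact_in_subset[OF Z]
    show "c * partial JN (series_d_eta P) m p = partial JN (series_d_eta (series_scale c P)) m p"
      using partial_d_eta(1)[OF hP p ZS assms(2,3)]
      by (simp add: partial_def series_d_eta_def series_scale_def d_eta_scale sum_distrib_left)
  qed
qed

text \<open>The \<open>\<eta>\<close>-derivative of a null series is null, by Cauchy's estimate on discs in the sector.\<close>

lemma null_growth_d_eta:
  assumes S: "S \<in> sectors" and d: "0 < d" "\<rho> < 1" and N: "null_at \<Omega> S d \<rho> P"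
  shows "growth wN I (DN \<Omega> (2 * d) \<rho>) S (partial JN (series_d_eta P))"
proof -
  obtain A where A: "A \<in> I" "\<And>Z h. h > 0 \<Longrightarrow> rel_compact_in Z S \<Longrightarrow>
    \<exists>C>0. \<forall>m. \<forall>p\<in>DN \<Omega> d \<rho> Z m. cmod (partial JN P m p) \<le> C * wN A h m p"
    using N unfolding null_at_def growth_def by blast
  obtain A' where A': "A' \<in> I" "\<And>h m z \<zeta> \<eta> w. \<eta> \<noteq> 0 \<Longrightarrow> cmod \<eta> / 2 \<le> cmod w \<Longrightarrow>
    wN A h m (z, \<zeta>, w) \<le> wN A' h m (z, \<zeta>, \<eta>)"
    using wN_move[OF A(1)] by blast
  have holo: "holo_on \<Omega> S d \<rho> P" using N by (simp add: null_at_def)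
  show ?thesis unfolding growth_def
  proof (intro bexI[OF _ A'(1)] allI impI)
    fix Z h assume h: "(h::real) > 0" and Z: "rel_compact_in Z S"
    obtain s Z' where s: "0 < s" "rel_compact_in Z' S"
      "\<And>\<eta> w. \<eta> \<in> Z \<Longrightarrow> w \<in> cball \<eta> s \<Longrightarrow> w \<in> Z' \<and> cmod \<eta> / 2 \<le> cmod w"
      using sector_shrink[OF S Z] by metis
    obtain C where C: "C > 0" "\<And>m p. p \<in> DN \<Omega> d \<rho> Z' m \<Longrightarrow> cmod (partial JN P m p) \<le> C * wN A h m p"
      using A(2)[OF h s(2)] by blast
    have "cmod (partial JN (series_d_eta P) m (z, \<zeta>, \<eta>)) \<le> C / s * wN A' h m (z, \<zeta>, \<eta>)"
      if p: "(z, \<zeta>, \<eta>) \<in> DN \<Omega> (2 * d) \<rho> Z m" for z \<zeta> \<eta> m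
    proof -
      have \<eta>: "\<eta> \<in> Z" by (rule DN_eta[OF p])
      have "\<eta> \<noteq> 0" using \<eta> rel_compact_in_subset[OF Z] sectors_zero[OF S] by blast
      have w: "(z, \<zeta>, w) \<in> DN \<Omega> d \<rho> Z' m" if "w \<in> cball \<eta> s" for w
        using s(3)[OF \<eta> that] by (intro DN_move[OF p _ _ d]) auto
      let ?f = "\<lambda>w. partial JN P m (z, \<zeta>, w)"
      have der: "(?f has_field_derivative d_eta (partial JN P m) (z, \<zeta>, v)) (at v)" if
        "v \<in> cball \<eta> s" for v
        unfolding partial_def[abs_def]
        by (rule d_eta_has_field_derivative[OF holo_at_sum])
           (rule partial_d_eta(1)[OF holo w[OF that] rel_compact_in_subset[OF s(2)] d])
      then have hol: "?f holomorphic_on cball \<eta> s"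
        by (meson field_differentiable_at_within field_differentiable_def holomorphic_onI)
      have "norm ((deriv ^^ 1) ?f \<eta>) \<le> fact 1 * (C * wN A' h m (z, \<zeta>, \<eta>)) / s ^ 1"
      proof (rule Cauchy_inequality)
        show "?f holomorphic_on ball \<eta> s" using hol by (rule holomorphic_on_subset) auto
        show "continuous_on (cball \<eta> s) ?f" by (rule holomorphic_on_imp_continuous_on[OF hol])
        fix v assume "norm (\<eta> - v) = s"
        then have v: "v \<in> cball \<eta> s" by (simp add: dist_norm)
        have "cmod (?f v) \<le> C * wN A h m (z, \<zeta>, v)" by (rule C(2)[OF w[OF v]])
        also have "\<dots> \<le> C * wN A' h m (z, \<zeta>, \<eta>)"
          using A'(2)[OF \<open>\<eta> \<noteq> 0\<close>] s(3)[OF \<eta> v] C(1) by (intro mult_left_mono) auto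
        finally show "cmod (?f v) \<le> C * wN A' h m (z, \<zeta>, \<eta>)" .
      qed (rule s(1))
      moreover have "deriv ?f \<eta> = d_eta (partial JN P m) (z, \<zeta>, \<eta>)"
        by (rule DERIV_imp_deriv[OF der]) (use s(1) in simp)
      moreover have "(z, \<zeta>, \<eta>) \<in> DN \<Omega> d \<rho> Z m" using DN_mono[OF order_refl d(1) _ order_refl d(2),
        of "2 * d" \<Omega> Z m] p d by auto
      ultimately show ?thesis
        using partial_d_eta(2)[OF holo _ rel_compact_in_subset[OF Z] d] by simp
    qed
    then show "\<exists>C>0. \<forall>m. \<forall>p\<in>DN \<Omega> (2 * d) \<rho> Z m. cmod (partial JN (series_d_eta P) m p) \<le> C * wN A' h m p"
      using C(1) s(1) by (intro exI[of _ "C / s"]) auto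
  qed
qed

lemma nulls_subset_syms:
  assumes "S \<in> sectors"
  shows "nulls \<Omega> S \<subseteq> syms \<Omega> S"
proof
  fix P assume "P \<in> nulls \<Omega> S"
  then obtain d \<rho> where *: "0 < d" "0 < \<rho>" "\<rho> < 1" "null_at \<Omega> S d \<rho> P" unfolding nulls_def by blast
  have n2: "null_at \<Omega> S (2 * d) \<rho> P" by (rule null_at_mono[OF order_refl order_refl *(1) _
    order_refl *(3,4)]) (use * in simp)
  have "growth wS I (DS \<Omega> (2 * d) \<rho>) S (partial JS P)"
    by (rule null_growth_symbol[OF assms _ *(2,3)]) (use n2 * in \<open>auto simp: null_at_def\<close>)
  then have "symbol_at \<Omega> S (2 * d) \<rho> P"
    using null_growth_d_eta[OF assms *(1,3,4)] n2 by (simp add: symbol_at_def null_at_def)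
  then show "P \<in> syms \<Omega> S" using * unfolding syms_eq by (intro CollectI exI[of _ "2 * d"]) auto
qed

lemma total_nulls_subset: "total_at z0 nulls \<subseteq> total_at z0 syms"
  unfolding total_at_def using nulls_subset_syms by blast

lemma total_nulls_cases:
  assumes "P \<in> total_at z0 nulls" "Q \<in> total_at z0 nulls"
  obtains \<Omega> S d \<rho> where "\<Omega> \<in> conic_nhds z0" "S \<in> sectors" "0 < d" "0 < \<rho>" "\<rho> < 1"
    "null_at \<Omega> S d \<rho> P" "null_at \<Omega> S d \<rho> Q"
proof -
  obtain \<Omega>1 S1 d1 \<rho>1 where 1: "\<Omega>1 \<in> conic_nhds z0" "S1 \<in> sectors" "0 < d1" "0 < \<rho>1" "\<rho>1 < 1"
    "null_at \<Omega>1 S1 d1 \<rho>1 P"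
    using assms(1) unfolding total_at_def nulls_def by blast
  obtain \<Omega>2 S2 d2 \<rho>2 where 2: "\<Omega>2 \<in> conic_nhds z0" "S2 \<in> sectors" "0 < d2" "0 < \<rho>2" "\<rho>2 < 1"
    "null_at \<Omega>2 S2 d2 \<rho>2 Q"
    using assms(2) unfolding total_at_def nulls_def by blast
  obtain d \<rho> where c: "0 < d" "0 < \<rho>" "\<rho> < 1" "d1 \<le> d" "d2 \<le> d" "\<rho> \<le> \<rho>1" "\<rho> \<le> \<rho>2"
    using common_params[OF 1(3) 2(3) 1(4,5) 2(4,5)] by blast
  show thesis
    by (rule that[OF conic_nhds_Int[OF 1(1) 2(1)] sectors_Int[OF 1(2) 2(2)] c(1-3)
          null_at_mono[OF Int_lower1 Int_lower1 1(3) c(4,6) 1(5,6)] null_at_mono[OF Int_lower2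
            Int_lower2 2(3) c(5,7) 2(5,6)]])
qed

lemma total_syms_cases:
  assumes "P \<in> total_at z0 syms" "Q \<in> total_at z0 syms"
  obtains \<Omega> S d \<rho> where "\<Omega> \<in> conic_nhds z0" "S \<in> sectors" "0 < d" "0 < \<rho>" "\<rho> < 1"
    "symbol_at \<Omega> S d \<rho> P" "symbol_at \<Omega> S d \<rho> Q"
proof -
  obtain \<Omega>1 S1 d1 \<rho>1 where 1: "\<Omega>1 \<in> conic_nhds z0" "S1 \<in> sectors" "0 < d1" "0 < \<rho>1" "\<rho>1 < 1"
    "symbol_at \<Omega>1 S1 d1 \<rho>1 P"
    using assms(1) unfolding total_at_def syms_eq by blast
  obtain \<Omega>2 S2 d2 \<rho>2 where 2: "\<Omega>2 \<in> conic_nhds z0" "S2 \<in> sectors" "0 < d2" "0 < \<rho>2" "\<rho>2 < 1"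
    "symbol_at \<Omega>2 S2 d2 \<rho>2 Q"
    using assms(2) unfolding total_at_def syms_eq by blast
  obtain d \<rho> where c: "0 < d" "0 < \<rho>" "\<rho> < 1" "d1 \<le> d" "d2 \<le> d" "\<rho> \<le> \<rho>1" "\<rho> \<le> \<rho>2"
    using common_params[OF 1(3) 2(3) 1(4,5) 2(4,5)] by blast
  show thesis
    by (rule that[OF conic_nhds_Int[OF 1(1) 2(1)] sectors_Int[OF 1(2) 2(2)] c(1-3)
          symbol_at_mono[OF Int_lower1 Int_lower1 1(3) c(4,6) 1(5,6)] symbol_at_mono[OF Int_lower2
            Int_lower2 2(3) c(5,7) 2(5,6)]])
qed

lemma total_nullsI:
  "\<lbrakk>\<Omega> \<in> conic_nhds z0; S \<in> sectors; 0 < d; 0 < \<rho>; \<rho> < 1; null_at \<Omega> S d \<rho> P\<rbrakk> \<Longrightarrow> P \<in> total_at z0 nulls"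
  unfolding total_at_def nulls_def by blast

lemma total_symsI:
  "\<lbrakk>\<Omega> \<in> conic_nhds z0; S \<in> sectors; 0 < d; 0 < \<rho>; \<rho> < 1; symbol_at \<Omega> S d \<rho> P\<rbrakk> \<Longrightarrow> P \<in> total_at z0 syms"
  unfolding total_at_def syms_eq by blast

lemma total_nulls_add: "P \<in> total_at z0 nulls \<Longrightarrow> Q \<in> total_at z0 nulls \<Longrightarrow> P + Q \<in> total_at z0 nulls"
  by (erule (1) total_nulls_cases) (rule total_nullsI[OF _ _ _ _ _ null_at_add])

lemma total_syms_add: "P \<in> total_at z0 syms \<Longrightarrow> Q \<in> total_at z0 syms \<Longrightarrow> P + Q \<in> total_at z0 syms"
  by (erule (1) total_syms_cases) (rule total_symsI[OF _ _ _ _ _ symbol_at_add])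

lemma total_nulls_scale: "P \<in> total_at z0 nulls \<Longrightarrow> series_scale c P \<in> total_at z0 nulls"
  by (rule total_nulls_cases[of P z0 P], assumption, assumption) (rule total_nullsI[OF _ _ _ _ _
    null_at_scale])

lemma total_syms_scale: "P \<in> total_at z0 syms \<Longrightarrow> series_scale c P \<in> total_at z0 syms"
  by (rule total_syms_cases[of P z0 P], assumption, assumption) (rule total_symsI[OF _ _ _ _ _
    symbol_at_scale])

lemma total_nulls_zero:
  assumes "conic_nhds z0 \<noteq> {}"
  shows "0 \<in> total_at z0 nulls"
proof -
  obtain \<Omega> S where "\<Omega> \<in> conic_nhds z0" "S \<in> sectors" using assms sectors_nonempty by blast
  moreover have "0 \<in> nulls \<Omega> S" unfolding nulls_def using null_at_zero[of \<Omega> S 1 "1/2"]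
    by (intro CollectI exI[of _ 1] conjI exI[of _ "1/2"]) auto
  ultimately show ?thesis unfolding total_at_def by blast
qed

lemma geqI: "\<Omega> \<in> conic_nhds z0 \<Longrightarrow> S \<in> sectors \<Longrightarrow> 0 < d \<Longrightarrow> 0 < \<rho> \<Longrightarrow> \<rho> < 1 \<Longrightarrow>
    (\<And>\<nu> p. p \<in> H \<Omega> S d \<rho> \<nu> \<Longrightarrow> fps_nth P \<nu> p = fps_nth Q \<nu> p) \<Longrightarrow> geq z0 P Q"
  unfolding geq_def by blast

lemma geq_refl: "conic_nhds z0 \<noteq> {} \<Longrightarrow> geq z0 P P"
  unfolding geq_def using sectors_nonempty by (auto intro!: exI[of _ "1::real"] exI[of _ "1/2::real"])

lemma geq_sym: "geq z0 P Q \<Longrightarrow> geq z0 Q P"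
  unfolding geq_def by metis

lemma geq_common:
  assumes "geq z0 P Q" "geq z0 P' Q'"
  obtains \<Omega> S d \<rho> where "\<Omega> \<in> conic_nhds z0" "S \<in> sectors" "0 < d" "0 < \<rho>" "\<rho> < 1"
    "\<And>\<nu> p. p \<in> H \<Omega> S d \<rho> \<nu> \<Longrightarrow> fps_nth P \<nu> p = fps_nth Q \<nu> p \<and> fps_nth P' \<nu> p = fps_nth Q' \<nu> p"
proof -
  obtain \<Omega>1 S1 d1 \<rho>1 where 1: "\<Omega>1 \<in> conic_nhds z0" "S1 \<in> sectors" "0 < d1" "0 < \<rho>1" "\<rho>1 < 1"
    "\<And>\<nu> p. p \<in> H \<Omega>1 S1 d1 \<rho>1 \<nu> \<Longrightarrow> fps_nth P \<nu> p = fps_nth Q \<nu> p"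
    using assms(1) unfolding geq_def by blast
  obtain \<Omega>2 S2 d2 \<rho>2 where 2: "\<Omega>2 \<in> conic_nhds z0" "S2 \<in> sectors" "0 < d2" "0 < \<rho>2" "\<rho>2 < 1"
    "\<And>\<nu> p. p \<in> H \<Omega>2 S2 d2 \<rho>2 \<nu> \<Longrightarrow> fps_nth P' \<nu> p = fps_nth Q' \<nu> p"
    using assms(2) unfolding geq_def by blast
  obtain d \<rho> where c: "0 < d" "0 < \<rho>" "\<rho> < 1" "d1 \<le> d" "d2 \<le> d" "\<rho> \<le> \<rho>1" "\<rho> \<le> \<rho>2"
    using common_params[OF 1(3) 2(3) 1(4,5) 2(4,5)] by blast
  show thesis
  proof (rule that[OF conic_nhds_Int[OF 1(1) 2(1)] sectors_Int[OF 1(2) 2(2)] c(1-3)])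
    fix \<nu> p assume p: "p \<in> H (\<Omega>1 \<inter> \<Omega>2) (S1 \<inter> S2) d \<rho> \<nu>"
    show "fps_nth P \<nu> p = fps_nth Q \<nu> p \<and> fps_nth P' \<nu> p = fps_nth Q' \<nu> p"
      using H_mono[OF Int_lower1 Int_lower1 1(3) c(4,6) 1(5)] H_mono[OF Int_lower2 Int_lower2 2(3)
        c(5,7) 2(5)] p 1(6) 2(6)
      by blast
  qed
qed

lemma geq_trans: "geq z0 P Q \<Longrightarrow> geq z0 Q T \<Longrightarrow> geq z0 P T"
  by (erule (1) geq_common) (rule geqI, auto)

lemma geq_add: "geq z0 P Q \<Longrightarrow> geq z0 P' Q' \<Longrightarrow> geq z0 (P + P') (Q + Q')"
  by (erule (1) geq_common) (rule geqI, auto)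

lemma geq_scale: "geq z0 P Q \<Longrightarrow> geq z0 (series_scale c P) (series_scale c Q)"
  by (rule geq_common[of z0 P Q P Q], assumption, assumption) (rule geqI, auto)

end

section \<open>The three kinds of symbols\<close>

text \<open>The weights of functions (null symbols and symbols), classical series and formal series.\<close>

definition fun_weight :: "real \<Rightarrow> real \<Rightarrow> nat \<Rightarrow> 'n::finite point \<Rightarrow> real" where
  "fun_weight A h m = (\<lambda>(z, \<zeta>, \<eta>). exp (- A * maxnorm (\<eta> *s \<zeta>)))"

definition exp_weight :: "real \<Rightarrow> real \<Rightarrow> nat \<Rightarrow> 'n::finite point \<Rightarrow> real" where
  "exp_weight A h m = (\<lambda>(z, \<zeta>, \<eta>). exp (h * maxnorm \<zeta>))"

definition cl_weight :: "real \<Rightarrow> real \<Rightarrow> nat \<Rightarrow> 'n::finite point \<Rightarrow> real" where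
  "cl_weight A h m = (\<lambda>(z, \<zeta>, \<eta>). fact m * A ^ m * exp (h * maxnorm \<zeta>) / maxnorm (\<eta> *s \<zeta>) ^ m)"

definition geom_weight :: "real \<Rightarrow> real \<Rightarrow> nat \<Rightarrow> 'n::finite point \<Rightarrow> real" where
  "geom_weight A h m = (\<lambda>(z, \<zeta>, \<eta>). A ^ m * exp (h * maxnorm \<zeta>))"

lemma cl_weight_mono: "0 < A \<Longrightarrow> A \<le> B \<Longrightarrow> cl_weight A h m p \<le> cl_weight B h m p"
  unfolding cl_weight_def by (cases p) (auto intro!: divide_right_mono mult_right_mono
    mult_left_mono power_mono)

lemma geom_weight_mono: "0 < A \<Longrightarrow> A \<le> B \<Longrightarrow> geom_weight A h m p \<le> geom_weight B h m p"
  unfolding geom_weight_def by (cases p) (auto intro!: mult_right_mono power_mono)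

lemma fun_weight_mono: "A \<le> B \<Longrightarrow> fun_weight B h m p \<le> fun_weight A h m p"
  unfolding fun_weight_def by (cases p) (auto intro!: mult_right_mono)

text \<open>Functions are regarded as series concentrated in degree \<open>0\<close>. The conditions concern the term
  of degree \<open>0\<close> only, so \<open>m\<close> plays no role in them.\<close>

interpretation fn: symbol_kind "\<lambda>\<Omega> S d \<rho> \<nu>. dom_prod \<Omega> S d \<rho>" "{0<..}"
  "\<lambda>m. {0}" fun_weight "\<lambda>\<Omega> d \<rho> Z m. dom_prod \<Omega> Z d \<rho>"
  "\<lambda>m. {0}" exp_weight "\<lambda>\<Omega> d \<rho> Z m. dom_prod \<Omega> Z d \<rho>"
proof (rule symbol_kind.intro, goal_cases)
  case (1 \<Omega> \<Omega>' U U' d d' \<rho> \<rho>' \<nu>) then show ?case by (intro dom_prod_mono) auto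
next
  case (2 \<Omega> \<Omega>' U d d' \<rho> \<rho>' m) then show ?case by (intro dom_prod_mono) auto
next
  case (3 \<Omega> \<Omega>' U d d' \<rho> \<rho>' m) then show ?case by (intro dom_prod_mono) auto
next
  case (4 \<Omega> d \<rho> Z S m \<nu>) then show ?case by (intro dom_prod_mono) auto
next
  case 5 show ?case by (auto intro: exI[of _ 1])
next
  case (6 A h m p) show ?case by (cases p) (simp add: fun_weight_def)
next
  case (7 A h m p) show ?case by (cases p) (simp add: exp_weight_def)
next
  case (8 A B) then show ?case by (intro bexI[of _ "min A B"]) (auto intro: fun_weight_mono)
next
  case (9 A B) then show ?case by (intro bexI[of _ A]) (auto simp: exp_weight_def)
next
  case (10 \<Omega> d \<rho> Z Z' m z \<zeta> \<eta> w)
  then have "0 \<le> d * (1 - \<rho>)" "2 * (d * (1 - \<rho>)) \<le> maxnorm \<zeta>"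
    by (simp_all only: dom_prod_def mem_Collect_eq prod.case mult.assoc) simp
  then have "d * (1 - \<rho>) \<le> maxnorm \<zeta>" by linarith
  then show ?case using 10 by (simp add: dom_prod_def)
next
  case (11 \<Omega> d \<rho> Z m z \<zeta> \<eta>) then show ?case by (simp add: dom_prod_def)
next
  case (12 A)
  show ?case
  proof (intro bexI[of _ "A/2"] allI impI)
    fix h m z \<zeta> \<eta> w assume "cmod \<eta> / 2 \<le> cmod w"
    then have "A * (cmod \<eta> / 2 * maxnorm \<zeta>) \<le> A * (cmod w * maxnorm \<zeta>)"
      using 12 by (intro mult_left_mono mult_right_mono) auto
    then show "fun_weight A h m (z, \<zeta>, w) \<le> fun_weight (A/2) h m (z, \<zeta>, \<eta>)"
      by (simp add: fun_weight_def maxnorm_scale)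
  qed (use 12 in auto)
next
  case (13 \<Omega> d \<rho> S P)
  have le: "fun_weight A h m p \<le> exp_weight 1 h m p" if "A > 0" "h > 0" for A h m and p :: "'a point"
  proof (cases p)
    case (fields z \<zeta> \<eta>)
    have "- A * maxnorm (\<eta> *s \<zeta>) \<le> 0" "0 \<le> h * maxnorm \<zeta>" using that by auto
    then show ?thesis by (simp add: fields fun_weight_def exp_weight_def)
  qed
  obtain A where AI: "A \<in> {0<..}" and AC: "\<forall>Z. \<forall>h>0. rel_compact_in Z S \<longrightarrow>
    (\<exists>C>0. \<forall>m. \<forall>p\<in>dom_prod \<Omega> Z d \<rho>. cmod (partial (\<lambda>m. {0}) P m p) \<le> C * fun_weight A h m p)"
    using growthD[OF 13(5)] by (elim exE conjE)
  have A: "A > 0" using AI by simp_all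
  show ?case
  proof (rule growthI[where A = 1])
    fix Z h assume h: "(h::real) > 0" and Z: "rel_compact_in Z S"
    from AC[rule_format, OF h Z]
    obtain C where C0: "C > 0 \<and> (\<forall>m. \<forall>p\<in>dom_prod \<Omega> Z d \<rho>. cmod (partial (\<lambda>m. {0}) P m p) \<le>
      C * fun_weight A h m p)" by (rule exE)
    note C = conjunct1[OF C0] conjunct2[OF C0, rule_format]
    have "cmod (partial (\<lambda>m. {0}) P m p) \<le> C * exp_weight 1 h m p" if "p\<in>dom_prod \<Omega> Z d \<rho>" for m p
      using C(2)[OF that, of m] mult_left_mono[OF le[OF A h, of m p] less_imp_le[OF C(1)]] by (rule
        order_trans)
    then show "\<exists>C>0. \<forall>m. \<forall>p\<in>dom_prod \<Omega> Z d \<rho>. cmod (partial (\<lambda>m. {0}) P m p) \<le> C * exp_weight 1 h m p"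
      using C(1) by blast
  qed auto
qed

interpretation cl: symbol_kind "\<lambda>\<Omega> S d \<rho> \<nu>. dom_prod \<Omega> S d \<rho>" "{0<..}"
  "\<lambda>m. {..<m}" cl_weight "\<lambda>\<Omega> d \<rho> Z m. dom_prod \<Omega> Z d \<rho>"
  "\<lambda>m. {m}" cl_weight "\<lambda>\<Omega> d \<rho> Z m. dom_prod \<Omega> Z d \<rho>"
proof (rule symbol_kind.intro, goal_cases)
  case (1 \<Omega> \<Omega>' U U' d d' \<rho> \<rho>' \<nu>) then show ?case by (intro dom_prod_mono) auto
next
  case (2 \<Omega> \<Omega>' U d d' \<rho> \<rho>' m) then show ?case by (intro dom_prod_mono) auto
next
  case (3 \<Omega> \<Omega>' U d d' \<rho> \<rho>' m) then show ?case by (intro dom_prod_mono) auto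
next
  case (4 \<Omega> d \<rho> Z S m \<nu>) then show ?case by (intro dom_prod_mono) auto
next
  case 5 show ?case by (auto intro: exI[of _ 1])
next
  case (6 A h m p) then show ?case by (cases p) (simp add: cl_weight_def)
next
  case (7 A h m p) then show ?case by (cases p) (simp add: cl_weight_def)
next
  case (8 A B) then show ?case by (intro bexI[of _ "max A B"]) (auto intro: cl_weight_mono)
next
  case (9 A B) then show ?case by (intro bexI[of _ "max A B"]) (auto intro: cl_weight_mono)
next
  case (10 \<Omega> d \<rho> Z Z' m z \<zeta> \<eta> w)
  then have "0 \<le> d * (1 - \<rho>)" "2 * (d * (1 - \<rho>)) \<le> maxnorm \<zeta>"
    by (simp_all only: dom_prod_def mem_Collect_eq prod.case mult.assoc) simp
  then have "d * (1 - \<rho>) \<le> maxnorm \<zeta>" by linarith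
  then show ?case using 10 by (simp add: dom_prod_def)
next
  case (11 \<Omega> d \<rho> Z m z \<zeta> \<eta>) then show ?case by (simp add: dom_prod_def)
next
  case (12 A)
  show ?case
  proof (intro bexI[of _ "2 * A"] allI impI)
    fix h m z \<zeta> \<eta> w assume \<eta>: "\<eta> \<noteq> (0::complex)" and le: "cmod \<eta> / 2 \<le> cmod w"
    show "cl_weight A h m (z, \<zeta>, w) \<le> cl_weight (2 * A) h m (z, \<zeta>, \<eta>)"
    proof (cases "\<zeta> = 0")
      case True
      have "maxnorm \<zeta> = 0" using maxnorm_le_norm[of \<zeta>] maxnorm_nonneg[of \<zeta>] unfolding True by simp
      then show ?thesis using 12 by (cases m) (simp_all add: cl_weight_def maxnorm_scale)
    next
      case False
      then have \<zeta>: "maxnorm \<zeta> > 0" by (simp add: maxnorm_pos_iff)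
      have pos: "0 < cmod \<eta> / 2 * maxnorm \<zeta>" using \<eta> \<zeta> by simp
      have "cmod \<eta> / 2 * maxnorm \<zeta> \<le> cmod w * maxnorm \<zeta>" using le by (intro mult_right_mono) auto
      then have "fact m * A ^ m * exp (h * maxnorm \<zeta>) / (cmod w * maxnorm \<zeta>) ^ m
           \<le> fact m * A ^ m * exp (h * maxnorm \<zeta>) / (cmod \<eta> / 2 * maxnorm \<zeta>) ^ m"
        using pos 12 by (intro divide_left_mono power_mono) (auto intro!: mult_nonneg_nonneg
          mult_pos_pos zero_less_power)
      also have "\<dots> = fact m * (2 * A) ^ m * exp (h * maxnorm \<zeta>) / (cmod \<eta> * maxnorm \<zeta>) ^ m"
        by (simp add: power_mult_distrib power_divide)
      finally show ?thesis by (simp add: cl_weight_def maxnorm_scale)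
    qed
  qed (use 12 in auto)
next
  case (13 \<Omega> d \<rho> S P)
  obtain A where AI: "A \<in> {0<..}" and AC: "\<forall>Z. \<forall>h>0. rel_compact_in Z S \<longrightarrow>
    (\<exists>C>0. \<forall>m. \<forall>p\<in>dom_prod \<Omega> Z d \<rho>. cmod (partial (\<lambda>m. {..<m}) P m p) \<le> C * cl_weight A h m p)"
    using growthD[OF 13(5)] by (elim exE conjE)
  have A: "A > 0" using AI by simp_all
  show ?case
  proof (rule growthI[where A = "2 * A"])
    fix Z h assume h: "(h::real) > 0" and Z: "rel_compact_in Z S"
    from AC[rule_format, OF h Z]
    obtain C where C0: "C > 0 \<and> (\<forall>m. \<forall>p\<in>dom_prod \<Omega> Z d \<rho>. cmod (partial (\<lambda>m. {..<m}) P m p) \<le>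
      C * cl_weight A h m p)" by (rule exE)
    note C = conjunct1[OF C0] conjunct2[OF C0, rule_format]
    obtain c where c: "0 < c" "\<And>\<eta>. \<eta> \<in> Z \<Longrightarrow> c \<le> cmod \<eta>" using rel_compact_lower_bound[OF 13(1) Z] by blast
    \<comment> \<open>The term of index \<open>m\<close> is a difference of two partial sums, and the bound of the longer one
      has an extra factor
      \<open>(m + 1) A / \<parallel>\<eta> \<zeta>\<parallel> \<le> 2\<^sup>m K\<close> on \<open>Z\<close>.\<close>
    define K where "K = A / (c * (d * (1 - \<rho>)))"
    have d\<rho>: "0 < d * (1 - \<rho>)" using 13 by simp
    have K: "K > 0" using A c d\<rho> by (simp add: K_def)
    have "cmod (partial (\<lambda>m. {m}) P m p) \<le> (C * (K + 1)) * cl_weight (2 * A) h m p" if p: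
      "p\<in>dom_prod \<Omega> Z d \<rho>" for m p
    proof -
      obtain z \<zeta> \<eta> where zz: "p = (z, \<zeta>, \<eta>)" by (cases p)
      have \<eta>: "\<eta> \<in> Z" and \<zeta>: "d * (1 - \<rho>) \<le> maxnorm \<zeta>" using p by (auto simp: zz dom_prod_def)
      define x where "x = maxnorm (\<eta> *s \<zeta>)"
      have x: "c * (d * (1 - \<rho>)) \<le> x" unfolding x_def maxnorm_scale using c \<eta> \<zeta> d\<rho> by (intro
        mult_mono) auto
      then have x0: "x > 0" using c(1) d\<rho> mult_pos_pos[of c "d * (1 - \<rho>)"] by linarith
      define E where "E = exp (h * maxnorm \<zeta>)"
      have Ax: "A / x \<le> K" unfolding K_def using x c d\<rho> A by (intro divide_left_mono) (auto intro!:
        mult_pos_pos x0)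
      have cw: "cl_weight B h j p = fact j * B ^ j * E / x ^ j" for B j by (simp add: cl_weight_def
        zz E_def x_def)
      have le2: "real (Suc m) \<le> 2 ^ m" by (induction m) auto
      have "cl_weight A h (Suc m) p = (real (Suc m) * (A / x)) * cl_weight A h m p"
        unfolding cw by (simp add: field_simps)
      also have "\<dots> \<le> (2 ^ m * K) * cl_weight A h m p"
        using le2 Ax A x0 by (intro mult_right_mono mult_mono) (auto simp: cw E_def)
      also have "\<dots> = K * cl_weight (2 * A) h m p" unfolding cw by (simp add: power_mult_distrib)
      finally have 1: "cl_weight A h (Suc m) p \<le> K * cl_weight (2 * A) h m p" .
      have 2: "cl_weight A h m p \<le> cl_weight (2 * A) h m p" by (rule cl_weight_mono) (use A in auto)
      have split: "partial (\<lambda>m. {m}) P m p = partial (\<lambda>m. {..<m}) P (Suc m) p - partial (\<lambda>m. {..<m})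
        P m p"
        by (simp add: partial_def)
      have "cmod (partial (\<lambda>m. {m}) P m p) \<le> C * cl_weight A h (Suc m) p + C * cl_weight A h m p"
        unfolding split using C(2)[OF p, of "Suc m"] C(2)[OF p, of m]
          norm_triangle_ineq4[of "partial (\<lambda>m. {..<m}) P (Suc m) p" "partial (\<lambda>m. {..<m}) P m p"] by
            linarith
      also have "\<dots> \<le> C * (K * cl_weight (2 * A) h m p) + C * cl_weight (2 * A) h m p"
        using 1 2 C(1) by (intro add_mono mult_left_mono) auto
      finally show ?thesis by (simp add: algebra_simps)
    qed
    then show "\<exists>C>0. \<forall>m. \<forall>p\<in>dom_prod \<Omega> Z d \<rho>. cmod (partial (\<lambda>m. {m}) P m p) \<le>
      C * cl_weight (2 * A) h m p"
      using C(1) K by (intro exI[of _ "C * (K + 1)"]) auto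
  qed (use A in auto)
qed

interpretation formal: symbol_kind "\<lambda>\<Omega> S d \<rho> \<nu>. dom_star \<Omega> S d \<rho> (\<nu> + 1)" "{0<..<1}"
  "\<lambda>m. {..<m}" geom_weight "\<lambda>\<Omega> d \<rho> Z m. dom_star \<Omega> Z d \<rho> m"
  "\<lambda>m. {m}" geom_weight "\<lambda>\<Omega> d \<rho> Z m. dom_star \<Omega> Z d \<rho> (m + 1)"
proof (rule symbol_kind.intro, goal_cases)
  case (1 \<Omega> \<Omega>' U U' d d' \<rho> \<rho>' \<nu>) then show ?case by (intro dom_star_mono) auto
next
  case (2 \<Omega> \<Omega>' U d d' \<rho> \<rho>' m) then show ?case by (intro dom_star_mono) auto
next
  case (3 \<Omega> \<Omega>' U d d' \<rho> \<rho>' m) then show ?case by (intro dom_star_mono) auto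
next
  case (4 \<Omega> d \<rho> Z S m \<nu>) then show ?case by (intro dom_star_mono) auto
next
  case 5 show ?case by (auto intro!: exI[of _ "1/2"])
next
  case (6 A h m p) then show ?case by (cases p) (simp add: geom_weight_def)
next
  case (7 A h m p) then show ?case by (cases p) (simp add: geom_weight_def)
next
  case (8 A B) then show ?case by (intro bexI[of _ "max A B"]) (auto intro: geom_weight_mono)
next
  case (9 A B) then show ?case by (intro bexI[of _ "max A B"]) (auto intro: geom_weight_mono)
next
  case (10 \<Omega> d \<rho> Z Z' m z \<zeta> \<eta> w)
  then have "real m * (2 * d * (1 - \<rho>)) \<le> cmod \<eta> * maxnorm \<zeta>" by (simp add: dom_star_def maxnorm_scale)
  moreover have "cmod \<eta> / 2 * maxnorm \<zeta> \<le> cmod w * maxnorm \<zeta>" using 10 by (intro mult_right_mono) auto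
  ultimately show ?case using 10 by (simp add: dom_star_def maxnorm_scale)
next
  case (11 \<Omega> d \<rho> Z m z \<zeta> \<eta>) then show ?case by (simp add: dom_star_def)
next
  case (12 A) then show ?case by (intro bexI[of _ A]) (auto simp: geom_weight_def)
next
  case (13 \<Omega> d \<rho> S P)
  obtain A where AI: "A \<in> {0<..<1}" and AC: "\<forall>Z. \<forall>h>0. rel_compact_in Z S \<longrightarrow>
    (\<exists>C>0. \<forall>m. \<forall>p\<in>dom_star \<Omega> Z d \<rho> m. cmod (partial (\<lambda>m. {..<m}) P m p) \<le> C * geom_weight A h m p)"
    using growthD[OF 13(5)] by (elim exE conjE)
  have A: "A > 0" "A < 1" using AI by simp_all
  show ?case
  proof (rule growthI[where A = A])
    fix Z h assume h: "(h::real) > 0" and Z: "rel_compact_in Z S"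
    from AC[rule_format, OF h Z]
    obtain C where C0: "C > 0 \<and> (\<forall>m. \<forall>p\<in>dom_star \<Omega> Z d \<rho> m. cmod (partial (\<lambda>m. {..<m}) P m p) \<le>
      C * geom_weight A h m p)" by (rule exE)
    note C = conjunct1[OF C0] conjunct2[OF C0, rule_format]
    have "cmod (partial (\<lambda>m. {m}) P m p) \<le> (2 * C) * geom_weight A h m p" if p:
      "p\<in>dom_star \<Omega> Z d \<rho> (m + 1)" for m p
    proof -
      have "dom_star \<Omega> Z d \<rho> (m + 1) \<subseteq> dom_star \<Omega> Z d \<rho> m" using 13 by (intro dom_star_mono) auto
      then have p': "p \<in> dom_star \<Omega> Z d \<rho> m" using p by blast
      have "A * A ^ m \<le> 1 * A ^ m" using A by (intro mult_right_mono) auto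
      then have "geom_weight A h (m + 1) p \<le> geom_weight A h m p"
        unfolding geom_weight_def by (cases p) (simp add: mult_right_mono)
      then have 1: "C * geom_weight A h (m + 1) p \<le> C * geom_weight A h m p" using C(1) by (intro
        mult_left_mono) auto
      have split: "partial (\<lambda>m. {m}) P m p = partial (\<lambda>m. {..<m}) P (m + 1) p - partial (\<lambda>m. {..<m})
        P m p"
        by (simp add: partial_def)
      show ?thesis unfolding split
        using 1 C(2)[OF p] C(2)[OF p'] norm_triangle_ineq4[of "partial (\<lambda>m. {..<m}) P (m + 1) p"
          "partial (\<lambda>m. {..<m}) P m p"]
        by linarith
    qed
    then show "\<exists>C>0. \<forall>m. \<forall>p\<in>dom_star \<Omega> Z d \<rho> (m + 1). cmod (partial (\<lambda>m. {m}) P m p) \<le>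
      C * geom_weight A h m p"
      using C(1) by (intro exI[of _ "2 * C"]) auto
  qed (use A in auto)
qed

text \<open>Identification with the spaces of symbols as they were defined.\<close>

lemma series_d_eta_const: "series_d_eta (fps_const P) = fps_const (d_eta P)"
  by (rule fps_ext) (auto simp: series_d_eta_def d_eta_def fun_eq_iff zero_fun_def)

lemma cl_nulls_eq: "cl.nulls = cl_null_symbols"
proof (intro ext)
  fix \<Omega> :: "'n::finite cotangent set" and S
  show "cl.nulls \<Omega> S = cl_null_symbols \<Omega> S"
    unfolding cl.nulls_def cl_null_symbols_def cl.null_at_def cl.holo_on_def growth_def partial_def
    unfolding cl_weight_def by (simp add: case_prod_unfold Bex_def mult.assoc)
qed

lemma cl_syms_eq: "cl.syms = cl_symbols"
proof (intro ext)
  fix \<Omega> :: "'n::finite cotangent set" and S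
  show "cl.syms \<Omega> S = cl_symbols \<Omega> S"
    unfolding cl.syms_def cl_symbols_def cl_nulls_eq cl.holo_on_def growth_def partial_def
    unfolding cl_weight_def by (simp add: case_prod_unfold Bex_def mult.assoc)
qed

lemma formal_nulls_eq: "formal.nulls = formal_null_symbols"
proof (intro ext)
  fix \<Omega> :: "'n::finite cotangent set" and S
  show "formal.nulls \<Omega> S = formal_null_symbols \<Omega> S"
    unfolding formal.nulls_def formal_null_symbols_def formal.null_at_def formal.holo_on_def
      growth_def partial_def
    unfolding geom_weight_def by (simp add: case_prod_unfold Bex_def mult.assoc)
qed

lemma formal_syms_eq: "formal.syms = formal_symbols"
proof (intro ext)
  fix \<Omega> :: "'n::finite cotangent set" and S
  show "formal.syms \<Omega> S = formal_symbols \<Omega> S"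
    unfolding formal.syms_def formal_symbols_def formal_nulls_eq formal.holo_on_def growth_def partial_def
    unfolding geom_weight_def by (simp add: case_prod_unfold Bex_def mult.assoc)
qed

lemma fn_nulls_iff: "fps_const P \<in> fn.nulls \<Omega> S \<longleftrightarrow> P \<in> null_symbols \<Omega> S"
proof -
  have all: "(\<forall>h>0::real. Q) \<longleftrightarrow> Q" for Q using zero_less_one by blast
  show ?thesis
    unfolding fn.nulls_def null_symbols_def fn.null_at_def fn.holo_on_def growth_def partial_def
    unfolding fun_weight_def all
    by (simp add: case_prod_unfold Bex_def holomorphic_near_zero)
qed

lemma fn_syms_iff: "fps_const P \<in> fn.syms \<Omega> S \<longleftrightarrow> P \<in> symbols \<Omega> S"
proof -
  have ex: "(\<exists>A\<in>{0::real<..}. R) \<longleftrightarrow> R" for R by (auto simp: gt_ex)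
  have swap: "(\<forall>Z. \<forall>h>0::real. X Z h) \<longleftrightarrow> (\<forall>h>0. \<forall>Z. X Z h)" for X :: "complex set \<Rightarrow> real \<Rightarrow> bool"
    by blast
  show ?thesis
    unfolding fn.syms_def symbols_def fn.holo_on_def growth_def partial_def swap
    unfolding exp_weight_def series_d_eta_const mem_Collect_eq fn_nulls_iff ex
    by (simp add: case_prod_unfold holomorphic_near_zero)
qed

lemma cl_geq_eq: "cl.geq = cl_germ_eq"
  by (intro ext) (unfold cl.geq_def cl_germ_eq_def, rule refl)

lemma formal_geq_eq: "formal.geq = formal_germ_eq"
  by (intro ext) (unfold formal.geq_def formal_germ_eq_def, rule refl)

lemma symb_germ_eq_iff: "symb_germ_eq z0 P Q \<longleftrightarrow> cl.geq z0 (fps_const P) (fps_const Q)"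
  unfolding cl.geq_def symb_germ_eq_def by (auto; metis fps_nth_fps_const)


section \<open>The inclusions\<close>

lemma power_le_fact_exp: "0 \<le> y \<Longrightarrow> y ^ m \<le> fact m * exp y" for y :: real
proof -
  assume y: "0 \<le> y"
  have s: "summable (\<lambda>n. y ^ n /\<^sub>R fact n)" by (rule summable_exp_generic)
  have "(\<Sum>n\<in>{m}. y ^ n /\<^sub>R fact n) \<le> (\<Sum>n. y ^ n /\<^sub>R fact n)"
    by (rule sum_le_suminf[OF s]) (use y in auto)
  then show ?thesis by (simp add: exp_def divide_simps mult.commute)
qed

lemma exp_minus_le: "0 < \<delta> \<Longrightarrow> 0 < x \<Longrightarrow> exp (- \<delta> * x) \<le> fact m * (1 / \<delta>) ^ m / x ^ m" for x \<delta> :: real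
  using power_le_fact_exp[of "\<delta> * x" m] by (simp add: exp_minus power_mult_distrib power_divide
    field_simps)

lemma dom_prod_pos:
  assumes "(z, \<zeta>, \<eta>) \<in> dom_prod \<Omega> Z d \<rho>" "rel_compact_in Z S" "S \<in> sectors" "0 < d" "\<rho> < 1"
  shows "0 < maxnorm (\<eta> *s \<zeta>)"
proof -
  have "\<eta> \<noteq> 0" using assms(1,2) sectors_zero[OF assms(3)] rel_compact_in_subset unfolding
    dom_prod_def by blast
  moreover have "0 < d * (1 - \<rho>)" using assms by simp
  then have "0 < maxnorm \<zeta>" using assms(1) unfolding dom_prod_def by auto
  ultimately show ?thesis by (simp add: maxnorm_scale)
qed

lemma partial_const:
  "partial (\<lambda>m. {0}) (fps_const q) m = q"
  "partial (\<lambda>m. {..<m}) (fps_const q) m = (if m = 0 then (\<lambda>_. 0) else q)"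
  "partial (\<lambda>m. {m}) (fps_const q) m = (if m = 0 then q else (\<lambda>_. 0))"
proof -
  show "partial (\<lambda>m. {0}) (fps_const q) m = q" by (simp add: partial_def fun_eq_iff)
  have "(\<Sum>\<nu><m. (if \<nu> = 0 then q else 0) p) = (\<Sum>\<nu><m. if \<nu> = 0 then q p else 0)" for p by (intro
    sum.cong) auto
  then show "partial (\<lambda>m. {..<m}) (fps_const q) m = (if m = 0 then (\<lambda>_. 0) else q)"
    by (auto simp: partial_def fun_eq_iff)
  show "partial (\<lambda>m. {m}) (fps_const q) m = (if m = 0 then q else (\<lambda>_. 0))" by (simp add:
    partial_def fun_eq_iff)
qed

lemma growth_fun_cl_null:
  assumes g: "growth fun_weight {0<..} (\<lambda>Z m. dom_prod \<Omega> Z d \<rho>) S (partial (\<lambda>m. {0}) (fps_const q))"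
    and S: "S \<in> sectors" "0 < d" "\<rho> < 1"
  shows "growth cl_weight {0<..} (\<lambda>Z m. dom_prod \<Omega> Z d \<rho>) S (partial (\<lambda>m. {..<m}) (fps_const q))"
proof -
  obtain \<delta> where \<delta>I: "\<delta> \<in> {0<..}" and \<delta>: "\<forall>Z. \<forall>h>0. rel_compact_in Z S \<longrightarrow>
    (\<exists>C>0. \<forall>m. \<forall>p\<in>dom_prod \<Omega> Z d \<rho>. cmod (partial (\<lambda>m. {0}) (fps_const q) m p) \<le> C * fun_weight \<delta> h m p)"
    using growthD[OF g] by (elim exE conjE)
  have \<delta>0: "\<delta> > 0" using \<delta>I by simp
  show ?thesis
  proof (rule growthI[where A = "1 / \<delta>"])
    fix Z h assume h: "(h::real) > 0" and Z: "rel_compact_in Z S"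
    from \<delta>[rule_format, OF h Z]
    obtain C where C0: "C > 0 \<and> (\<forall>m. \<forall>p\<in>dom_prod \<Omega> Z d \<rho>. cmod (partial (\<lambda>m. {0}) (fps_const q) m p)
      \<le> C * fun_weight \<delta> h m p)" by (rule exE)
    note C = conjunct1[OF C0] conjunct2[OF C0, rule_format]
    have "cmod (partial (\<lambda>m. {..<m}) (fps_const q) m p) \<le> C * cl_weight (1/\<delta>) h m p" if p:
      "p \<in> dom_prod \<Omega> Z d \<rho>" for m p
    proof -
      obtain z \<zeta> \<eta> where zz: "p = (z, \<zeta>, \<eta>)" by (cases p)
      have x: "0 < maxnorm (\<eta> *s \<zeta>)" by (rule dom_prod_pos[OF p[unfolded zz] Z S])
      have "cmod (partial (\<lambda>m. {..<m}) (fps_const q) m p) \<le> cmod (q p)" by (simp add: partial_const)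
      also have "\<dots> \<le> C * fun_weight \<delta> h m p" using C(2)[OF p] by (simp add: partial_const)
      also have "\<dots> \<le> C * cl_weight (1/\<delta>) h m p"
      proof (rule mult_left_mono)
        have "fun_weight \<delta> h m p \<le> fact m * (1 / \<delta>) ^ m / maxnorm (\<eta> *s \<zeta>) ^ m * 1"
          using exp_minus_le[OF \<delta>0 x, of m] by (simp add: fun_weight_def zz)
        also have "\<dots> \<le> fact m * (1 / \<delta>) ^ m / maxnorm (\<eta> *s \<zeta>) ^ m * exp (h * maxnorm \<zeta>)"
          using h \<delta>0 by (intro mult_left_mono) auto
        finally show "fun_weight \<delta> h m p \<le> cl_weight (1/\<delta>) h m p" by (simp add: cl_weight_def zz)
      qed (use C in simp)
      finally show ?thesis .
    qed
    then show "\<exists>C>0. \<forall>m. \<forall>p\<in>dom_prod \<Omega> Z d \<rho>. cmod (partial (\<lambda>m. {..<m}) (fps_const q) m p) \<le>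
      C * cl_weight (1/\<delta>) h m p"
      using C(1) by blast
  qed (use \<delta>0 in simp)
qed

lemma growth_fun_cl_symbol:
  assumes g: "growth exp_weight {0<..} (\<lambda>Z m. dom_prod \<Omega> Z d \<rho>) S (partial (\<lambda>m. {0}) (fps_const q))"
  shows "growth cl_weight {0<..} (\<lambda>Z m. dom_prod \<Omega> Z d \<rho>) S (partial (\<lambda>m. {m}) (fps_const q))"
proof -
  obtain B where B: "B \<in> {0::real<..} \<and> (\<forall>Z. \<forall>h>0. rel_compact_in Z S \<longrightarrow>
    (\<exists>C>0. \<forall>m. \<forall>p\<in>dom_prod \<Omega> Z d \<rho>. cmod (partial (\<lambda>m. {0}) (fps_const q) m p) \<le> C * exp_weight B h m p))"
    using growthD[OF g] by (rule exE)
  show ?thesis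
  proof (rule growthI[where A = 1])
    fix Z h assume h: "(h::real) > 0" and Z: "rel_compact_in Z S"
    from conjunct2[OF B, rule_format, OF h Z]
    obtain C where C0: "C > 0 \<and> (\<forall>m. \<forall>p\<in>dom_prod \<Omega> Z d \<rho>. cmod (partial (\<lambda>m. {0}) (fps_const q) m p)
      \<le> C * exp_weight B h m p)" by (rule exE)
    note C = conjunct1[OF C0] conjunct2[OF C0, rule_format]
    have "cmod (partial (\<lambda>m. {m}) (fps_const q) m p) \<le> C * cl_weight 1 h m p" if p:
      "p \<in> dom_prod \<Omega> Z d \<rho>" for m p
      using C(1) C(2)[OF p] by (cases p) (auto simp: partial_const cl_weight_def exp_weight_def)
    then show "\<exists>C>0. \<forall>m. \<forall>p\<in>dom_prod \<Omega> Z d \<rho>. cmod (partial (\<lambda>m. {m}) (fps_const q) m p) \<le>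
      C * cl_weight 1 h m p"
      using C(1) by blast
  qed simp
qed

lemma fact_le_real_power: "(fact m :: real) \<le> real m ^ m"
  using fact_le_power[of m, where 'a = real] by simp

lemma cl_weight_le_geom_weight:
  assumes "0 < A" "real m * (2 * A) \<le> maxnorm (\<eta> *s \<zeta>)"
  shows "cl_weight A h m (z, \<zeta>, \<eta>) \<le> geom_weight (1/2) h m (z, \<zeta>, \<eta>)"
proof (cases "m = 0")
  case False
  define x where "x = maxnorm (\<eta> *s \<zeta>)"
  have x: "0 < real m * (2 * A)" "real m * (2 * A) \<le> x" using False assms by (auto simp: x_def)
  then have "fact m * A ^ m \<le> real m ^ m * A ^ m"
    using assms by (intro mult_right_mono fact_le_real_power) auto
  also have "\<dots> = (1/2) ^ m * (real m * (2 * A)) ^ m" by (simp add: power_mult_distrib power_divide)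
  also have "\<dots> \<le> (1/2) ^ m * x ^ m" using x by (intro mult_left_mono power_mono) auto
  finally have "fact m * A ^ m / x ^ m \<le> (1/2) ^ m" using less_le_trans[OF x(1) x(2), THEN
    zero_less_power, of m] by (simp only: pos_divide_le_eq)
  then have "fact m * A ^ m / x ^ m * exp (h * maxnorm \<zeta>) \<le> (1/2) ^ m * exp (h * maxnorm \<zeta>)"
    by (intro mult_right_mono) auto
  then show ?thesis by (simp add: cl_weight_def geom_weight_def x_def)
qed (simp add: cl_weight_def geom_weight_def)

text \<open>Where \<open>\<parallel>\<eta> \<zeta>\<parallel> \<ge> 2 m A\<close> the classical weight is at most \<open>(1/2)\<^sup>m\<close>; this region is reached by
  increasing \<open>d\<close>. The side condition on \<open>e\<close> and \<open>J\<close> takes care of the index \<open>m = 0\<close>, for which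
  \<open>dom_star\<close> is not contained in \<open>dom_prod\<close>.\<close>

lemma growth_cl_formal:
  assumes g: "growth cl_weight {0<..} (\<lambda>Z m. dom_prod \<Omega> Z d \<rho>) S (partial J P)"
    and S: "S \<in> sectors" and d: "0 < d" "\<rho> < 1" and J: "e = (1::nat) \<or> J 0 = {}"
  shows "\<exists>d'\<ge>d. growth geom_weight {0<..<1} (\<lambda>Z m. dom_star \<Omega> Z d' \<rho> (m + e)) S (partial J P)"
proof -
  obtain A where AI: "A \<in> {0<..}" and AC: "\<forall>Z. \<forall>h>0. rel_compact_in Z S \<longrightarrow>
    (\<exists>C>0. \<forall>m. \<forall>p\<in>dom_prod \<Omega> Z d \<rho>. cmod (partial J P m p) \<le> C * cl_weight A h m p)"
    using growthD[OF g] by (elim exE conjE)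
  have A: "A > 0" using AI by simp
  define d' where "d' = max d (2 * A / (1 - \<rho>))"
  have d': "d \<le> d'" "2 * A \<le> d' * (1 - \<rho>)" "0 < d'"
    using d A by (auto simp: d'_def max_def field_simps)
  have "growth geom_weight {0<..<1} (\<lambda>Z m. dom_star \<Omega> Z d' \<rho> (m + e)) S (partial J P)"
  proof (rule growthI[where A = "1/2"])
    fix Z h assume h: "(h::real) > 0" and Z: "rel_compact_in Z S"
    from AC[rule_format, OF h Z]
    obtain C where C0: "C > 0 \<and> (\<forall>m. \<forall>p\<in>dom_prod \<Omega> Z d \<rho>. cmod (partial J P m p) \<le>
      C * cl_weight A h m p)" by (rule exE)
    note C = conjunct1[OF C0] conjunct2[OF C0, rule_format]
    have Z1: "Z \<subseteq> cball 0 1" using rel_compact_in_subset[OF Z] sectors_norm[OF S] by force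
    have "cmod (partial J P m p) \<le> C * geom_weight (1/2) h m p" if p:
      "p \<in> dom_star \<Omega> Z d' \<rho> (m + e)" for m p
    proof (cases "m + e = 0")
      case True
      then have "J m = {}" using J by simp
      then show ?thesis using C(1) by (cases p) (simp add: partial_def geom_weight_def)
    next
      case False
      obtain z \<zeta> \<eta> where zz: "p = (z, \<zeta>, \<eta>)" by (cases p)
      have "dom_star \<Omega> Z d' \<rho> (m + e) \<subseteq> dom_prod \<Omega> Z d' \<rho>"
        using False d d' by (intro dom_star_subset_dom_prod[OF Z1]) auto
      also have "\<dots> \<subseteq> dom_prod \<Omega> Z d \<rho>" using d d' by (intro dom_prod_mono) auto
      finally have p': "p \<in> dom_prod \<Omega> Z d \<rho>" using p by blast
      have "real m * (2 * A) \<le> real (m + e) * (d' * (1 - \<rho>))" using A by (intro mult_mono[OF _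
        d'(2)]) auto
      also have "\<dots> \<le> maxnorm (\<eta> *s \<zeta>)" using p by (simp add: zz dom_star_def)
      finally have "C * cl_weight A h m p \<le> C * geom_weight (1/2) h m p"
        unfolding zz using C(1) A by (intro mult_left_mono cl_weight_le_geom_weight) auto
      then show ?thesis using C(2)[OF p', of m] by linarith
    qed
    then show "\<exists>C>0. \<forall>m. \<forall>p\<in>dom_star \<Omega> Z d' \<rho> (m + e). cmod (partial J P m p) \<le>
      C * geom_weight (1/2) h m p"
      using C(1) by blast
  qed simp
  then show ?thesis using d'(1) by blast
qed

lemma fn_null_cl_null:
  assumes "S \<in> sectors" "0 < d" "\<rho> < 1" "fn.null_at \<Omega> S d \<rho> (fps_const q)"
  shows "cl.null_at \<Omega> S d \<rho> (fps_const q)"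
  using assms growth_fun_cl_null unfolding fn.null_at_def cl.null_at_def fn.holo_on_def
    cl.holo_on_def by blast

lemma fn_symbol_cl_symbol:
  assumes "S \<in> sectors" "0 < d" "\<rho> < 1" "fn.symbol_at \<Omega> S d \<rho> (fps_const q)"
  shows "cl.symbol_at \<Omega> S d \<rho> (fps_const q)"
  using assms growth_fun_cl_null growth_fun_cl_symbol
  unfolding fn.symbol_at_def cl.symbol_at_def fn.holo_on_def cl.holo_on_def series_d_eta_const by blast

lemma cl_holo_formal_holo:
  assumes "cl.holo_on \<Omega> S d \<rho> P" "S \<in> sectors" "0 < d" "\<rho> < 1"
  shows "formal.holo_on \<Omega> S d \<rho> P"
proof -
  have "S \<subseteq> cball 0 1" using sectors_norm[OF assms(2)] by force
  then have "dom_star \<Omega> S d \<rho> (\<nu> + 1) \<subseteq> dom_prod \<Omega> S d \<rho>" for \<nu>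
    using assms by (intro dom_star_subset_dom_prod) auto
  then show ?thesis using assms(1) holomorphic_near_subset unfolding cl.holo_on_def
    formal.holo_on_def by blast
qed

lemma cl_null_formal_null:
  assumes "S \<in> sectors" "0 < d" "\<rho> < 1" "cl.null_at \<Omega> S d \<rho> P"
  shows "\<exists>d'\<ge>d. formal.null_at \<Omega> S d' \<rho> P"
proof -
  have g: "growth cl_weight {0<..} (\<lambda>Z m. dom_prod \<Omega> Z d \<rho>) S (partial (\<lambda>m. {..<m}) P)"
    and h: "cl.holo_on \<Omega> S d \<rho> P" using assms(4) by (auto simp: cl.null_at_def)
  obtain d' where d': "d \<le> d'" "growth geom_weight {0<..<1} (\<lambda>Z m. dom_star \<Omega> Z d' \<rho> (m + 0)) S
    (partial (\<lambda>m. {..<m}) P)"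
    using growth_cl_formal[OF g assms(1-3), of 0] by auto
  have "formal.holo_on \<Omega> S d' \<rho> P"
    by (rule formal.holo_on_mono[OF order_refl order_refl assms(2) d'(1) order_refl assms(3)
      cl_holo_formal_holo[OF h assms(1-3)]])
  moreover have "growth geom_weight {0<..<1} (\<lambda>Z m. dom_star \<Omega> Z d' \<rho> m) S (partial (\<lambda>m. {..<m}) P)"
    using d'(2) by (simp only: add_0_right)
  ultimately show ?thesis using d'(1) unfolding formal.null_at_def by blast
qed

lemma cl_symbol_formal_symbol:
  assumes "S \<in> sectors" "0 < d" "\<rho> < 1" "cl.symbol_at \<Omega> S d \<rho> P"
  shows "\<exists>d'\<ge>d. formal.symbol_at \<Omega> S d' \<rho> P"
proof -
  have gN: "growth cl_weight {0<..} (\<lambda>Z m. dom_prod \<Omega> Z d \<rho>) S (partial (\<lambda>m. {..<m}) (series_d_eta P))"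
    and gS: "growth cl_weight {0<..} (\<lambda>Z m. dom_prod \<Omega> Z d \<rho>) S (partial (\<lambda>m. {m}) P)"
    and h: "cl.holo_on \<Omega> S d \<rho> P" using assms(4) by (auto simp: cl.symbol_at_def)
  obtain d1 where d1: "d \<le> d1" "growth geom_weight {0<..<1} (\<lambda>Z m. dom_star \<Omega> Z d1 \<rho> (m + 0)) S
    (partial (\<lambda>m. {..<m}) (series_d_eta P))"
    using growth_cl_formal[OF gN assms(1-3), of 0] by auto
  obtain d2 where d2: "d \<le> d2" "growth geom_weight {0<..<1} (\<lambda>Z m. dom_star \<Omega> Z d2 \<rho> (m + 1)) S
    (partial (\<lambda>m. {m}) P)"
    using growth_cl_formal[OF gS assms(1-3), of 1] by auto
  define d' where "d' = max d1 d2"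
  have d': "d \<le> d'" "d1 \<le> d'" "d2 \<le> d'" using d1 by (auto simp: d'_def)
  have pos: "0 < d1" "0 < d2" using d1 d2 assms by auto
  have "formal.holo_on \<Omega> S d' \<rho> P"
    by (rule formal.holo_on_mono[OF order_refl order_refl assms(2) d'(1) order_refl assms(3)
      cl_holo_formal_holo[OF h assms(1-3)]])
  moreover have "growth geom_weight {0<..<1} (\<lambda>Z m. dom_star \<Omega> Z d' \<rho> m) S (partial (\<lambda>m. {..<m})
    (series_d_eta P))"
    using formal.growth_N_mono[OF order_refl order_refl pos(1) d'(2) order_refl assms(3)] d1(2) by
      (simp only: add_0_right)
  moreover have "growth geom_weight {0<..<1} (\<lambda>Z m. dom_star \<Omega> Z d' \<rho> (m + 1)) S (partial (\<lambda>m. {m}) P)"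
    by (rule formal.growth_S_mono[OF order_refl order_refl pos(2) d'(3) order_refl assms(3) d2(2)])
  ultimately show ?thesis using d'(1) unfolding formal.symbol_at_def by blast
qed

section \<open>Symbols that are formally null\<close>

text \<open>The index at which a formal null series is truncated optimally.\<close>

lemma floor_index:
  fixes x D :: real
  assumes "0 < D" "0 \<le> x"
  obtains k where "real k * D \<le> x" "x < real (k + 1) * D" "\<And>m. real m * D \<le> x \<Longrightarrow> m \<le> k"
proof -
  define k where "k = nat \<lfloor>x / D\<rfloor>"
  have k: "real k \<le> x / D" "x / D < real k + 1" using assms by (auto simp: k_def)
  show thesis
  proof (rule that)
    show "real k * D \<le> x" "x < real (k + 1) * D" using k assms by (auto simp: field_simps)
    show "m \<le> k" if "real m * D \<le> x" for m
    proof -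
      have "real m \<le> x / D" using that assms by (simp add: field_simps)
      then show ?thesis using k by linarith
    qed
  qed
qed

lemma power_floor_le:
  fixes x D B :: real
  assumes "0 < D" "0 < B" "x < real (k + 1) * D"
  shows "B < 1 \<Longrightarrow> B ^ k \<le> (1 / B) * exp (- (- ln B / D) * x)"
proof -
  assume B1: "B < 1"
  define l where "l = - ln B"
  have l: "l > 0" "B = exp (- l)" using assms B1 by (auto simp: l_def)
  have "x / D < real k + 1" using assms by (simp add: field_simps)
  then have "l * (x / D) \<le> l * (real k + 1)" using l by (intro mult_left_mono) auto
  then have le: "exp (real k * (- l)) \<le> exp (l + - (l / D) * x)" by (simp add: algebra_simps)
  have pow: "B ^ k = exp (real k * (- l))"
    unfolding exp_of_nat_mult by (rule arg_cong[OF l(2)])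
  have inv: "1 / B = exp l"
    using arg_cong[OF l(2), of "\<lambda>y. 1 / y"] by (simp add: exp_minus divide_inverse)
  show ?thesis
    unfolding l_def[symmetric] pow inv exp_add[symmetric] by (rule le)
qed

text \<open>On the domain of index \<open>m\<close> the partial sum of length \<open>m\<close> involves only terms on domains where
  the two series agree.\<close>

lemma agree_partial:
  assumes eq: "\<And>\<nu> p. p \<in> dom_star \<Omega> S d \<rho> (\<nu> + 1) \<Longrightarrow> fps_nth P \<nu> p = fps_nth Q \<nu> p"
    and "p \<in> dom_star \<Omega> Z d \<rho> m" "Z \<subseteq> S" "0 < d" "\<rho> < 1"
  shows "partial (\<lambda>m. {..<m}) P m p = partial (\<lambda>m. {..<m}) Q m p"
  unfolding partial_def
proof (rule sum.cong[OF refl])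
  fix \<nu> assume "\<nu> \<in> {..<m}"
  then have "dom_star \<Omega> Z d \<rho> m \<subseteq> dom_star \<Omega> S d \<rho> (\<nu> + 1)" using assms by (intro dom_star_mono) auto
  then show "fps_nth P \<nu> p = fps_nth Q \<nu> p" using eq assms(2) by blast
qed

lemma symbol_formally_null:
  assumes S: "S \<in> sectors" and d: "0 < d" "0 < \<rho>" "\<rho> < 1"
    and P: "fn.symbol_at \<Omega> S d \<rho> (fps_const q)" and Q: "formal.null_at \<Omega> S d \<rho> Q"
    and eq: "\<And>\<nu> p. p \<in> dom_star \<Omega> S d \<rho> (\<nu> + 1) \<Longrightarrow> fps_nth (fps_const q) \<nu> p = fps_nth Q \<nu> p"
  shows "fn.null_at \<Omega> S d \<rho> (fps_const q)"
proof -
  define D where "D = d * (1 - \<rho>)"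
  have D: "D > 0" using d by (simp add: D_def)
  obtain A where AI: "A \<in> {0<..<1}" and AC: "\<forall>Z. \<forall>h>0. rel_compact_in Z S \<longrightarrow>
    (\<exists>C>0. \<forall>m. \<forall>p\<in>dom_star \<Omega> Z d \<rho> m. cmod (partial (\<lambda>m. {..<m}) Q m p) \<le> C * geom_weight A h m p)"
    using growthD[OF conjunct2[OF Q[unfolded formal.null_at_def]]] by (elim exE conjE)
  have A: "0 < A" "A < 1" using AI by simp_all
  obtain B where B: "B \<in> {0::real<..} \<and> (\<forall>Z. \<forall>h>0. rel_compact_in Z S \<longrightarrow>
    (\<exists>C>0. \<forall>m. \<forall>p\<in>dom_prod \<Omega> Z d \<rho>. cmod (partial (\<lambda>m. {0}) (fps_const q) m p) \<le> C * exp_weight B h m p))"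
    using growthD[OF conjunct1[OF conjunct2[OF P[unfolded fn.symbol_at_def]]]] by (rule exE)
  define \<delta> where "\<delta> = - ln A / D / 2"
  have "0 < - ln A" using A by simp
  then have \<delta>: "\<delta> > 0" unfolding \<delta>_def using D by (intro divide_pos_pos) auto
  have "growth fun_weight {0<..} (\<lambda>Z m. dom_prod \<Omega> Z d \<rho>) S (partial (\<lambda>m. {0}) (fps_const q))"
  proof (rule growthI[where A = \<delta>])
    fix Z h assume "(h::real) > 0" and Z: "rel_compact_in Z S"
    obtain c where c: "0 < c" "\<And>\<eta>. \<eta> \<in> Z \<Longrightarrow> c \<le> cmod \<eta>" using rel_compact_lower_bound[OF S Z] by blast
    \<comment> \<open>On \<open>Z\<close> the norms of \<open>\<zeta>\<close> and \<open>\<eta> \<zeta>\<close> are comparable, so an arbitrarily small exponent is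
      absorbed by half of the decay.\<close>
    have h0: "\<delta> * c > 0" using \<delta> c by simp
    from AC[rule_format, OF h0 Z]
    obtain C1 where C10: "C1 > 0 \<and> (\<forall>m. \<forall>p\<in>dom_star \<Omega> Z d \<rho> m. cmod (partial (\<lambda>m. {..<m}) Q m p) \<le>
      C1 * geom_weight A (\<delta> * c) m p)" by (rule exE)
    note C1 = conjunct1[OF C10] conjunct2[OF C10, rule_format]
    from conjunct2[OF B, rule_format, OF h0 Z]
    obtain C2 where C20: "C2 > 0 \<and> (\<forall>m. \<forall>p\<in>dom_prod \<Omega> Z d \<rho>. cmod (partial (\<lambda>m. {0}) (fps_const q) m
      p) \<le> C2 * exp_weight B (\<delta> * c) m p)" by (rule exE)
    note C2 = conjunct1[OF C20] conjunct2[OF C20, rule_format]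
    \<comment> \<open>The formal estimate is used where the truncation index is positive, the symbol estimate elsewhere.\<close>
    define C where "C = C1 / A + C2 / A"
    have "cmod (q p) \<le> C * fun_weight \<delta> h m p" if p: "p \<in> dom_prod \<Omega> Z d \<rho>" for m p
    proof -
      obtain z \<zeta> \<eta> where zz: "p = (z, \<zeta>, \<eta>)" by (cases p)
      have \<eta>: "\<eta> \<in> Z" using p by (simp add: zz dom_prod_def)
      define x where "x = maxnorm (\<eta> *s \<zeta>)"
      have x: "0 \<le> x" by (simp add: x_def)
      have "\<delta> * (c * maxnorm \<zeta>) \<le> \<delta> * x"
        unfolding x_def maxnorm_scale using c(2)[OF \<eta>] \<delta> by (intro mult_left_mono mult_right_mono) auto
      then have E: "exp (\<delta> * c * maxnorm \<zeta>) \<le> exp (\<delta> * x)" by (simp add: mult.assoc)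
      obtain k where k: "real k * D \<le> x" "x < real (k + 1) * D" using floor_index[OF D x] by blast
      have half: "exp (\<delta> * x) * exp (- (- ln A / D) * x) = exp (- \<delta> * x)"
        unfolding exp_add[symmetric] \<delta>_def by (simp add: field_simps)
      have pk: "A ^ k * exp (\<delta> * x) \<le> 1 / A * exp (- \<delta> * x)"
        using mult_right_mono[OF power_floor_le[OF D A(1) k(2) A(2)], of "exp (\<delta> * x)"] half
        by (simp add: mult_ac)
      have "cmod (q p) \<le> C * exp (- \<delta> * x)"
      proof (cases "k = 0")
        case False
        have ps: "p \<in> dom_star \<Omega> Z d \<rho> k" using p k(1) by (simp add: zz dom_star_def dom_prod_def
          x_def D_def)
        have "q p = partial (\<lambda>m. {..<m}) (fps_const q) k p" using False by (simp add: partial_const)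
        also have "\<dots> = partial (\<lambda>m. {..<m}) Q k p" by (rule agree_partial[OF eq ps
          rel_compact_in_subset[OF Z] d(1,3)])
        finally have "cmod (q p) \<le> C1 * geom_weight A (\<delta> * c) k p" using C1(2)[OF ps] by simp
        also have "\<dots> \<le> C1 * (A ^ k * exp (\<delta> * x))"
          using E C1(1) A by (simp add: geom_weight_def zz)
        also have "\<dots> \<le> C1 * (1 / A * exp (- \<delta> * x))" using pk C1(1) by (intro mult_left_mono) auto
        also have "\<dots> \<le> C * exp (- \<delta> * x)" using C2(1) A by (simp add: C_def algebra_simps)
        finally show ?thesis .
      next
        case True
        have "cmod (q p) \<le> C2 * exp_weight B (\<delta> * c) 0 p" using C2(2)[OF p, of 0] by (simp add:
          partial_const)
        also have "\<dots> \<le> C2 * (A ^ k * exp (\<delta> * x))" using E C2(1) True by (simp add: exp_weight_def zz)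
        also have "\<dots> \<le> C2 * (1 / A * exp (- \<delta> * x))" using pk C2(1) by (intro mult_left_mono) auto
        also have "\<dots> \<le> C * exp (- \<delta> * x)" using C1(1) A by (simp add: C_def algebra_simps)
        finally show ?thesis .
      qed
      then show ?thesis by (simp add: fun_weight_def zz x_def)
    qed
    moreover have "C > 0" using C1(1) C2(1) A by (simp add: C_def add_pos_pos)
    ultimately show "\<exists>C>0. \<forall>m. \<forall>p\<in>dom_prod \<Omega> Z d \<rho>. cmod (partial (\<lambda>m. {0}) (fps_const q) m p) \<le>
      C * fun_weight \<delta> h m p"
      unfolding partial_const by blast
  qed (use \<delta> in simp)
  then show ?thesis using P by (simp add: fn.null_at_def fn.symbol_at_def)
qed

text \<open>Two estimates for the sequence \<open>\<nu>! A^\<nu> / x^\<nu>\<close>: it decreases geometrically as long as \<open>\<nu> \<le> x /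
  D\<close>, and beyond that index it is dominated by \<open>m! K^m / x^m\<close>.\<close>

lemma cl_weight_sum_below:
  assumes A: "0 < A" "2 * A \<le> D" and x: "x = maxnorm (\<eta> *s \<zeta>)" "0 < x" "real k * D \<le> x" and m: "m \<le> k"
  shows "(\<Sum>\<nu>\<in>{m..<k}. cl_weight A h \<nu> (z, \<zeta>, \<eta>)) \<le> 2 * cl_weight A h m (z, \<zeta>, \<eta>)"
proof -
  define a where "a = (\<lambda>\<nu>. cl_weight A h \<nu> (z, \<zeta>, \<eta>))"
  have a: "a \<nu> = fact \<nu> * A ^ \<nu> * exp (h * maxnorm \<zeta>) / x ^ \<nu>" for \<nu> by (simp add: a_def
    cl_weight_def x(1))
  have a0: "0 \<le> a \<nu>" for \<nu> using A x by (simp add: a)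
  have step: "a (Suc \<nu>) \<le> a \<nu> / 2" if "\<nu> < k" for \<nu>
  proof -
    have "2 * (real (Suc \<nu>) * A) \<le> real k * D" using that A mult_mono[of "real (Suc \<nu>)" "real k"
      "2 * A" D] by simp
    then have "real (Suc \<nu>) * A / x \<le> 1/2" using x by (simp add: divide_simps)
    then have "a \<nu> * (real (Suc \<nu>) * A / x) \<le> a \<nu> * (1/2)" using a0 by (intro mult_left_mono) auto
    moreover have "a (Suc \<nu>) = a \<nu> * (real (Suc \<nu>) * A / x)" using x by (simp add: a field_simps)
    ultimately show ?thesis by simp
  qed
  have "(\<Sum>\<nu>\<in>{m..<k}. a \<nu>) + 2 * a k \<le> 2 * a m"
    using m
  proof (induction k rule: dec_induct)
    case (step j)
    have "a (Suc j) \<le> a j / 2" if "j < k" using \<open>\<And>\<nu>. \<nu> < k \<Longrightarrow> a (Suc \<nu>) \<le> a \<nu> / 2\<close> that by blast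
    then show ?case using step by simp
  qed simp
  then show ?thesis using a0[of k] by (simp add: a_def)
qed

lemma cl_weight_sum_above:
  assumes A: "0 < A" "A \<le> D" and K: "2 * exp 1 * D \<le> K"
    and x: "x = maxnorm (\<eta> *s \<zeta>)" "0 < x" "x < real m * D"
  shows "(\<Sum>\<nu><m. cl_weight A h \<nu> (z, \<zeta>, \<eta>)) \<le> cl_weight K h m (z, \<zeta>, \<eta>)"
proof -
  have D: "D > 0" using A by simp
  define E where "E = exp (h * maxnorm \<zeta>)"
  have term_le: "cl_weight A h \<nu> (z, \<zeta>, \<eta>) \<le> (1/2) ^ m * cl_weight K h m (z, \<zeta>, \<eta>)" if "\<nu> < m" for \<nu>
  proof -
    have f: "(fact \<nu> :: real) \<le> real m ^ \<nu>"
      using fact_le_real_power[of \<nu>] power_mono[of "real \<nu>" "real m" \<nu>] that by simp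
    have "fact \<nu> * A ^ \<nu> * x ^ (m - \<nu>) \<le> real m ^ \<nu> * D ^ \<nu> * (real m * D) ^ (m - \<nu>)"
      using f A x by (intro mult_mono power_mono) auto
    also have "\<dots> = real m ^ \<nu> * real m ^ (m - \<nu>) * (D ^ \<nu> * D ^ (m - \<nu>))"
      by (simp add: power_mult_distrib)
    also have "\<dots> = real m ^ m * D ^ m" using that by (simp flip: power_add)
    also have "\<dots> \<le> (fact m * exp (real m)) * D ^ m"
      using power_le_fact_exp[of "real m" m] D by (intro mult_right_mono) auto
    also have "exp (real m) = exp 1 ^ m" by (simp flip: exp_of_nat_mult)
    also have "fact m * exp 1 ^ m * D ^ m = (1/2) ^ m * (fact m * (2 * exp 1 * D) ^ m)"
      by (simp add: power_mult_distrib power_divide)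
    also have "\<dots> \<le> (1/2) ^ m * (fact m * K ^ m)"
      using K D by (intro mult_left_mono power_mono) auto
    finally have "fact \<nu> * A ^ \<nu> * x ^ (m - \<nu>) / x ^ m \<le> (1/2) ^ m * (fact m * K ^ m) / x ^ m"
      using x by (intro divide_right_mono) auto
    moreover have "x ^ (m - \<nu>) / x ^ m = 1 / x ^ \<nu>" using that x by (simp add: power_diff field_simps)
    ultimately have "fact \<nu> * A ^ \<nu> / x ^ \<nu> \<le> (1/2) ^ m * (fact m * K ^ m) / x ^ m"
      by (metis (no_types, lifting) times_divide_eq_right mult_1_right)
    then have "fact \<nu> * A ^ \<nu> / x ^ \<nu> * E \<le> (1/2) ^ m * (fact m * K ^ m) / x ^ m * E"
      by (intro mult_right_mono) (auto simp: E_def)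
    then show ?thesis by (simp add: cl_weight_def x(1) E_def mult_ac)
  qed
  have w0: "0 \<le> cl_weight K h m (z, \<zeta>, \<eta>)"
    using K D x order_trans[of 0 "2 * exp 1 * D" K] by (simp add: cl_weight_def)
  have "(\<Sum>\<nu><m. cl_weight A h \<nu> (z, \<zeta>, \<eta>)) \<le> (\<Sum>\<nu><m. (1/2) ^ m * cl_weight K h m (z, \<zeta>, \<eta>))"
    by (intro sum_mono term_le) simp
  also have "\<dots> = (real m * (1/2) ^ m) * cl_weight K h m (z, \<zeta>, \<eta>)" by simp
  also have "\<dots> \<le> 1 * cl_weight K h m (z, \<zeta>, \<eta>)"
  proof (intro mult_right_mono w0)
    have "real m \<le> 2 ^ m" by (rule of_nat_less_two_power[THEN less_imp_le])
    then show "real m * (1/2) ^ m \<le> 1" by (simp add: power_divide)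
  qed
  finally show ?thesis by simp
qed

lemma cl_symbol_formally_null:
  assumes S: "S \<in> sectors" and d: "0 < d" "0 < \<rho>" "\<rho> < 1"
    and P: "cl.symbol_at \<Omega> S d \<rho> P" and Q: "formal.null_at \<Omega> S d \<rho> Q"
    and eq: "\<And>\<nu> p. p \<in> dom_star \<Omega> S d \<rho> (\<nu> + 1) \<Longrightarrow> fps_nth P \<nu> p = fps_nth Q \<nu> p"
  shows "\<exists>d'\<ge>d. cl.null_at \<Omega> S d' \<rho> P"
proof -
  obtain A where AI: "A \<in> {0<..}" and AC: "\<forall>Z. \<forall>h>0. rel_compact_in Z S \<longrightarrow>
    (\<exists>C>0. \<forall>m. \<forall>p\<in>dom_prod \<Omega> Z d \<rho>. cmod (partial (\<lambda>m. {m}) P m p) \<le> C * cl_weight A h m p)"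
    using growthD[OF conjunct1[OF conjunct2[OF P[unfolded cl.symbol_at_def]]]] by (elim exE conjE)
  have A: "0 < A" using AI by simp
  obtain B where BI: "B \<in> {0<..<1}" and BC: "\<forall>Z. \<forall>h>0. rel_compact_in Z S \<longrightarrow>
    (\<exists>C>0. \<forall>m. \<forall>p\<in>dom_star \<Omega> Z d \<rho> m. cmod (partial (\<lambda>m. {..<m}) Q m p) \<le> C * geom_weight B h m p)"
    using growthD[OF conjunct2[OF Q[unfolded formal.null_at_def]]] by (elim exE conjE)
  have B: "0 < B" "B < 1" using BI by simp_all
  define d' where "d' = max d (2 * A / (1 - \<rho>))"
  define D where "D = d' * (1 - \<rho>)"
  have d': "d \<le> d'" "2 * A \<le> D" "0 < d'" using d A by (auto simp: D_def d'_def max_def field_simps)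
  have D: "D > 0" using A d' by simp
  define \<delta> where "\<delta> = - ln B / D"
  have "0 < - ln B" using B by simp
  then have \<delta>: "\<delta> > 0" unfolding \<delta>_def using D by (intro divide_pos_pos)
  define K where "K = 1 / \<delta> + 2 * exp 1 * D"
  have "1 * D \<le> 2 * exp 1 * D" using D one_le_exp_iff[of 1] by (intro mult_right_mono) linarith+
  moreover have "0 < 1 / \<delta>" using \<delta> by simp
  ultimately have K: "1 / \<delta> \<le> K" "A \<le> K" "2 * exp 1 * D \<le> K" "0 < K"
    unfolding K_def using D A d'(2) by linarith+
  have sub: "dom_prod \<Omega> Z d' \<rho> \<subseteq> dom_prod \<Omega> Z d \<rho>" for Z using d d' by (intro dom_prod_mono) auto
  have "growth cl_weight {0<..} (\<lambda>Z m. dom_prod \<Omega> Z d' \<rho>) S (partial (\<lambda>m. {..<m}) P)"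
  proof (rule growthI[where A = K])
    fix Z h assume h: "(h::real) > 0" and Z: "rel_compact_in Z S"
    from AC[rule_format, OF h Z]
    obtain C2 where C20: "C2 > 0 \<and> (\<forall>m. \<forall>p\<in>dom_prod \<Omega> Z d \<rho>. cmod (partial (\<lambda>m. {m}) P m p) \<le>
      C2 * cl_weight A h m p)" by (rule exE)
    note C2 = conjunct1[OF C20] conjunct2[OF C20, rule_format]
    from BC[rule_format, OF h Z]
    obtain C1 where C10: "C1 > 0 \<and> (\<forall>m. \<forall>p\<in>dom_star \<Omega> Z d \<rho> m. cmod (partial (\<lambda>m. {..<m}) Q m p) \<le>
      C1 * geom_weight B h m p)" by (rule exE)
    note C1 = conjunct1[OF C10] conjunct2[OF C10, rule_format]
    define C where "C = C1 / B + 2 * C2"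
    have "cmod (partial (\<lambda>m. {..<m}) P m p) \<le> C * cl_weight K h m p" if p: "p \<in> dom_prod \<Omega> Z d' \<rho>" for m p
    proof -
      obtain z \<zeta> \<eta> where zz: "p = (z, \<zeta>, \<eta>)" by (cases p)
      have pd: "p \<in> dom_prod \<Omega> Z d \<rho>" using p sub by blast
      define x where "x = maxnorm (\<eta> *s \<zeta>)"
      have x: "0 < x" unfolding x_def by (rule dom_prod_pos[OF p[unfolded zz] Z S d'(3) d(3)])
      have coeff: "cmod (fps_nth P \<nu> p) \<le> C2 * cl_weight A h \<nu> p" for \<nu>
        using C2(2)[OF pd, of \<nu>] by (simp add: partial_def)
      have AK: "cl_weight A h m p \<le> cl_weight K h m p" by (rule cl_weight_mono[OF A K(2)])
      have w0: "0 \<le> cl_weight K h m p" unfolding zz cl_weight_def prod.case using K(4) by simp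
      show ?thesis
      proof (cases "real m * D \<le> x")
        case True
        \<comment> \<open>The sum of length \<open>m\<close> is the optimally truncated one minus a geometrically decreasing tail.\<close>
        obtain k where k: "real k * D \<le> x" "x < real (k + 1) * D" "m \<le> k" using floor_index[OF D
          less_imp_le[OF x]] True by blast
        have "real k * (d * (1 - \<rho>)) \<le> real k * D" unfolding D_def using d d' by (intro
          mult_left_mono mult_right_mono) auto
        then have ps: "p \<in> dom_star \<Omega> Z d \<rho> k" using pd k(1) by (simp add: zz dom_star_def
          dom_prod_def x_def)
        have "partial (\<lambda>m. {..<m}) P k p = partial (\<lambda>m. {..<m}) Q k p"
          by (rule agree_partial[OF eq ps rel_compact_in_subset[OF Z] d(1,3)])
        then have "cmod (partial (\<lambda>m. {..<m}) P k p) \<le> C1 * geom_weight B h k p" using C1(2)[OF ps]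
          by simp
        also have "\<dots> \<le> C1 * (1 / B * cl_weight K h m p)"
        proof (rule mult_left_mono)
          have "B ^ k \<le> 1 / B * exp (- \<delta> * x)" using power_floor_le[OF D B(1) k(2) B(2)] by (simp
            add: \<delta>_def)
          also have "\<dots> \<le> 1 / B * (fact m * (1 / \<delta>) ^ m / x ^ m)"
            using exp_minus_le[OF \<delta> x, of m] B by (intro mult_left_mono) auto
          also have "\<dots> \<le> 1 / B * (fact m * K ^ m / x ^ m)"
            using K \<delta> B x by (intro mult_left_mono divide_right_mono power_mono) auto
          finally have "B ^ k * exp (h * maxnorm \<zeta>) \<le>
            1 / B * (fact m * K ^ m / x ^ m) * exp (h * maxnorm \<zeta>)"
            by (intro mult_right_mono) auto
          then show "geom_weight B h k p \<le> 1 / B * cl_weight K h m p"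
            by (simp add: geom_weight_def cl_weight_def zz x_def)
        qed (use C1 in simp)
        finally have 1: "cmod (partial (\<lambda>m. {..<m}) P k p) \<le> C1 / B * cl_weight K h m p" by simp
        have "cmod (\<Sum>\<nu>\<in>{m..<k}. fps_nth P \<nu> p) \<le> (\<Sum>\<nu>\<in>{m..<k}. C2 * cl_weight A h \<nu> p)"
          by (rule sum_norm_le[OF coeff])
        also have "\<dots> = C2 * (\<Sum>\<nu>\<in>{m..<k}. cl_weight A h \<nu> p)" by (simp add: sum_distrib_left)
        also have "\<dots> \<le> C2 * (2 * cl_weight A h m p)"
          unfolding zz using C2(1) by (intro mult_left_mono cl_weight_sum_below[OF A d'(2) x_def x
            k(1,3)]) auto
        also have "\<dots> \<le> C2 * (2 * cl_weight K h m p)" using AK C2(1) by (intro mult_left_mono) auto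
        finally have 2: "cmod (\<Sum>\<nu>\<in>{m..<k}. fps_nth P \<nu> p) \<le> C2 * (2 * cl_weight K h m p)" .
        have "(\<Sum>\<nu><k. fps_nth P \<nu> p) = (\<Sum>\<nu><m. fps_nth P \<nu> p) + (\<Sum>\<nu>\<in>{m..<k}. fps_nth P \<nu> p)"
          using k(3) by (simp add: lessThan_atLeast0 sum.atLeastLessThan_concat)
        then have split: "partial (\<lambda>m. {..<m}) P m p =
          partial (\<lambda>m. {..<m}) P k p - (\<Sum>\<nu>\<in>{m..<k}. fps_nth P \<nu> p)"
          by (simp add: partial_def)
        have "cmod (partial (\<lambda>m. {..<m}) P m p) \<le>
          C1 / B * cl_weight K h m p + C2 * (2 * cl_weight K h m p)"
          unfolding split using norm_triangle_ineq4[of "partial (\<lambda>m. {..<m}) P k p"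
            "\<Sum>\<nu>\<in>{m..<k}. fps_nth P \<nu> p"] 1 2 by linarith
        then show ?thesis by (simp add: C_def algebra_simps)
      next
        case False
        have "cmod (partial (\<lambda>m. {..<m}) P m p) \<le> (\<Sum>\<nu><m. C2 * cl_weight A h \<nu> p)"
          unfolding partial_def by (rule sum_norm_le[OF coeff])
        also have "\<dots> = C2 * (\<Sum>\<nu><m. cl_weight A h \<nu> p)" by (simp add: sum_distrib_left)
        also have "\<dots> \<le> C2 * cl_weight K h m p"
          unfolding zz using C2(1) A d' False x by (intro mult_left_mono cl_weight_sum_above[OF A _
            K(3) x_def]) auto
        also have "\<dots> \<le> C * cl_weight K h m p" using w0 C1(1) C2(1) B by (intro mult_right_mono)
          (auto simp: C_def)
        finally show ?thesis .
      qed
    qed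
    moreover have "C > 0" using C1(1) C2(1) B by (simp add: C_def add_pos_pos)
    ultimately show "\<exists>C>0. \<forall>m. \<forall>p\<in>dom_prod \<Omega> Z d' \<rho>. cmod (partial (\<lambda>m. {..<m}) P m p) \<le>
      C * cl_weight K h m p"
      by blast
  qed (use K in simp)
  moreover have "cl.holo_on \<Omega> S d' \<rho> P"
    by (rule cl.holo_on_mono[OF order_refl order_refl d(1) d'(1) order_refl d(3) conjunct1[OF
      P[unfolded cl.symbol_at_def]]])
  ultimately show ?thesis using d'(1) by (auto simp: cl.null_at_def)
qed


section \<open>Every formal symbol is a symbol up to a formal null symbol\<close>

text \<open>On the segment from \<open>\<eta>\<close> to a point \<open>r > cmod \<eta>\<close> of the positive axis the modulus is at least
  half that of \<open>\<eta>\<close>.\<close>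

lemma segment_lower_bound:
  assumes "S \<in> sectors" "\<eta> \<in> S" "w \<in> closed_segment \<eta> (complex_of_real r)" "cmod \<eta> < r"
  shows "cmod \<eta> / 2 \<le> cmod w"
proof -
  obtain u where u: "0 \<le> u" "u \<le> 1" "w = (1 - u) *\<^sub>R \<eta> + u *\<^sub>R complex_of_real r"
    using assms(3) unfolding closed_segment_def by blast
  have "(1 - u) * (cmod \<eta> / 2) + u * (cmod \<eta> / 2) \<le> (1 - u) * Re \<eta> + u * r"
  proof (intro add_mono mult_left_mono)
    show "cmod \<eta> / 2 \<le> r" using assms(4) norm_ge_zero[of \<eta>] by linarith
  qed (use u sectors_Re[OF assms(1,2)] in auto)
  also have "\<dots> = Re w" by (simp add: u(3))
  finally have "(1 - u) * (cmod \<eta> / 2) + u * (cmod \<eta> / 2) \<le> Re w" .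
  moreover have "(1 - u) * (cmod \<eta> / 2) + u * (cmod \<eta> / 2) = cmod \<eta> / 2"
    unfolding distrib_right[symmetric] by simp
  ultimately show ?thesis using complex_Re_le_cmod[of w] by linarith
qed

text \<open>The partial sums hardly depend on \<open>\<eta>\<close>: their \<open>\<eta>\<close>-derivatives are the partial sums of a null
  series, and the sector is convex.\<close>

lemma partial_sum_lipschitz:
  assumes S: "S \<in> sectors" and d: "0 < d" "0 < \<rho>" "\<rho> < 1" and P: "formal.symbol_at \<Omega> S d \<rho> P"
    and r: "complex_of_real r \<in> S"
  obtains A where "0 < A" "A < 1"
    "\<And>Z h. rel_compact_in Z S \<Longrightarrow> 0 < h \<Longrightarrow> \<exists>C>0. \<forall>m z \<zeta> \<eta>. \<eta> \<in> Z \<longrightarrow> cmod \<eta> < r \<longrightarrow>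
       (z, \<zeta>) \<in> thicken \<Omega> \<rho> \<longrightarrow> real m * (2 * d * (1 - \<rho>)) \<le> maxnorm (\<eta> *s \<zeta>) \<longrightarrow>
       cmod (partial (\<lambda>m. {..<m}) P m (z, \<zeta>, \<eta>) - partial (\<lambda>m. {..<m}) P m (z, \<zeta>, complex_of_real r))
         \<le> C * (A ^ m * exp (h * maxnorm \<zeta>))"
proof -
  have holo: "formal.holo_on \<Omega> S d \<rho> P" using P unfolding formal.symbol_at_def by (rule conjunct1)
  obtain A where AI: "A \<in> {0<..<1}" and AC: "\<forall>Z. \<forall>h>0. rel_compact_in Z S \<longrightarrow>
    (\<exists>C>0. \<forall>m. \<forall>p\<in>dom_star \<Omega> Z d \<rho> m. cmod (partial (\<lambda>m. {..<m}) (series_d_eta P) m p) \<le> C *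
    geom_weight A h m p)"
    using growthD[OF conjunct2[OF conjunct2[OF P[unfolded formal.symbol_at_def]]]] by (elim exE conjE)
  have A: "0 < A" "A < 1" using AI by simp_all
  show thesis
  proof (rule that[OF A])
    fix Z h assume Z: "rel_compact_in Z S" and h: "(h::real) > 0"
    define Z' where "Z' = convex hull (insert (complex_of_real r) (closure Z))"
    have cZ: "compact (closure Z)" "closure Z \<subseteq> S" using Z by (auto simp: rel_compact_in_def)
    have "compact Z'" unfolding Z'_def by (intro compact_convex_hull compact_insert cZ)
    moreover have "Z' \<subseteq> S" unfolding Z'_def using cZ r by (intro hull_minimal sectors_convex[OF S]) auto
    ultimately have Z': "rel_compact_in Z' S" unfolding rel_compact_in_def by (simp add:
      compact_imp_closed)
    from AC[rule_format, OF h Z']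
    obtain C where C0: "C > 0 \<and> (\<forall>m. \<forall>p\<in>dom_star \<Omega> Z' d \<rho> m. cmod (partial (\<lambda>m. {..<m})
      (series_d_eta P) m p) \<le> C * geom_weight A h m p)" by (rule exE)
    note C = conjunct1[OF C0] conjunct2[OF C0, rule_format]
    have "cmod (partial (\<lambda>m. {..<m}) P m (z, \<zeta>, \<eta>) - partial (\<lambda>m. {..<m}) P m (z, \<zeta>, complex_of_real r))
         \<le> C * (A ^ m * exp (h * maxnorm \<zeta>))"
      if \<eta>: "\<eta> \<in> Z" "cmod \<eta> < r" and z: "(z, \<zeta>) \<in> thicken \<Omega> \<rho>"
        and big: "real m * (2 * d * (1 - \<rho>)) \<le> maxnorm (\<eta> *s \<zeta>)" for m z \<zeta> \<eta>
    proof -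
      let ?f = "\<lambda>w. partial (\<lambda>m. {..<m}) P m (z, \<zeta>, w)"
      let ?L = "closed_segment \<eta> (complex_of_real r)"
      have \<eta>S: "\<eta> \<in> S" using \<eta>(1) rel_compact_in_subset[OF Z] by blast
      have L: "w \<in> Z'" "(z, \<zeta>, w) \<in> dom_star \<Omega> Z' d \<rho> m" if w: "w \<in> ?L" for w
      proof -
        have "?L \<subseteq> Z'"
          unfolding Z'_def using \<eta>(1) closure_subset[of Z] by (intro
            closed_segment_subset_convex_hull) (auto intro: hull_inc)
        then show wZ: "w \<in> Z'" using w by blast
        have "cmod \<eta> / 2 * maxnorm \<zeta> \<le> cmod w * maxnorm \<zeta>"
          by (intro mult_right_mono segment_lower_bound[OF S \<eta>S w \<eta>(2)]) simp
        then show "(z, \<zeta>, w) \<in> dom_star \<Omega> Z' d \<rho> m"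
          using big wZ z by (simp add: dom_star_def maxnorm_scale)
      qed
      have "cmod (?f \<eta> - ?f (complex_of_real r)) \<le>
        (C * (A ^ m * exp (h * maxnorm \<zeta>))) * cmod (\<eta> - complex_of_real r)"
      proof (rule field_differentiable_bound[where S = ?L and f' =
        "\<lambda>w. partial (\<lambda>m. {..<m}) (series_d_eta P) m (z, \<zeta>, w)"])
        fix w assume w: "w \<in> ?L"
        note pd = formal.partial_d_eta[OF holo L(2)[OF w] rel_compact_in_subset[OF Z'] d(1,3)]
        have "holo_at (\<lambda>p. partial (\<lambda>m. {..<m}) P m p) (z, \<zeta>, w)"
          unfolding partial_def by (rule holo_at_sum) (rule pd(1))
        then show "(?f has_field_derivative partial (\<lambda>m. {..<m}) (series_d_eta P) m (z, \<zeta>, w)) (at w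
          within ?L)"
          unfolding pd(2) by (rule has_field_derivative_at_within[OF d_eta_has_field_derivative])
        show "cmod (partial (\<lambda>m. {..<m}) (series_d_eta P) m (z, \<zeta>, w)) \<le>
          C * (A ^ m * exp (h * maxnorm \<zeta>))"
          using C(2)[OF L(2)[OF w]] by (simp add: geom_weight_def)
      qed auto
      also have "\<dots> \<le> (C * (A ^ m * exp (h * maxnorm \<zeta>))) * 1"
      proof (intro mult_left_mono)
        have "cmod (complex_of_real r) < 1/2" "cmod \<eta> < 1/2" using sectors_norm[OF S r]
          sectors_norm[OF S \<eta>S] by auto
        then show "cmod (\<eta> - complex_of_real r) \<le> 1" using norm_triangle_ineq4[of \<eta>
          "complex_of_real r"] by linarith
      qed (use C(1) A in simp)
      finally show ?thesis by simp
    qed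
    then show "\<exists>C>0. \<forall>m z \<zeta> \<eta>. \<eta> \<in> Z \<longrightarrow> cmod \<eta> < r \<longrightarrow>
       (z, \<zeta>) \<in> thicken \<Omega> \<rho> \<longrightarrow> real m * (2 * d * (1 - \<rho>)) \<le> maxnorm (\<eta> *s \<zeta>) \<longrightarrow>
       cmod (partial (\<lambda>m. {..<m}) P m (z, \<zeta>, \<eta>) - partial (\<lambda>m. {..<m}) P m (z, \<zeta>, complex_of_real r))
         \<le> C * (A ^ m * exp (h * maxnorm \<zeta>))"
      using C(1) by (intro exI[of _ C] conjI allI impI)
  qed
qed

lemma partial_diff: "partial J (P - Q) m p = partial J P m p - partial J Q m p"
  by (simp add: partial_def sum_subtractf)

text \<open>The terms are frozen at \<open>\<eta>0 = r0 / 2\<close> and resummed. The new sector has radius \<open>r0 / 2\<close>, so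
  that the segments from its points to \<open>\<eta>0\<close> stay where the partial sums are controlled.\<close>

lemma formal_symbol_resummed:
  fixes z0 :: "'n::finite cotangent"
  assumes z0: "snd z0 \<noteq> 0" and P: "P \<in> total_at z0 formal.syms"
  obtains q where "fps_const q \<in> total_at z0 fn.syms" "P - fps_const q \<in> total_at z0 formal.nulls"
proof -
  obtain \<Omega> S d \<rho> where \<Omega>: "\<Omega> \<in> conic_nhds z0" and S: "S \<in> sectors" and d: "0 < d" "0 < \<rho>" "\<rho> < 1"
    and PS: "formal.symbol_at \<Omega> S d \<rho> P"
    by (rule formal.total_syms_cases[OF P P])
  have holo: "formal.holo_on \<Omega> S d \<rho> P" using PS unfolding formal.symbol_at_def by (rule conjunct1)
  obtain r0 \<theta> where r0: "S = sector r0 \<theta>" "0 < r0" "r0 < 1/2" "0 < \<theta>" "\<theta> < 1/2"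
    using S unfolding sectors_def by auto
  define r where "r = r0 / 2"
  define \<eta>0 where "\<eta>0 = complex_of_real r"
  have r: "0 < r" "r < 1/2" using r0 by (auto simp: r_def)
  have "Arg \<eta>0 = 0" "cmod \<eta>0 = r" "\<eta>0 \<noteq> 0" using r by (simp_all add: \<eta>0_def Arg_of_real)
  moreover have rr0: "r < r0" using r0 by (simp add: r_def)
  ultimately have \<eta>0: "\<eta>0 \<in> S" "cmod \<eta>0 = r" using r r0(4) by (simp_all add: r0(1) sector_def)
  define S' where "S' = sector r \<theta>"
  have S': "S' \<in> sectors" unfolding sectors_def S'_def using r r0(4,5) by blast
  have S'_sub: "S' \<subseteq> S" using rr0 by (auto simp: S'_def r0(1) sector_def)
  have S'r: "cmod \<eta> < r" if "\<eta> \<in> S'" for \<eta> using that by (simp add: S'_def sector_def)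
  obtain w i u t where chart: "cone_chart w i u" and t: "0 < t" and z0eq: "z0 = (fst z0, t *\<^sub>R w)"
    by (rule cone_chart_exists[OF z0])
  interpret cone_chart "fst z0" w i u by (rule chart)
  have "open \<Omega>" "fibre_conic \<Omega>" "(fst z0, t *\<^sub>R w) \<in> \<Omega>" using \<Omega> z0eq by (auto simp: conic_nhds_def)
  then obtain k' where k': "0 < k'" "\<And>z v b. norm (z - fst z0) < k' \<Longrightarrow> norm (v - w) < k' \<Longrightarrow> 0 < b \<Longrightarrow>
    (z, b *\<^sub>R v) \<in> \<Omega>"
    using open_conic_absorbs[of \<Omega> t] t by metis
  define k0 where "k0 = min k' 1"
  have k0: "0 < k0" "k0 \<le> 1" using k' by (auto simp: k0_def)
  have cone_\<Omega>: "(z, \<zeta>) \<in> \<Omega>" if c: "cone k0 (z, \<zeta>)" for z \<zeta>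
  proof -
    define b where "b = Re (coord \<zeta>)"
    have b: "b > 0" using cone_Re[OF c k0(1)] by (simp add: b_def)
    have "(1/b) *\<^sub>R \<zeta> - w = (1/b) *\<^sub>R (\<zeta> - b *\<^sub>R w)" using b by (simp add: algebra_simps)
    then have "norm ((1/b) *\<^sub>R \<zeta> - w) = norm (\<zeta> - b *\<^sub>R w) / b" using b by simp
    also have "\<dots> < k0" using c b by (simp add: cone_def b_def divide_simps)
    finally have "(z, b *\<^sub>R ((1/b) *\<^sub>R \<zeta>)) \<in> \<Omega>" using c b by (intro k') (auto simp: cone_def k0_def)
    then show ?thesis using b by simp
  qed
  define D where "D = d * (1 - \<rho>) / r"
  have D: "D > 0" using d r by (simp add: D_def)
  have in_star: "(z, \<zeta>, \<eta>0) \<in> dom_star \<Omega> {\<eta>0} d \<rho> n"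
    if c: "cone k0 (z, \<zeta>)" and big: "real n * D \<le> maxnorm \<zeta>" for z \<zeta> n
  proof -
    have "(z, \<zeta>) \<in> thicken \<Omega> \<rho>" using cone_\<Omega>[OF c] subset_thicken[of \<rho> \<Omega>] d by auto
    moreover have "real n * (d * (1 - \<rho>)) \<le> r * maxnorm \<zeta>" using big r by (simp add: D_def field_simps)
    ultimately show ?thesis by (simp add: dom_star_def maxnorm_scale \<eta>0)
  qed
  have rc\<eta>0: "rel_compact_in {\<eta>0} S" using \<eta>0 by (simp add: rel_compact_in_def)
  obtain A where AI: "A \<in> {0<..<1}" and AC: "\<forall>Z. \<forall>h>0. rel_compact_in Z S \<longrightarrow>
    (\<exists>C>0. \<forall>m. \<forall>p\<in>dom_star \<Omega> Z d \<rho> (m + 1). cmod (partial (\<lambda>m. {m}) P m p) \<le> C * geom_weight A h m p)"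
    using growthD[OF conjunct1[OF conjunct2[OF PS[unfolded formal.symbol_at_def]]]] by (elim exE conjE)
  have A: "0 < A" "A < 1" using AI by simp_all
  interpret R: resummation "fst z0" w i u "\<lambda>\<nu>. fps_nth P \<nu>" \<eta>0 D A k0
  proof (unfold_locales)
    show "0 < D" "0 < A" "A < 1" "0 < k0" "k0 \<le> 1" by (fact D A k0)+
  next
    fix \<nu> z \<zeta> assume "cone k0 (z, \<zeta>)" "real (\<nu> + 1) * D \<le> maxnorm \<zeta>"
    then have "(z, \<zeta>, \<eta>0) \<in> dom_star \<Omega> {\<eta>0} d \<rho> (\<nu> + 1)" by (rule in_star)
    moreover have "dom_star \<Omega> {\<eta>0} d \<rho> (\<nu> + 1) \<subseteq> dom_star \<Omega> S d \<rho> (\<nu> + 1)"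
      using \<eta>0 d by (intro dom_star_mono) auto
    ultimately have "(z, \<zeta>, \<eta>0) \<in> dom_star \<Omega> S d \<rho> (\<nu> + 1)" by (rule rev_subsetD)
    then show "holo_at (fps_nth P \<nu>) (z, \<zeta>, \<eta>0)"
      by (rule holomorphic_near_holo_at[OF holo[unfolded formal.holo_on_def, rule_format, of \<nu>]])
  next
    fix h :: real assume h: "0 < h"
    from AC[rule_format, OF h rc\<eta>0]
    obtain C where C0: "C > 0 \<and> (\<forall>m. \<forall>p\<in>dom_star \<Omega> {\<eta>0} d \<rho> (m + 1). cmod (partial (\<lambda>m. {m}) P m p)
      \<le> C * geom_weight A h m p)" by (rule exE)
    show "\<exists>C>0. \<forall>\<nu> z \<zeta>. cone k0 (z, \<zeta>) \<longrightarrow> real (\<nu> + 1) * D \<le> maxnorm \<zeta> \<longrightarrow>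
       cmod (fps_nth P \<nu> (z, \<zeta>, \<eta>0)) \<le> C * A ^ \<nu> * exp (h * maxnorm \<zeta>)"
    proof (intro exI[of _ C] conjI allI impI conjunct1[OF C0])
      fix \<nu> z \<zeta> assume "cone k0 (z, \<zeta>)" "real (\<nu> + 1) * D \<le> maxnorm \<zeta>"
      from conjunct2[OF C0, rule_format, OF in_star[OF this]]
      show "cmod (fps_nth P \<nu> (z, \<zeta>, \<eta>0)) \<le> C * A ^ \<nu> * exp (h * maxnorm \<zeta>)"
        by (simp add: partial_def geom_weight_def)
    qed
  qed
  obtain q B L where B: "0 < B" "B < 1" and L: "0 < L"
    and holo_q: "\<And>z \<zeta> \<eta>. cone R.k (z, \<zeta>) \<Longrightarrow> holo_at q (z, \<zeta>, \<eta>)"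
    and indep: "\<And>z \<zeta> \<eta> \<eta>'. q (z, \<zeta>, \<eta>) = q (z, \<zeta>, \<eta>')"
    and est: "\<And>h. 0 < h \<Longrightarrow> \<exists>C>0. \<forall>m z \<zeta> \<eta>. cone R.k (z, \<zeta>) \<longrightarrow> real m * L \<le> maxnorm \<zeta> \<longrightarrow>
       cmod (q (z, \<zeta>, \<eta>) - (\<Sum>\<nu><m. fps_nth P \<nu> (z, \<zeta>, \<eta>0))) \<le> C * B ^ m * exp (h * maxnorm \<zeta>)"
    using R.resummation by metis
  obtain k1 \<rho>1 where k1: "0 < k1" "0 < \<rho>1" "\<rho>1 < 1"
    and thick: "\<And>z \<zeta>. (z, \<zeta>) \<in> thicken {p. cone k1 p} \<rho>1 \<Longrightarrow> \<zeta> \<noteq> 0 \<Longrightarrow> cone R.k (z, \<zeta>)"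
    using thicken_cone[OF R.par_facts(4)] by metis
  define \<Omega>' where "\<Omega>' = {p. cone k1 p}"
  have \<Omega>': "\<Omega>' \<in> conic_nhds z0" unfolding \<Omega>'_def using cone_in_conic_nhds[OF k1(1) t] z0eq by simp
  have \<Omega>'\<Omega>: "\<Omega>' \<subseteq> \<Omega>"
  proof
    fix p assume p: "p \<in> \<Omega>'"
    obtain z \<zeta> where zz: "p = (z, \<zeta>)" by (cases p)
    have c: "cone k1 (z, \<zeta>)" using p by (simp add: \<Omega>'_def zz)
    have nz: "\<zeta> \<noteq> 0" using cone_Re[OF c k1(1)] by auto
    have "(z, \<zeta>) \<in> thicken {p. cone k1 p} \<rho>1" using c subset_thicken[of \<rho>1 "{p. cone k1 p}"] k1 by auto
    then have c2: "cone R.k (z, \<zeta>)" using thick nz by blast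
    then have "(z, \<zeta>, 0) \<in> R.U" by (simp add: R.U_def)
    from R.cone_k_k0[OF this] show "p \<in> \<Omega>" using cone_\<Omega> by (simp add: zz)
  qed
  define \<rho>' where "\<rho>' = min \<rho> \<rho>1"
  have \<rho>': "0 < \<rho>'" "\<rho>' < 1" "\<rho>' \<le> \<rho>" "\<rho>' \<le> \<rho>1" using d k1 by (auto simp: \<rho>'_def)
  define d' where "d' = max (2 * d) (L / (1 - \<rho>'))"
  have d': "2 * d \<le> d'" "L \<le> d' * (1 - \<rho>')" "0 < d'" "d \<le> d'"
    using d L \<rho>' by (auto simp: d'_def max_def field_simps)
  have in_cone: "cone R.k (z, \<zeta>)" if "(z, \<zeta>) \<in> thicken \<Omega>' \<rho>'" "0 < maxnorm \<zeta>" for z \<zeta>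
    using thick thicken_mono[OF order_refl \<rho>'(4), of \<Omega>'] that unfolding \<Omega>'_def[symmetric]
      maxnorm_pos_iff by blast
  have near_q: "holomorphic_near q X" if X: "X \<subseteq> {p. cone R.k (fst p, fst (snd p))}" for X
    unfolding holomorphic_near_iff
  proof (intro exI[of _ R.U] conjI ballI R.open_U)
    show "X \<subseteq> R.U" using X by (simp add: R.U_def)
    fix p assume "p \<in> R.U"
    then show "holo_at q p" using holo_q by (cases p) (simp add: R.U_def)
  qed
  have d\<rho>': "0 < d' * (1 - \<rho>')" using d' \<rho>' by simp
  have prod_cone: "dom_prod \<Omega>' S' d' \<rho>' \<subseteq> {p. cone R.k (fst p, fst (snd p))}"
    using in_cone d\<rho>' by (auto simp: dom_prod_def)
  have q_holo: "holomorphic_near q (dom_prod \<Omega>' S' d' \<rho>')" by (rule near_q[OF prod_cone])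
  have fn_holo: "fn.holo_on \<Omega>' S' d' \<rho>' (fps_const q)"
    unfolding fn.holo_on_def using q_holo by (simp add: holomorphic_near_zero)
  have "fn.symbol_at \<Omega>' S' d' \<rho>' (fps_const q)"
    unfolding fn.symbol_at_def
  proof (intro conjI fn_holo)
    show "growth exp_weight {0<..} (\<lambda>Z m. dom_prod \<Omega>' Z d' \<rho>') S' (partial (\<lambda>m. {0}) (fps_const q))"
    proof (rule growthI[where A = 1])
      fix Z h assume h: "(h::real) > 0" and Z: "rel_compact_in Z S'"
      from est[OF h] obtain C where C: "C > 0 \<and> (\<forall>m z \<zeta> \<eta>. cone R.k (z, \<zeta>) \<longrightarrow> real m * L \<le> maxnorm \<zeta> \<longrightarrow>
         cmod (q (z, \<zeta>, \<eta>) - (\<Sum>\<nu><m. fps_nth P \<nu> (z, \<zeta>, \<eta>0))) \<le> C * B ^ m * exp (h * maxnorm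
           \<zeta>))" by (rule exE)
      have "cmod (q p) \<le> C * exp_weight 1 h m p" if p: "p \<in> dom_prod \<Omega>' Z d' \<rho>'" for m p
      proof -
        obtain z \<zeta> \<eta> where zz: "p = (z, \<zeta>, \<eta>)" by (cases p)
        have c: "cone R.k (z, \<zeta>)" using p d\<rho>' by (intro in_cone) (auto simp: zz dom_prod_def)
        \<comment> \<open>For \<open>m = 0\<close> the partial sum is empty and the estimate bounds \<open>q\<close> itself.\<close>
        from conjunct2[OF C, rule_format, OF c, of 0 \<eta>] show ?thesis by (simp add: zz exp_weight_def)
      qed
      then show "\<exists>C>0. \<forall>m. \<forall>p\<in>dom_prod \<Omega>' Z d' \<rho>'. cmod (partial (\<lambda>m. {0}) (fps_const q) m p) \<le>
        C * exp_weight 1 h m p"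
        unfolding partial_const using conjunct1[OF C] by blast
    qed simp
    have "d_eta q = (\<lambda>p. 0)"
    proof
      fix p :: "'n point"
      obtain z \<zeta> \<eta> where zz: "p = (z, \<zeta>, \<eta>)" by (cases p)
      have "(\<lambda>w. q (z, \<zeta>, w)) = (\<lambda>w. q (z, \<zeta>, 0))" using indep by blast
      then show "d_eta q p = 0" by (simp add: d_eta_def zz)
    qed
    then have "partial (\<lambda>m. {0}) (series_d_eta (fps_const q)) = (\<lambda>m p. 0)"
      unfolding series_d_eta_const by (simp add: fun_eq_iff partial_const)
    then show "growth fun_weight {0<..} (\<lambda>Z m. dom_prod \<Omega>' Z d' \<rho>') S' (partial (\<lambda>m. {0})
      (series_d_eta (fps_const q)))"
      by (simp only:) (intro growth_zero fn.I_ne fn.wN_nonneg)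
  qed
  then have 1: "fps_const q \<in> total_at z0 fn.syms"
    by (rule fn.total_symsI[OF \<Omega>' S' d'(3) \<rho>'(1,2)])
  obtain A1 where A1: "0 < A1" "A1 < 1" and lip:
    "\<And>Z h. rel_compact_in Z S \<Longrightarrow> 0 < h \<Longrightarrow> \<exists>C>0. \<forall>m z \<zeta> \<eta>. \<eta> \<in> Z \<longrightarrow> cmod \<eta> < r \<longrightarrow>
       (z, \<zeta>) \<in> thicken \<Omega> \<rho> \<longrightarrow> real m * (2 * d * (1 - \<rho>)) \<le> maxnorm (\<eta> *s \<zeta>) \<longrightarrow>
       cmod (partial (\<lambda>m. {..<m}) P m (z, \<zeta>, \<eta>) - partial (\<lambda>m. {..<m}) P m (z, \<zeta>, complex_of_real r))
         \<le> C * (A1 ^ m * exp (h * maxnorm \<zeta>))"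
    using partial_sum_lipschitz[OF S d PS \<eta>0(1)[unfolded \<eta>0_def]] by metis
  define b where "b = max A1 B"
  have b: "0 < b" "b < 1" "A1 \<le> b" "B \<le> b" using A1 B by (auto simp: b_def)
  have "formal.null_at \<Omega>' S' d' \<rho>' (P - fps_const q)"
    unfolding formal.null_at_def
  proof (intro conjI)
    have cl_holo: "cl.holo_on \<Omega>' S' d' \<rho>' (fps_const q)" using fn_holo by (simp add: fn.holo_on_def
      cl.holo_on_def)
    have 1: "formal.holo_on \<Omega>' S' d' \<rho>' (fps_const q)" by (rule cl_holo_formal_holo[OF cl_holo S'
      d'(3) \<rho>'(2)])
    have 2: "formal.holo_on \<Omega>' S' d' \<rho>' P" by (rule formal.holo_on_mono[OF \<Omega>'\<Omega> S'_sub d(1) d'(4)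
      \<rho>'(3) d(3) holo])
    have "P - fps_const q = P + series_scale (-1) (fps_const q)"
      by (rule fps_ext) (auto simp: fun_eq_iff)
    then show "formal.holo_on \<Omega>' S' d' \<rho>' (P - fps_const q)"
      using formal.holo_on_add[OF 2 formal.holo_on_scale[OF 1]] by (simp only:)
    show "growth geom_weight {0<..<1} (\<lambda>Z m. dom_star \<Omega>' Z d' \<rho>' m) S' (partial (\<lambda>m. {..<m}) (P -
      fps_const q))"
    proof (rule growthI[where A = b])
      fix Z h assume h: "(h::real) > 0" and Z: "rel_compact_in Z S'"
      from est[OF h] obtain C1 where C1: "C1 > 0 \<and> (\<forall>m z \<zeta> \<eta>. cone R.k (z, \<zeta>) \<longrightarrow> real m * L \<le> maxnorm \<zeta> \<longrightarrow>
         cmod (q (z, \<zeta>, \<eta>) - (\<Sum>\<nu><m. fps_nth P \<nu> (z, \<zeta>, \<eta>0))) \<le> C1 * B ^ m * exp (h * maxnorm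
           \<zeta>))" by (rule exE)
      from lip[OF rel_compact_in_mono[OF Z S'_sub] h]
      obtain C2 where C2: "C2 > 0 \<and> (\<forall>m z \<zeta> \<eta>. \<eta> \<in> Z \<longrightarrow> cmod \<eta> < r \<longrightarrow>
       (z, \<zeta>) \<in> thicken \<Omega> \<rho> \<longrightarrow> real m * (2 * d * (1 - \<rho>)) \<le> maxnorm (\<eta> *s \<zeta>) \<longrightarrow>
       cmod (partial (\<lambda>m. {..<m}) P m (z, \<zeta>, \<eta>) - partial (\<lambda>m. {..<m}) P m (z, \<zeta>, complex_of_real r))
         \<le> C2 * (A1 ^ m * exp (h * maxnorm \<zeta>)))" by (rule exE)
      have "cmod (partial (\<lambda>m. {..<m}) (P - fps_const q) m p) \<le> (C1 + C2) * geom_weight b h m p"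
        if p: "p \<in> dom_star \<Omega>' Z d' \<rho>' m" for m p
      proof (cases "m = 0")
        case True
        have "0 \<le> geom_weight b h m p" by (rule formal.wN_nonneg) (use b in simp)
        then show ?thesis using True C1 C2 by (simp add: partial_def)
      next
        case False
        obtain z \<zeta> \<eta> where zz: "p = (z, \<zeta>, \<eta>)" by (cases p)
        have p': "(z, \<zeta>) \<in> thicken \<Omega>' \<rho>'" "\<eta> \<in> Z" "real m * (d' * (1 - \<rho>')) \<le> maxnorm (\<eta> *s \<zeta>)"
          using p by (auto simp: zz dom_star_def)
        have \<eta>S': "\<eta> \<in> S'" using p'(2) rel_compact_in_subset[OF Z] by blast
        have "cmod \<eta> * maxnorm \<zeta> \<le> 1 * maxnorm \<zeta>" using sectors_norm[OF S' \<eta>S'] by (intro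
          mult_right_mono) auto
        then have xz: "maxnorm (\<eta> *s \<zeta>) \<le> maxnorm \<zeta>" by (simp add: maxnorm_scale)
        have "real m * L \<le> real m * (d' * (1 - \<rho>'))" using d'(2) by (intro mult_left_mono) auto
        then have mL: "real m * L \<le> maxnorm \<zeta>" using p'(3) xz by linarith
        have "0 < real m * L" using False L by simp
        then have c: "cone R.k (z, \<zeta>)" using mL by (intro in_cone p'(1)) linarith
        have th: "(z, \<zeta>) \<in> thicken \<Omega> \<rho>" using thicken_mono[OF \<Omega>'\<Omega> \<rho>'(3)] p'(1) by blast
        have "2 * d * (1 - \<rho>) \<le> d' * (1 - \<rho>')" using d d' \<rho>' by (intro mult_mono) auto
        then have "real m * (2 * d * (1 - \<rho>)) \<le> real m * (d' * (1 - \<rho>'))" by (intro mult_left_mono) auto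
        then have big: "real m * (2 * d * (1 - \<rho>)) \<le> maxnorm (\<eta> *s \<zeta>)" using p'(3) by linarith
        define E where "E = exp (h * maxnorm \<zeta>)"
        let ?S = "partial (\<lambda>m. {..<m}) P m"
        have "cmod (q (z, \<zeta>, \<eta>) - ?S (z, \<zeta>, \<eta>0)) \<le> C1 * B ^ m * E"
          unfolding partial_def E_def by (rule conjunct2[OF C1, rule_format, OF c mL])
        also have "\<dots> \<le> C1 * b ^ m * E" using C1 b B by (intro mult_right_mono mult_left_mono
          power_mono) (auto simp: E_def)
        finally have 1: "cmod (q (z, \<zeta>, \<eta>) - ?S (z, \<zeta>, \<eta>0)) \<le> C1 * b ^ m * E" .
        have "cmod (?S (z, \<zeta>, \<eta>) - ?S (z, \<zeta>, \<eta>0)) \<le> C2 * (A1 ^ m * E)"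
          unfolding E_def \<eta>0_def by (rule conjunct2[OF C2, rule_format, OF p'(2) S'r[OF \<eta>S'] th big])
        also have "\<dots> \<le> C2 * (b ^ m * E)" using C2 b A1 by (intro mult_right_mono mult_left_mono
          power_mono) (auto simp: E_def)
        finally have 2: "cmod (?S (z, \<zeta>, \<eta>) - ?S (z, \<zeta>, \<eta>0)) \<le> C2 * (b ^ m * E)" .
        have split: "partial (\<lambda>m. {..<m}) (P - fps_const q) m p
            = (?S (z, \<zeta>, \<eta>) - ?S (z, \<zeta>, \<eta>0)) - (q (z, \<zeta>, \<eta>) - ?S (z, \<zeta>, \<eta>0))"
          using False by (simp add: partial_diff partial_const zz)
        have "cmod (partial (\<lambda>m. {..<m}) (P - fps_const q) m p) \<le> C2 * (b ^ m * E) + C1 * b ^ m * E"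
          unfolding split using norm_triangle_ineq4[of "?S (z, \<zeta>, \<eta>) - ?S (z, \<zeta>, \<eta>0)"
            "q (z, \<zeta>, \<eta>) - ?S (z, \<zeta>, \<eta>0)"] 1 2
          by linarith
        then show ?thesis by (simp add: geom_weight_def zz E_def algebra_simps)
      qed
      moreover have "0 < C1 + C2" using C1 C2 by simp
      ultimately show "\<exists>C>0. \<forall>m. \<forall>p\<in>dom_star \<Omega>' Z d' \<rho>' m. cmod (partial (\<lambda>m. {..<m}) (P - fps_const
        q) m p) \<le> C * geom_weight b h m p"
        by blast
    qed (use b in simp)
  qed
  then have 2: "P - fps_const q \<in> total_at z0 formal.nulls"
    by (rule formal.total_nullsI[OF \<Omega>' S' d'(3) \<rho>'(1,2)])
  show thesis by (rule that[OF 1 2])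
qed

section \<open>Classical symbols are determined by their restriction\<close>

text \<open>The identity theorem along the rays \<open>\<lambda> \<mapsto> (z, \<lambda> \<zeta>, \<eta>)\<close>, \<open>\<lambda> \<ge> 1\<close>.\<close>

lemma identity_on_ray:
  assumes hol: "\<And>t. 1 \<le> t \<Longrightarrow> \<exists>W. open W \<and> (z, complex_of_real t *s \<zeta>, \<eta>) \<in> W \<and> (\<forall>x\<in>W. holo_at f x)"
    and zero: "\<And>t. N \<le> t \<Longrightarrow> f (z, complex_of_real t *s \<zeta>, \<eta>) = 0"
  shows "f (z, \<zeta>, \<eta>) = 0"
proof -
  define W where "W = \<Union> {W. open W \<and> (\<forall>x\<in>W. holo_at f x)}"
  have W: "open W" "\<And>x. x \<in> W \<Longrightarrow> holo_at f x" unfolding W_def by auto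
  let ?v = "(0, \<zeta>, 0) :: 'a point"
  let ?l = "\<lambda>\<mu>. (z, 0, \<eta>) + point_scale \<mu> ?v"
  have l: "?l \<mu> = (z, \<mu> *s \<zeta>, \<eta>)" for \<mu> by (simp add: point_scale_def)
  define T where "T = ?l -` W"
  have "continuous_on UNIV ?l"
    by (intro continuous_intros bounded_linear.continuous_on[OF
      bounded_bilinear.bounded_linear_left[OF bounded_bilinear_point_scale]])
  then have oT: "open T" unfolding T_def by (intro open_vimage W)
  let ?ray = "complex_of_real ` {1..}"
  have ray: "?ray \<subseteq> T" using hol unfolding T_def W_def l by blast
  have conray: "connected ?ray" by (intro connected_continuous_image continuous_intros) simp
  define C where "C = connected_component_set T 1"
  have one: "(1::complex) \<in> ?ray" by (rule image_eqI[of _ _ 1]) auto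
  have rC: "?ray \<subseteq> C" unfolding C_def by (rule connected_component_maximal[OF one conray ray])
  have "(\<lambda>\<mu>. f (?l \<mu>)) field_differentiable at \<mu>" if "\<mu> \<in> C" for \<mu>
  proof (rule holo_at_line, rule W(2))
    show "?l \<mu> \<in> W" using that connected_component_subset[of T 1] unfolding C_def T_def by blast
  qed
  then have holC: "(\<lambda>\<mu>. f (?l \<mu>)) holomorphic_on C"
    by (simp add: holomorphic_on_def field_differentiable_at_within)
  define a where "a = max 1 N"
  let ?Z = "complex_of_real ` {a..a+1}"
  have "(\<lambda>\<mu>. f (?l \<mu>)) 1 = 0"
  proof (rule analytic_continuation[OF holC])
    show "open C" unfolding C_def by (rule open_connected_component[OF oT])
    show "connected C" unfolding C_def by simp
    show "?Z \<subseteq> C" using rC by (force simp: a_def)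
    show "complex_of_real a \<in> C" using rC by (force simp: a_def)
    show "complex_of_real a islimpt ?Z"
    proof (rule connected_imp_perfect)
      show "connected ?Z" by (intro connected_continuous_image continuous_intros) simp
      show "complex_of_real a \<in> ?Z" by auto
      show "?Z \<noteq> {x}" for x
      proof
        assume x: "?Z = {x}"
        have "complex_of_real a \<in> ?Z" "complex_of_real (a + 1) \<in> ?Z" by (rule imageI, simp)+
        then have "complex_of_real a = complex_of_real (a + 1)" unfolding x by simp
        then show False unfolding of_real_eq_iff by simp
      qed
    qed
    show "f (?l \<mu>) = 0" if "\<mu> \<in> ?Z" for \<mu> using that zero unfolding l by (auto simp: a_def)
    show "1 \<in> C" using rC one by blast
  qed
  then show ?thesis unfolding l by simp
qed

lemma cl_geq_if_formal_geq:
  assumes P: "P \<in> total_at z0 cl.syms" and Q: "Q \<in> total_at z0 cl.syms" and eq: "formal.geq z0 P Q"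
  shows "cl.geq z0 P Q"
proof -
  obtain \<Omega>1 S1 d1 \<rho>1 where 1: "\<Omega>1 \<in> conic_nhds z0" "S1 \<in> sectors" "0 < d1" "0 < \<rho>1" "\<rho>1 < 1"
    and PQ: "cl.symbol_at \<Omega>1 S1 d1 \<rho>1 P" "cl.symbol_at \<Omega>1 S1 d1 \<rho>1 Q"
    by (rule cl.total_syms_cases[OF P Q])
  obtain \<Omega>2 S2 d2 \<rho>2 where 2: "\<Omega>2 \<in> conic_nhds z0" "S2 \<in> sectors" "0 < d2" "0 < \<rho>2" "\<rho>2 < 1"
    and agree: "\<And>\<nu> p. p \<in> dom_star \<Omega>2 S2 d2 \<rho>2 (\<nu> + 1) \<Longrightarrow> fps_nth P \<nu> p = fps_nth Q \<nu> p"
    using eq unfolding formal.geq_def by blast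
  obtain d \<rho> where c: "0 < d" "0 < \<rho>" "\<rho> < 1" "d1 \<le> d" "d2 \<le> d" "\<rho> \<le> \<rho>1" "\<rho> \<le> \<rho>2"
    using common_params[OF 1(3) 2(3) 1(4,5) 2(4,5)] by blast
  let ?\<Omega> = "\<Omega>1 \<inter> \<Omega>2" and ?S = "S1 \<inter> S2"
  have \<Omega>: "?\<Omega> \<in> conic_nhds z0" by (rule conic_nhds_Int[OF 1(1) 2(1)])
  have S: "?S \<in> sectors" by (rule sectors_Int[OF 1(2) 2(2)])
  show ?thesis
  proof (rule cl.geqI[OF \<Omega> S c(1-3)])
    fix \<nu> p assume p: "p \<in> dom_prod ?\<Omega> ?S d \<rho>"
    obtain z \<zeta> \<eta> where zz: "p = (z, \<zeta>, \<eta>)" by (cases p)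
    have th: "(z, \<zeta>) \<in> thicken ?\<Omega> \<rho>" and \<zeta>: "d * (1 - \<rho>) \<le> maxnorm \<zeta>" and \<eta>: "\<eta> \<in> ?S" using p by
      (auto simp: zz dom_prod_def)
    have d\<rho>: "0 < d * (1 - \<rho>)" using c by simp
    have x: "0 < cmod \<eta> * maxnorm \<zeta>" using sectors_norm[OF S \<eta>] \<zeta> d\<rho> by simp
    have con: "fibre_conic ?\<Omega>" using \<Omega> by (simp add: conic_nhds_def)
    have th': "(z, complex_of_real t *s \<zeta>) \<in> thicken ?\<Omega> \<rho>" if "1 \<le> t" for t
      using thicken_conic[OF con th, of t] that by (simp add: scaleR_eq_smult)
    define f where "f = (\<lambda>p. fps_nth P \<nu> p - fps_nth Q \<nu> p)"
    have "f (z, \<zeta>, \<eta>) = 0"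
    proof (rule identity_on_ray)
      fix t :: real assume t: "1 \<le> t"
      have "1 * maxnorm \<zeta> \<le> t * maxnorm \<zeta>" using t by (intro mult_right_mono) auto
      then have "(z, complex_of_real t *s \<zeta>, \<eta>) \<in> dom_prod ?\<Omega> ?S d \<rho>"
        using th'[OF t] \<eta> \<zeta> t by (simp add: dom_prod_def maxnorm_scale)
      moreover have "dom_prod ?\<Omega> ?S d \<rho> \<subseteq> dom_prod \<Omega>1 S1 d1 \<rho>1" using c 1 by (intro dom_prod_mono) auto
      ultimately have q: "(z, complex_of_real t *s \<zeta>, \<eta>) \<in> dom_prod \<Omega>1 S1 d1 \<rho>1" by (rule rev_subsetD)
      have "holomorphic_near (fps_nth P \<nu>) (dom_prod \<Omega>1 S1 d1 \<rho>1)"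
        by (rule conjunct1[OF PQ(1)[unfolded cl.symbol_at_def], unfolded cl.holo_on_def, rule_format])
      then obtain W1 where W1: "open W1" "dom_prod \<Omega>1 S1 d1 \<rho>1 \<subseteq> W1" "\<forall>p\<in>W1. holo_at (fps_nth P \<nu>) p"
        unfolding holomorphic_near_iff by (elim exE conjE)
      have "holomorphic_near (fps_nth Q \<nu>) (dom_prod \<Omega>1 S1 d1 \<rho>1)"
        by (rule conjunct1[OF PQ(2)[unfolded cl.symbol_at_def], unfolded cl.holo_on_def, rule_format])
      then obtain W2 where W2: "open W2" "dom_prod \<Omega>1 S1 d1 \<rho>1 \<subseteq> W2" "\<forall>p\<in>W2. holo_at (fps_nth Q \<nu>) p"
        unfolding holomorphic_near_iff by (elim exE conjE)
      show "\<exists>W. open W \<and> (z, complex_of_real t *s \<zeta>, \<eta>) \<in> W \<and> (\<forall>x\<in>W. holo_at f x)"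
      proof (intro exI[of _ "W1 \<inter> W2"] conjI ballI)
        show "open (W1 \<inter> W2)" using W1 W2 by blast
        show "(z, complex_of_real t *s \<zeta>, \<eta>) \<in> W1 \<inter> W2" using q W1(2) W2(2) by blast
        fix x assume "x \<in> W1 \<inter> W2"
        then show "holo_at f x" unfolding f_def using W1(3) W2(3) by (intro holo_at_diff) simp_all
      qed
    next
      fix t :: real assume t: "max 1 (real (\<nu> + 1) * (d * (1 - \<rho>)) / (cmod \<eta> * maxnorm \<zeta>)) \<le> t"
      then have t1: "1 \<le> t" "real (\<nu> + 1) * (d * (1 - \<rho>)) / (cmod \<eta> * maxnorm \<zeta>) \<le> t" by auto
      have "real (\<nu> + 1) * (d * (1 - \<rho>)) \<le> t * (cmod \<eta> * maxnorm \<zeta>)"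
        using t1(2) x by (simp only: pos_divide_le_eq)
      then have "(z, complex_of_real t *s \<zeta>, \<eta>) \<in> dom_star ?\<Omega> ?S d \<rho> (\<nu> + 1)"
        using th'[OF t1(1)] \<eta> t1(1) by (simp add: dom_star_def maxnorm_scale mult_ac)
      moreover have "dom_star ?\<Omega> ?S d \<rho> (\<nu> + 1) \<subseteq> dom_star \<Omega>2 S2 d2 \<rho>2 (\<nu> + 1)" using c 2 by (intro
        dom_star_mono) auto
      ultimately have "(z, complex_of_real t *s \<zeta>, \<eta>) \<in> dom_star \<Omega>2 S2 d2 \<rho>2 (\<nu> + 1)" by (rule
        rev_subsetD)
      then show "f (z, complex_of_real t *s \<zeta>, \<eta>) = 0" unfolding f_def using agree by simp
    qed
    then show "fps_nth P \<nu> p = fps_nth Q \<nu> p" by (simp add: f_def zz)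
  qed
qed


section \<open>The statements for germs\<close>

lemma total_fn_cl_nulls: "fps_const q \<in> total_at z0 fn.nulls \<Longrightarrow> fps_const q \<in> total_at z0 cl.nulls"
  by (rule fn.total_nulls_cases[of "fps_const q" z0 "fps_const q"], assumption, assumption)
     (rule cl.total_nullsI[OF _ _ _ _ _ fn_null_cl_null])

lemma total_fn_cl_syms: "fps_const q \<in> total_at z0 fn.syms \<Longrightarrow> fps_const q \<in> total_at z0 cl.syms"
  by (rule fn.total_syms_cases[of "fps_const q" z0 "fps_const q"], assumption, assumption)
     (rule cl.total_symsI[OF _ _ _ _ _ fn_symbol_cl_symbol])

lemma total_cl_formal_nulls:
  assumes P: "P \<in> total_at z0 cl.nulls"
  shows "P \<in> total_at z0 formal.nulls"
proof (rule cl.total_nulls_cases[OF P P])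
  fix \<Omega> S d \<rho> assume *: "\<Omega> \<in> conic_nhds z0" "S \<in> sectors" "0 < d" "0 < \<rho>" "\<rho> < 1" "cl.null_at \<Omega> S d \<rho> P"
  obtain d' where "d \<le> d' \<and> formal.null_at \<Omega> S d' \<rho> P" using cl_null_formal_null[OF *(2,3,5,6)] by
    (rule exE)
  then show ?thesis using * by (intro formal.total_nullsI[of \<Omega> z0 S d' \<rho>]) auto
qed

lemma total_cl_formal_syms:
  assumes P: "P \<in> total_at z0 cl.syms"
  shows "P \<in> total_at z0 formal.syms"
proof (rule cl.total_syms_cases[OF P P])
  fix \<Omega> S d \<rho> assume *: "\<Omega> \<in> conic_nhds z0" "S \<in> sectors" "0 < d" "0 < \<rho>" "\<rho> < 1" "cl.symbol_at \<Omega> S d \<rho> P"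
  obtain d' where "d \<le> d' \<and> formal.symbol_at \<Omega> S d' \<rho> P" using cl_symbol_formal_symbol[OF
    *(2,3,5,6)] by (rule exE)
  then show ?thesis using * by (intro formal.total_symsI[of \<Omega> z0 S d' \<rho>]) auto
qed

lemma cl_geq_formal_geq:
  assumes "cl.geq z0 P Q"
  shows "formal.geq z0 P Q"
proof -
  obtain \<Omega> S d \<rho> where *: "\<Omega> \<in> conic_nhds z0" "S \<in> sectors" "0 < d" "0 < \<rho>" "\<rho> < 1"
    "\<And>\<nu> p. p \<in> dom_prod \<Omega> S d \<rho> \<Longrightarrow> fps_nth P \<nu> p = fps_nth Q \<nu> p"
    using assms unfolding cl.geq_def by blast
  have S1: "S \<subseteq> cball 0 1" using sectors_norm[OF *(2)] by force
  show ?thesis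
  proof (rule formal.geqI[OF *(1-5)])
    fix \<nu> p assume "p \<in> dom_star \<Omega> S d \<rho> (\<nu> + 1)"
    moreover have "dom_star \<Omega> S d \<rho> (\<nu> + 1) \<subseteq> dom_prod \<Omega> S d \<rho>"
      using * by (intro dom_star_subset_dom_prod[OF S1]) auto
    ultimately show "fps_nth P \<nu> p = fps_nth Q \<nu> p" using *(6) by blast
  qed
qed

text \<open>A formal null series and a series with the same germ have a common domain of agreement and
  estimates.\<close>

lemma formal_null_agree:
  assumes Q: "Q \<in> total_at z0 formal.nulls" and eq: "formal.geq z0 P Q"
  obtains \<Omega> S d \<rho> where "\<Omega> \<in> conic_nhds z0" "S \<in> sectors" "0 < d" "0 < \<rho>" "\<rho> < 1"
    "formal.null_at \<Omega> S d \<rho> Q"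
    "\<forall>\<nu>. \<forall>p\<in>dom_star \<Omega> S d \<rho> (\<nu> + 1). fps_nth P \<nu> p = fps_nth Q \<nu> p"
proof -
  obtain \<Omega>1 S1 d1 \<rho>1 where 1: "\<Omega>1 \<in> conic_nhds z0" "S1 \<in> sectors" "0 < d1" "0 < \<rho>1" "\<rho>1 < 1"
    and N: "formal.null_at \<Omega>1 S1 d1 \<rho>1 Q"
    by (rule formal.total_nulls_cases[OF Q Q])
  obtain \<Omega>2 S2 d2 \<rho>2 where 2: "\<Omega>2 \<in> conic_nhds z0" "S2 \<in> sectors" "0 < d2" "0 < \<rho>2" "\<rho>2 < 1"
    and agree: "\<And>\<nu> p. p \<in> dom_star \<Omega>2 S2 d2 \<rho>2 (\<nu> + 1) \<Longrightarrow> fps_nth P \<nu> p = fps_nth Q \<nu> p"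
    using eq unfolding formal.geq_def by blast
  obtain d \<rho> where c: "0 < d" "0 < \<rho>" "\<rho> < 1" "d1 \<le> d" "d2 \<le> d" "\<rho> \<le> \<rho>1" "\<rho> \<le> \<rho>2"
    using common_params[OF 1(3) 2(3) 1(4,5) 2(4,5)] by blast
  show thesis
  proof (rule that[OF conic_nhds_Int[OF 1(1) 2(1)] sectors_Int[OF 1(2) 2(2)] c(1-3)
        formal.null_at_mono[OF Int_lower1 Int_lower1 1(3) c(4,6) 1(5) N]], intro allI ballI)
    fix \<nu> p assume p: "p \<in> dom_star (\<Omega>1 \<inter> \<Omega>2) (S1 \<inter> S2) d \<rho> (\<nu> + 1)"
    have "dom_star (\<Omega>1 \<inter> \<Omega>2) (S1 \<inter> S2) d \<rho> (\<nu> + 1) \<subseteq> dom_star \<Omega>2 S2 d2 \<rho>2 (\<nu> + 1)"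
      using c 2 by (intro dom_star_mono) auto
    then show "fps_nth P \<nu> p = fps_nth Q \<nu> p" using agree p by blast
  qed
qed

lemma total_symbol_formally_null:
  assumes P: "fps_const q \<in> total_at z0 fn.syms" and Q: "Q \<in> total_at z0 formal.nulls" and eq:
    "formal.geq z0 (fps_const q) Q"
  shows "fps_const q \<in> total_at z0 fn.nulls"
proof -
  obtain \<Omega>1 S1 d1 \<rho>1 where 1: "\<Omega>1 \<in> conic_nhds z0" "S1 \<in> sectors" "0 < d1" "0 < \<rho>1" "\<rho>1 < 1"
    and s: "fn.symbol_at \<Omega>1 S1 d1 \<rho>1 (fps_const q)"
    by (rule fn.total_syms_cases[OF P P])
  obtain \<Omega>2 S2 d2 \<rho>2 where 2: "\<Omega>2 \<in> conic_nhds z0" "S2 \<in> sectors" "0 < d2" "0 < \<rho>2" "\<rho>2 < 1"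
    "formal.null_at \<Omega>2 S2 d2 \<rho>2 Q"
    "\<forall>\<nu>. \<forall>p\<in>dom_star \<Omega>2 S2 d2 \<rho>2 (\<nu> + 1). fps_nth (fps_const q) \<nu> p = fps_nth Q \<nu> p"
    by (rule formal_null_agree[OF Q eq])
  obtain d \<rho> where c: "0 < d" "0 < \<rho>" "\<rho> < 1" "d1 \<le> d" "d2 \<le> d" "\<rho> \<le> \<rho>1" "\<rho> \<le> \<rho>2"
    using common_params[OF 1(3) 2(3) 1(4,5) 2(4,5)] by blast
  let ?\<Omega> = "\<Omega>1 \<inter> \<Omega>2" and ?S = "S1 \<inter> S2"
  have S: "?S \<in> sectors" by (rule sectors_Int[OF 1(2) 2(2)])
  have "fn.null_at ?\<Omega> ?S d \<rho> (fps_const q)"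
  proof (rule symbol_formally_null[OF S c(1-3)])
    show "fn.symbol_at ?\<Omega> ?S d \<rho> (fps_const q)" by (rule fn.symbol_at_mono[OF Int_lower1 Int_lower1
      1(3) c(4,6) 1(5) s])
    show "formal.null_at ?\<Omega> ?S d \<rho> Q" by (rule formal.null_at_mono[OF Int_lower2 Int_lower2 2(3)
      c(5,7) 2(5,6)])
    fix \<nu> p assume p: "p \<in> dom_star ?\<Omega> ?S d \<rho> (\<nu> + 1)"
    have "dom_star ?\<Omega> ?S d \<rho> (\<nu> + 1) \<subseteq> dom_star \<Omega>2 S2 d2 \<rho>2 (\<nu> + 1)" using c 2(1-5) by (intro
      dom_star_mono) auto
    then show "fps_nth (fps_const q) \<nu> p = fps_nth Q \<nu> p" using 2(7) p by blast
  qed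
  then show ?thesis by (rule fn.total_nullsI[OF conic_nhds_Int[OF 1(1) 2(1)] S c(1-3)])
qed

lemma total_cl_symbol_formally_null:
  assumes P: "P \<in> total_at z0 cl.syms" and Q: "Q \<in> total_at z0 formal.nulls" and eq: "formal.geq z0 P Q"
  shows "P \<in> total_at z0 cl.nulls"
proof -
  obtain \<Omega>1 S1 d1 \<rho>1 where 1: "\<Omega>1 \<in> conic_nhds z0" "S1 \<in> sectors" "0 < d1" "0 < \<rho>1" "\<rho>1 < 1"
    and s: "cl.symbol_at \<Omega>1 S1 d1 \<rho>1 P"
    by (rule cl.total_syms_cases[OF P P])
  obtain \<Omega>2 S2 d2 \<rho>2 where 2: "\<Omega>2 \<in> conic_nhds z0" "S2 \<in> sectors" "0 < d2" "0 < \<rho>2" "\<rho>2 < 1"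
    "formal.null_at \<Omega>2 S2 d2 \<rho>2 Q"
    "\<forall>\<nu>. \<forall>p\<in>dom_star \<Omega>2 S2 d2 \<rho>2 (\<nu> + 1). fps_nth P \<nu> p = fps_nth Q \<nu> p"
    by (rule formal_null_agree[OF Q eq])
  obtain d \<rho> where c: "0 < d" "0 < \<rho>" "\<rho> < 1" "d1 \<le> d" "d2 \<le> d" "\<rho> \<le> \<rho>1" "\<rho> \<le> \<rho>2"
    using common_params[OF 1(3) 2(3) 1(4,5) 2(4,5)] by blast
  let ?\<Omega> = "\<Omega>1 \<inter> \<Omega>2" and ?S = "S1 \<inter> S2"
  have S: "?S \<in> sectors" by (rule sectors_Int[OF 1(2) 2(2)])
  have "\<exists>d'\<ge>d. cl.null_at ?\<Omega> ?S d' \<rho> P"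
  proof (rule cl_symbol_formally_null[OF S c(1-3)])
    show "cl.symbol_at ?\<Omega> ?S d \<rho> P" by (rule cl.symbol_at_mono[OF Int_lower1 Int_lower1 1(3) c(4,6)
      1(5) s])
    show "formal.null_at ?\<Omega> ?S d \<rho> Q" by (rule formal.null_at_mono[OF Int_lower2 Int_lower2 2(3)
      c(5,7) 2(5,6)])
    fix \<nu> p assume p: "p \<in> dom_star ?\<Omega> ?S d \<rho> (\<nu> + 1)"
    have "dom_star ?\<Omega> ?S d \<rho> (\<nu> + 1) \<subseteq> dom_star \<Omega>2 S2 d2 \<rho>2 (\<nu> + 1)" using c 2(1-5) by (intro
      dom_star_mono) auto
    then show "fps_nth P \<nu> p = fps_nth Q \<nu> p" using 2(7) p by blast
  qed
  then obtain d' where d': "d \<le> d' \<and> cl.null_at ?\<Omega> ?S d' \<rho> P" by (rule exE)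
  have "0 < d'" using d' c(1) by linarith
  then show ?thesis by (rule cl.total_nullsI[OF conic_nhds_Int[OF 1(1) 2(1)] S _ c(2,3) conjunct2[OF d']])
qed

section \<open>Modules of germs and their quotients\<close>

lemma cring_complex_ring: "cring complex_ring"
proof (rule cringI)
  show "abelian_group complex_ring"
    by (rule abelian_groupI) (auto simp: complex_ring_def intro: exI[of _ "- _"] add.left_inverse)
  show "comm_monoid complex_ring"
    by (rule comm_monoidI) (auto simp: complex_ring_def)
qed (auto simp: complex_ring_def algebra_simps)

text \<open>A linear map that reflects the submodules and is onto modulo the target submodule induces an
  isomorphism of the quotients.\<close>

lemma quotient_iso:
  fixes R (structure) and M (structure) and M' (structure)
  assumes M: "module R M" and M': "module R M'" and N: "submodule N R M" and N': "submodule N' R M'"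
    and f: "f \<in> linear_maps R M M'" and fN: "f ` N \<subseteq> N'"
    and refl: "\<And>x. x \<in> carrier M \<Longrightarrow> f x \<in> N' \<Longrightarrow> x \<in> N"
    and surj: "\<And>y. y \<in> carrier M' \<Longrightarrow> \<exists>x\<in>carrier M. \<exists>k\<in>N'. y = k \<oplus>\<^bsub>M'\<^esub> f x"
  shows "induced_map M' N' f \<in> linear_isos R (quotient_module M N) (quotient_module M' N')"
proof -
  interpret M: module R M by (rule M)
  interpret M': module R M' by (rule M')
  have sN: "subgroup N (add_monoid M)" and sN': "subgroup N' (add_monoid M')"
    using N N' by (auto simp: submodule_def)
  interpret A: abelian_subgroup N M
    by (rule abelian_subgroupI3[OF additive_subgroup.intro[OF sN] M.abelian_group_axioms])
  interpret A': abelian_subgroup N' M'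
    by (rule abelian_subgroupI3[OF additive_subgroup.intro[OF sN'] M'.abelian_group_axioms])
  have f_hom: "f \<in> hom (add_monoid M) (add_monoid M')"
    and f_smult: "\<And>a x. a \<in> carrier R \<Longrightarrow> x \<in> carrier M \<Longrightarrow> f (a \<odot>\<^bsub>M\<^esub> x) = a \<odot>\<^bsub>M'\<^esub> f x"
    using f by (auto simp: linear_maps_def)
  interpret F: abelian_group_hom M M' f
    by (rule abelian_group_homI[OF M.abelian_group_axioms M'.abelian_group_axioms])
       (simp add: group_hom_def group_hom_axioms_def f_hom M.a_group M'.a_group)
  have smN: "\<And>a x. a \<in> carrier R \<Longrightarrow> x \<in> N \<Longrightarrow> a \<odot>\<^bsub>M\<^esub> x \<in> N"
    and smN': "\<And>a x. a \<in> carrier R \<Longrightarrow> x \<in> N' \<Longrightarrow> a \<odot>\<^bsub>M'\<^esub> x \<in> N'"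
    using N N' by (auto simp: submodule_def submodule_axioms_def)
  have coset_eq: "N +>\<^bsub>M\<^esub> (n \<oplus>\<^bsub>M\<^esub> x) = N +>\<^bsub>M\<^esub> x" if "n \<in> N" "x \<in> carrier M" for n x
    using A.a_repr_independence'[of "n \<oplus>\<^bsub>M\<^esub> x" x] that by (auto simp: a_r_coset_def')
  have coset_eq': "N' +>\<^bsub>M'\<^esub> (n \<oplus>\<^bsub>M'\<^esub> x) = N' +>\<^bsub>M'\<^esub> x" if "n \<in> N'" "x \<in> carrier M'" for n x
    using A'.a_repr_independence'[of "n \<oplus>\<^bsub>M'\<^esub> x" x] that by (auto simp: a_r_coset_def')
  have coset_elem: "\<exists>n\<in>N. y = n \<oplus>\<^bsub>M\<^esub> x" if "y \<in> N +>\<^bsub>M\<^esub> x" for x y using that by (auto simp: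
    a_r_coset_def')
  have coset_elem': "\<exists>n\<in>N'. y = n \<oplus>\<^bsub>M'\<^esub> x" if "y \<in> N' +>\<^bsub>M'\<^esub> x" for x y using that by (auto simp:
    a_r_coset_def')
  have ind: "induced_map M' N' f (N +>\<^bsub>M\<^esub> x) = N' +>\<^bsub>M'\<^esub> f x" if x: "x \<in> carrier M" for x
  proof -
    have "N' +>\<^bsub>M'\<^esub> f y = N' +>\<^bsub>M'\<^esub> f x" if mem: "y \<in> N +>\<^bsub>M\<^esub> x" for y
    proof -
      obtain n where n: "n \<in> N" "y = n \<oplus>\<^bsub>M\<^esub> x" using coset_elem[OF mem] by blast
      have "f y = f n \<oplus>\<^bsub>M'\<^esub> f x" using n x by simp
      then show ?thesis using coset_eq'[of "f n" "f x"] n fN x by auto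
    qed
    moreover have "x \<in> N +>\<^bsub>M\<^esub> x" by (rule A.a_rcos_self[OF x])
    ultimately show ?thesis unfolding induced_map_def by blast
  qed
  have sm: "smult (quotient_module M N) a (N +>\<^bsub>M\<^esub> x) = N +>\<^bsub>M\<^esub> (a \<odot>\<^bsub>M\<^esub> x)"
    if a: "a \<in> carrier R" and x: "x \<in> carrier M" for a x
  proof -
    have "N +>\<^bsub>M\<^esub> (a \<odot>\<^bsub>M\<^esub> y) = N +>\<^bsub>M\<^esub> (a \<odot>\<^bsub>M\<^esub> x)" if mem: "y \<in> N +>\<^bsub>M\<^esub> x" for y
    proof -
      obtain n where n: "n \<in> N" "y = n \<oplus>\<^bsub>M\<^esub> x" using coset_elem[OF mem] by blast
      have "a \<odot>\<^bsub>M\<^esub> y = a \<odot>\<^bsub>M\<^esub> n \<oplus>\<^bsub>M\<^esub> a \<odot>\<^bsub>M\<^esub> x" using n x a by (simp add: M.smult_r_distr)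
      then show ?thesis using coset_eq[OF smN[OF a n(1)], of "a \<odot>\<^bsub>M\<^esub> x"] a x by simp
    qed
    moreover have "x \<in> N +>\<^bsub>M\<^esub> x" by (rule A.a_rcos_self[OF x])
    ultimately show ?thesis unfolding quotient_module_def module.simps by blast
  qed
  have sm': "smult (quotient_module M' N') a (N' +>\<^bsub>M'\<^esub> x) = N' +>\<^bsub>M'\<^esub> (a \<odot>\<^bsub>M'\<^esub> x)"
    if a: "a \<in> carrier R" and x: "x \<in> carrier M'" for a x
  proof -
    have "N' +>\<^bsub>M'\<^esub> (a \<odot>\<^bsub>M'\<^esub> y) = N' +>\<^bsub>M'\<^esub> (a \<odot>\<^bsub>M'\<^esub> x)" if mem: "y \<in> N' +>\<^bsub>M'\<^esub> x" for y
    proof -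
      obtain n where n: "n \<in> N'" "y = n \<oplus>\<^bsub>M'\<^esub> x" using coset_elem'[OF mem] by blast
      have "a \<odot>\<^bsub>M'\<^esub> y = a \<odot>\<^bsub>M'\<^esub> n \<oplus>\<^bsub>M'\<^esub> a \<odot>\<^bsub>M'\<^esub> x" using n x a by (simp add: M'.smult_r_distr)
      then show ?thesis using coset_eq'[OF smN'[OF a n(1)], of "a \<odot>\<^bsub>M'\<^esub> x"] a x by simp
    qed
    moreover have "x \<in> N' +>\<^bsub>M'\<^esub> x" by (rule A'.a_rcos_self[OF x])
    ultimately show ?thesis unfolding quotient_module_def module.simps by blast
  qed
  have car: "carrier (quotient_module M N) = (\<lambda>x. N +>\<^bsub>M\<^esub> x) ` carrier M"
    by (auto simp: quotient_module_def A_RCOSETS_def')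
  have car': "carrier (quotient_module M' N') = (\<lambda>x. N' +>\<^bsub>M'\<^esub> x) ` carrier M'"
    by (auto simp: quotient_module_def A_RCOSETS_def')
  have f_car: "f x \<in> carrier M'" if "x \<in> carrier M" for x using that by simp
  have "induced_map M' N' f \<in> linear_maps R (quotient_module M N) (quotient_module M' N')"
    unfolding linear_maps_def
  proof (intro CollectI conjI homI ballI)
    fix X assume "X \<in> carrier (add_monoid (quotient_module M N))"
    then obtain x where x: "x \<in> carrier M" "X = N +>\<^bsub>M\<^esub> x" using car by auto
    then show "induced_map M' N' f X \<in> carrier (add_monoid (quotient_module M' N'))"
      using car' f_car ind by auto
    fix Y assume "Y \<in> carrier (add_monoid (quotient_module M N))"
    then obtain y where y: "y \<in> carrier M" "Y = N +>\<^bsub>M\<^esub> y" using car by auto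
    have "X \<otimes>\<^bsub>add_monoid (quotient_module M N)\<^esub> Y = N +>\<^bsub>M\<^esub> (x \<oplus>\<^bsub>M\<^esub> y)"
      using A.a_rcos_sum[OF x(1) y(1)] x y by (simp add: quotient_module_def)
    moreover have "induced_map M' N' f X \<otimes>\<^bsub>add_monoid (quotient_module M' N')\<^esub> induced_map M' N' f Y
        = N' +>\<^bsub>M'\<^esub> (f x \<oplus>\<^bsub>M'\<^esub> f y)"
      using A'.a_rcos_sum[OF f_car[OF x(1)] f_car[OF y(1)]] x y ind by (simp add: quotient_module_def)
    ultimately show "induced_map M' N' f (X \<otimes>\<^bsub>add_monoid (quotient_module M N)\<^esub> Y)
        = induced_map M' N' f X \<otimes>\<^bsub>add_monoid (quotient_module M' N')\<^esub> induced_map M' N' f Y"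
      using x y ind[of "x \<oplus>\<^bsub>M\<^esub> y"] by simp
  next
    fix a X assume a: "a \<in> carrier R" and "X \<in> carrier (quotient_module M N)"
    then obtain x where x: "x \<in> carrier M" "X = N +>\<^bsub>M\<^esub> x" using car by auto
    show "induced_map M' N' f (a \<odot>\<^bsub>quotient_module M N\<^esub> X) =
      a \<odot>\<^bsub>quotient_module M' N'\<^esub> induced_map M' N' f X"
      unfolding x(2) sm[OF a x(1)] ind[OF x(1)] sm'[OF a f_car[OF x(1)]]
      using ind[of "a \<odot>\<^bsub>M\<^esub> x"] f_smult a x by simp
  qed
  moreover have "bij_betw (induced_map M' N' f) (carrier (quotient_module M N)) (carrier
    (quotient_module M' N'))"
    unfolding bij_betw_def
  proof (rule conjI[OF inj_onI], goal_cases)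
    case (1 X Y)
    then have "X \<in> carrier (quotient_module M N)" "Y \<in> carrier (quotient_module M N)"
      and eq: "induced_map M' N' f X = induced_map M' N' f Y" by auto
    then obtain x y where x: "x \<in> carrier M" "X = N +>\<^bsub>M\<^esub> x" and y: "y \<in> carrier M" "Y = N +>\<^bsub>M\<^esub> y"
      using car by auto
    have "f x \<in> N' +>\<^bsub>M'\<^esub> f y" using eq A'.a_rcos_self[OF f_car[OF x(1)]] x y ind by simp
    then obtain n where n: "n \<in> N'" "f x = n \<oplus>\<^bsub>M'\<^esub> f y" using coset_elem' by blast
    have nc: "n \<in> carrier M'" using n(1) A'.a_Hcarr by blast
    have "f (x \<ominus>\<^bsub>M\<^esub> y) = f x \<ominus>\<^bsub>M'\<^esub> f y" using x y by (simp add: a_minus_def)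
    also have "\<dots> = n" using n nc f_car[OF y(1)] by (simp add: a_minus_def M'.a_assoc M'.r_neg)
    finally have "f (x \<ominus>\<^bsub>M\<^esub> y) \<in> N'" using n by simp
    then have "x \<ominus>\<^bsub>M\<^esub> y \<in> N" using x y by (intro refl) simp_all
    from coset_eq[OF this y(1)] have "N +>\<^bsub>M\<^esub> (x \<ominus>\<^bsub>M\<^esub> y \<oplus>\<^bsub>M\<^esub> y) = Y" by (simp add: y)
    moreover have "x \<ominus>\<^bsub>M\<^esub> y \<oplus>\<^bsub>M\<^esub> y = x" using x y by (simp add: a_minus_def M.a_assoc M.l_neg)
    ultimately show "X = Y" by (simp add: x)
  next
    case 2
    show ?case
    proof (rule equalityI; rule subsetI)
      fix Y assume "Y \<in> induced_map M' N' f ` carrier (quotient_module M N)"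
      then show "Y \<in> carrier (quotient_module M' N')" using car car' ind f_car by auto
    next
      fix Y assume "Y \<in> carrier (quotient_module M' N')"
      then obtain y where y: "y \<in> carrier M'" "Y = N' +>\<^bsub>M'\<^esub> y" using car' by auto
      obtain x k where x: "x \<in> carrier M" "k \<in> N'" "y = k \<oplus>\<^bsub>M'\<^esub> f x" using surj[OF y(1)] by blast
      have "Y = N' +>\<^bsub>M'\<^esub> f x" using coset_eq'[OF x(2) f_car[OF x(1)]] x y by simp
      then have "Y = induced_map M' N' f (N +>\<^bsub>M\<^esub> x)" using ind[OF x(1)] by simp
      then show "Y \<in> induced_map M' N' f ` carrier (quotient_module M N)" using car x(1) by blast
    qed
  qed
  ultimately show ?thesis by (simp add: linear_isos_def)
qed

text \<open>A space \<open>F\<close> of representatives with a subspace \<open>N\<close> and a congruence \<open>E\<close>, the equality of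
  germs. The congruence lives on the whole type, so the operations on germs are computed on
  arbitrary representatives.\<close>

locale germ_space =
  fixes E :: "'f::ab_group_add \<Rightarrow> 'f \<Rightarrow> bool" and sc :: "complex \<Rightarrow> 'f \<Rightarrow> 'f" and F N :: "'f set"
  assumes E_refl: "E x x" and E_sym: "E x y \<Longrightarrow> E y x" and E_trans: "E x y \<Longrightarrow> E y z \<Longrightarrow> E x z"
    and E_add: "E x x' \<Longrightarrow> E y y' \<Longrightarrow> E (x + y) (x' + y')" and E_sc: "E x x' \<Longrightarrow> E (sc c x) (sc c x')"
    and sc_add_left: "sc (a + b) x = sc a x + sc b x" and sc_add_right: "sc a (x + y) = sc a x + sc a y"
    and sc_mult: "sc (a * b) x = sc a (sc b x)" and sc_one: "sc 1 x = x"
    and F_add: "x \<in> F \<Longrightarrow> y \<in> F \<Longrightarrow> x + y \<in> F" and F_sc: "x \<in> F \<Longrightarrow> sc a x \<in> F"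
    and N_add: "x \<in> N \<Longrightarrow> y \<in> N \<Longrightarrow> x + y \<in> N" and N_sc: "x \<in> N \<Longrightarrow> sc a x \<in> N"
    and N_zero: "0 \<in> N" and N_F: "N \<subseteq> F"
begin

abbreviation "GM \<equiv> germ_module E sc (germ E ` F)"

lemma germ_eq_iff: "germ E x = germ E y \<longleftrightarrow> E x y"
  unfolding germ_def using E_refl E_sym E_trans by blast

lemma germ_UN: "(\<And>y. E x y \<Longrightarrow> g y = g x) \<Longrightarrow> (\<Union>y\<in>germ E x. g y) = g x"
  unfolding germ_def using E_refl by blast

lemma add_germ: "germ E x \<oplus>\<^bsub>GM\<^esub> germ E y = germ E (x + y)"
proof -
  have "(\<Union>Q\<in>germ E y. germ E (P + Q)) = germ E (P + y)" for P
    by (rule germ_UN) (auto simp: germ_eq_iff intro: E_add E_refl E_sym)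
  then have "germ E x \<oplus>\<^bsub>GM\<^esub> germ E y = (\<Union>P\<in>germ E x. germ E (P + y))"
    by (simp add: germ_module_def)
  also have "\<dots> = germ E (x + y)"
    by (rule germ_UN) (auto simp: germ_eq_iff intro: E_add E_refl E_sym)
  finally show ?thesis .
qed

lemma smult_germ: "a \<odot>\<^bsub>GM\<^esub> germ E x = germ E (sc a x)"
  unfolding germ_module_def module.simps
  by (rule germ_UN) (auto simp: germ_eq_iff intro: E_sc E_sym)

lemma carrier_GM: "carrier GM = germ E ` F"
  by (simp add: germ_module_def)

lemma zero_GM: "\<zero>\<^bsub>GM\<^esub> = germ E 0"
  by (simp add: germ_module_def)

lemma sc_zero: "sc 0 x = 0"
  using sc_add_left[of 0 0 x] by simp

lemma sc_minus: "sc (-1) x + x = 0"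
  using sc_add_left[of "-1" 1 x] sc_zero sc_one by simp

lemma abelian_group_GM: "abelian_group GM"
proof (rule abelian_groupI)
  fix X Y Z assume "X \<in> carrier GM" "Y \<in> carrier GM" "Z \<in> carrier GM"
  then obtain x y z where xyz: "x \<in> F" "X = germ E x" "y \<in> F" "Y = germ E y" "z \<in> F" "Z = germ E z"
    by (auto simp: carrier_GM)
  show "X \<oplus>\<^bsub>GM\<^esub> Y \<oplus>\<^bsub>GM\<^esub> Z = X \<oplus>\<^bsub>GM\<^esub> (Y \<oplus>\<^bsub>GM\<^esub> Z)"
    by (simp add: xyz add_germ add.assoc)
next
  fix X Y assume "X \<in> carrier GM" "Y \<in> carrier GM"
  then obtain x y where xy: "x \<in> F" "X = germ E x" "y \<in> F" "Y = germ E y" by (auto simp: carrier_GM)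
  show "X \<oplus>\<^bsub>GM\<^esub> Y \<in> carrier GM" using xy F_add by (simp add: add_germ carrier_GM)
  show "X \<oplus>\<^bsub>GM\<^esub> Y = Y \<oplus>\<^bsub>GM\<^esub> X" using xy by (simp add: add_germ add.commute)
next
  show "\<zero>\<^bsub>GM\<^esub> \<in> carrier GM" using N_zero N_F by (auto simp: zero_GM carrier_GM)
next
  fix X assume "X \<in> carrier GM"
  then obtain x where x: "x \<in> F" "X = germ E x" by (auto simp: carrier_GM)
  show "\<zero>\<^bsub>GM\<^esub> \<oplus>\<^bsub>GM\<^esub> X = X" by (simp add: x zero_GM add_germ)
  show "\<exists>Y\<in>carrier GM. Y \<oplus>\<^bsub>GM\<^esub> X = \<zero>\<^bsub>GM\<^esub>"
    by (rule bexI[of _ "germ E (sc (-1) x)"]) (simp_all add: x add_germ sc_minus zero_GM carrier_GM F_sc)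
qed

lemma module_GM: "module complex_ring GM"
proof (rule moduleI[OF cring_complex_ring abelian_group_GM])
  fix a X assume "X \<in> carrier GM"
  then obtain x where x: "x \<in> F" "X = germ E x" by (auto simp: carrier_GM)
  show "a \<odot>\<^bsub>GM\<^esub> X \<in> carrier GM" using x F_sc by (simp add: smult_germ carrier_GM)
  show "\<one>\<^bsub>complex_ring\<^esub> \<odot>\<^bsub>GM\<^esub> X = X" by (simp add: x smult_germ complex_ring_def sc_one)
  fix b
  show "(a \<oplus>\<^bsub>complex_ring\<^esub> b) \<odot>\<^bsub>GM\<^esub> X = a \<odot>\<^bsub>GM\<^esub> X \<oplus>\<^bsub>GM\<^esub> b \<odot>\<^bsub>GM\<^esub> X"
    by (simp add: x smult_germ add_germ complex_ring_def sc_add_left)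
  show "(a \<otimes>\<^bsub>complex_ring\<^esub> b) \<odot>\<^bsub>GM\<^esub> X = a \<odot>\<^bsub>GM\<^esub> (b \<odot>\<^bsub>GM\<^esub> X)"
    by (simp add: x smult_germ complex_ring_def sc_mult)
next
  fix a X Y assume "X \<in> carrier GM" "Y \<in> carrier GM"
  then obtain x y where xy: "x \<in> F" "X = germ E x" "y \<in> F" "Y = germ E y" by (auto simp: carrier_GM)
  show "a \<odot>\<^bsub>GM\<^esub> (X \<oplus>\<^bsub>GM\<^esub> Y) = a \<odot>\<^bsub>GM\<^esub> X \<oplus>\<^bsub>GM\<^esub> a \<odot>\<^bsub>GM\<^esub> Y"
    by (simp add: xy smult_germ add_germ sc_add_right)
qed

lemma submodule_GM: "submodule (germ E ` N) complex_ring GM"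
proof (rule module.submoduleI[OF module_GM])
  interpret abelian_group GM by (rule abelian_group_GM)
  show "germ E ` N \<subseteq> carrier GM" using N_F by (auto simp: carrier_GM)
  show "\<zero>\<^bsub>GM\<^esub> \<in> germ E ` N" using N_zero by (auto simp: zero_GM)
  fix X assume "X \<in> germ E ` N"
  then obtain x where x: "x \<in> N" "X = germ E x" by auto
  have "\<ominus>\<^bsub>GM\<^esub> X = germ E (sc (-1) x)"
    using x N_F by (intro minus_equality) (auto simp: add_germ sc_minus zero_GM carrier_GM F_sc)
  then show "\<ominus>\<^bsub>GM\<^esub> X \<in> germ E ` N" using x N_sc by simp
  show "a \<odot>\<^bsub>GM\<^esub> X \<in> germ E ` N" for a using x N_sc by (simp add: smult_germ)
  fix Y assume "Y \<in> germ E ` N"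
  then show "X \<oplus>\<^bsub>GM\<^esub> Y \<in> germ E ` N" using x N_add by (auto simp: add_germ)
qed

end

text \<open>The assumptions \<open>refl\<close> and \<open>surj\<close> are the two facts on representatives that make the map of
  quotients injective and surjective.\<close>

lemma germ_inclusion:
  assumes A: "germ_space E sc F N" and B: "germ_space E' sc' F' N'"
    and add: "\<And>x y. \<phi> (x + y) = \<phi> x + \<phi> y" and scale: "\<And>a x. \<phi> (sc a x) = sc' a (\<phi> x)"
    and cong: "\<And>x y. E x y \<Longrightarrow> E' (\<phi> x) (\<phi> y)"
    and F: "\<And>x. x \<in> F \<Longrightarrow> \<phi> x \<in> F'" and N: "\<And>x. x \<in> N \<Longrightarrow> \<phi> x \<in> N'"
    and inj: "\<And>x y. x \<in> F \<Longrightarrow> y \<in> F \<Longrightarrow> E' (\<phi> x) (\<phi> y) \<Longrightarrow> E x y"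
    and refl: "\<And>x k. x \<in> F \<Longrightarrow> k \<in> N' \<Longrightarrow> E' (\<phi> x) k \<Longrightarrow> x \<in> N"
    and surj: "\<And>y. y \<in> F' \<Longrightarrow> \<exists>x\<in>F. y - \<phi> x \<in> N'"
  defines "M \<equiv> germ_module E sc (germ E ` F)" and "M' \<equiv> germ_module E' sc' (germ E' ` F')"
  shows "germ_map E' \<phi> \<in> linear_maps complex_ring M M'"
    and "inj_on (germ_map E' \<phi>) (carrier M)"
    and "germ_map E' \<phi> ` (germ E ` N) \<subseteq> germ E' ` N'"
    and "induced_map M' (germ E' ` N') (germ_map E' \<phi>)
       \<in> linear_isos complex_ring (quotient_module M (germ E ` N)) (quotient_module M' (germ E' ` N'))"
proof -
  interpret A: germ_space E sc F N by (rule A)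
  interpret B: germ_space E' sc' F' N' by (rule B)
  have map: "germ_map E' \<phi> (germ E x) = germ E' (\<phi> x)" for x
    unfolding germ_map_def by (rule A.germ_UN) (auto simp: B.germ_eq_iff intro: cong A.E_sym)
  show lin: "germ_map E' \<phi> \<in> linear_maps complex_ring M M'"
    unfolding linear_maps_def M_def M'_def
  proof (intro CollectI conjI homI ballI)
    fix X assume "X \<in> carrier (add_monoid A.GM)"
    then obtain x where x: "x \<in> F" "X = germ E x" by (auto simp: A.carrier_GM)
    then show "germ_map E' \<phi> X \<in> carrier (add_monoid B.GM)" using F by (simp add: map B.carrier_GM)
    fix Y assume "Y \<in> carrier (add_monoid A.GM)"
    then obtain y where y: "y \<in> F" "Y = germ E y" by (auto simp: A.carrier_GM)
    show "germ_map E' \<phi> (X \<otimes>\<^bsub>add_monoid A.GM\<^esub> Y) = germ_map E' \<phi> X \<otimes>\<^bsub>add_monoid B.GM\<^esub> germ_map E' \<phi> Y"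
      by (simp add: x y A.add_germ B.add_germ map add)
  next
    fix a X assume "X \<in> carrier A.GM"
    then obtain x where x: "x \<in> F" "X = germ E x" by (auto simp: A.carrier_GM)
    show "germ_map E' \<phi> (a \<odot>\<^bsub>A.GM\<^esub> X) = a \<odot>\<^bsub>B.GM\<^esub> germ_map E' \<phi> X"
      by (simp add: x A.smult_germ B.smult_germ map scale)
  qed
  show "inj_on (germ_map E' \<phi>) (carrier M)"
    unfolding M_def A.carrier_GM using inj by (auto simp: inj_on_def map A.germ_eq_iff B.germ_eq_iff)
  show N_sub: "germ_map E' \<phi> ` (germ E ` N) \<subseteq> germ E' ` N'"
    using N by (auto simp: map)
  show "induced_map M' (germ E' ` N') (germ_map E' \<phi>)
       \<in> linear_isos complex_ring (quotient_module M (germ E ` N)) (quotient_module M' (germ E' ` N'))"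
  proof (rule quotient_iso[OF _ _ _ _ lin N_sub])
    show "module complex_ring M" "module complex_ring M'" "submodule (germ E ` N) complex_ring M"
      "submodule (germ E' ` N') complex_ring M'"
      unfolding M_def M'_def by (fact A.module_GM B.module_GM A.submodule_GM B.submodule_GM)+
  next
    fix X assume "X \<in> carrier M" and mem: "germ_map E' \<phi> X \<in> germ E' ` N'"
    then obtain x where x: "x \<in> F" "X = germ E x" by (auto simp: M_def A.carrier_GM)
    from mem obtain k where "k \<in> N'" "E' (\<phi> x) k" by (auto simp: x map B.germ_eq_iff)
    then show "X \<in> germ E ` N" using refl x by blast
  next
    fix Y assume "Y \<in> carrier M'"
    then obtain y where y: "y \<in> F'" "Y = germ E' y" by (auto simp: M'_def B.carrier_GM)
    obtain x where x: "x \<in> F" "y - \<phi> x \<in> N'" using surj[OF y(1)] by blast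
    have "Y = germ E' (y - \<phi> x) \<oplus>\<^bsub>M'\<^esub> germ_map E' \<phi> (germ E x)"
      by (simp add: M'_def map B.add_germ y)
    then show "\<exists>X\<in>carrier M. \<exists>K\<in>germ E' ` N'. Y = K \<oplus>\<^bsub>M'\<^esub> germ_map E' \<phi> X"
      using x by (auto simp: M_def A.carrier_GM)
  qed
qed

section \<open>The isomorphisms of quotients\<close>

lemma series_scale_laws:
  "series_scale (a + b) P = series_scale a P + series_scale b P"
  "series_scale a (P + Q) = series_scale a P + series_scale a Q"
  "series_scale (a * b) P = series_scale a (series_scale b P)"
  "series_scale 1 P = P"
  by (rule fps_ext, simp add: fun_eq_iff algebra_simps)+

lemma symb_scale_laws:
  "symb_scale (a + b) p = symb_scale a p + symb_scale b p"
  "symb_scale a (p + q) = symb_scale a p + symb_scale a q"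
  "symb_scale (a * b) p = symb_scale a (symb_scale b p)"
  "symb_scale 1 p = p"
  by (simp_all add: symb_scale_def fun_eq_iff algebra_simps)

lemma fps_const_laws:
  "fps_const (p + q) = fps_const p + (fps_const q :: 'n series)"
  "fps_const (symb_scale c p) = series_scale c (fps_const p)"
  by (rule fps_ext, simp add: fun_eq_iff symb_scale_def)+

lemma germ_space_series:
  assumes "conic_nhds z0 \<noteq> {}"
  shows "germ_space (cl_germ_eq z0) series_scale (total_at z0 cl_symbols) (total_at z0 cl_null_symbols)"
    and "germ_space (formal_germ_eq z0) series_scale (total_at z0 formal_symbols) (total_at z0
      formal_null_symbols)"
  unfolding cl_geq_eq[symmetric] cl_syms_eq[symmetric] cl_nulls_eq[symmetric]
    formal_geq_eq[symmetric] formal_syms_eq[symmetric] formal_nulls_eq[symmetric]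
  by (rule germ_space.intro; fact cl.geq_refl[OF assms] cl.geq_sym cl.geq_trans cl.geq_add cl.geq_scale
      formal.geq_refl[OF assms] formal.geq_sym formal.geq_trans formal.geq_add formal.geq_scale
        series_scale_laws
      cl.total_syms_add cl.total_syms_scale cl.total_nulls_add cl.total_nulls_scale
        cl.total_nulls_zero[OF assms] cl.total_nulls_subset
      formal.total_syms_add formal.total_syms_scale formal.total_nulls_add formal.total_nulls_scale
      formal.total_nulls_zero[OF assms] formal.total_nulls_subset)+

lemma total_symbols_iff: "p \<in> total_at z0 symbols \<longleftrightarrow> fps_const p \<in> total_at z0 fn.syms"
  "p \<in> total_at z0 null_symbols \<longleftrightarrow> fps_const p \<in> total_at z0 fn.nulls"
  by (simp_all add: total_at_def fn_syms_iff fn_nulls_iff)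

lemma germ_space_symbols:
  assumes "conic_nhds z0 \<noteq> {}"
  shows "germ_space (symb_germ_eq z0) symb_scale (total_at z0 symbols) (total_at z0 null_symbols)"
proof (rule germ_space.intro, unfold symb_germ_eq_iff total_symbols_iff fps_const_laws)
  show "total_at z0 null_symbols \<subseteq> total_at z0 symbols"
    using fn.total_nulls_subset[of z0] by (auto simp: total_symbols_iff)
  show "fps_const 0 \<in> total_at z0 fn.nulls"
    using fn.total_nulls_zero[OF assms] by simp
qed (fact cl.geq_refl[OF assms] cl.geq_sym cl.geq_trans cl.geq_add cl.geq_scale symb_scale_laws
    fn.total_syms_add fn.total_syms_scale fn.total_nulls_add fn.total_nulls_scale)+

lemma germs_at_total: "germs_at z0 E F = germ E ` total_at z0 F"
  by (simp add: germs_at_def total_at_def)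

lemma formal_germ_class_has_symbol:
  assumes "snd z0 \<noteq> 0" "P \<in> total_at z0 formal.syms"
  shows "\<exists>q. q \<in> total_at z0 symbols \<and> P - fps_const q \<in> total_at z0 formal.nulls"
  by (rule formal_symbol_resummed[OF assms]) (auto simp: total_symbols_iff)

theorem theorem7p10:
  fixes z0 :: "(complex^'n::finite) \<times> (complex^'n)"
  assumes "snd z0 \<noteq> 0"
  shows
    "module complex_ring (Symb z0) \<and> submodule (Null z0) complex_ring (Symb z0) \<and>
     module complex_ring (Symb_cl z0) \<and> submodule (Null_cl z0) complex_ring (Symb_cl z0) \<and>
     module complex_ring (Symb_formal z0) \<and> submodule (Null_formal z0) complex_ring (Symb_formal z0) \<and>
     incl_cl z0 \<in> linear_maps complex_ring (Symb z0) (Symb_cl z0) \<and>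
     inj_on (incl_cl z0) (carrier (Symb z0)) \<and>
     incl_cl z0 ` Null z0 \<subseteq> Null_cl z0 \<and>
     incl_formal z0 \<in> linear_maps complex_ring (Symb_cl z0) (Symb_formal z0) \<and>
     inj_on (incl_formal z0) (carrier (Symb_cl z0)) \<and>
     incl_formal z0 ` Null_cl z0 \<subseteq> Null_formal z0 \<and>
     induced_map (Symb_cl z0) (Null_cl z0) (incl_cl z0)
       \<in> linear_isos complex_ring
           (quotient_module (Symb z0) (Null z0))
           (quotient_module (Symb_cl z0) (Null_cl z0)) \<and>
     induced_map (Symb_formal z0) (Null_formal z0) (incl_formal z0)
       \<in> linear_isos complex_ring
           (quotient_module (Symb_cl z0) (Null_cl z0))
           (quotient_module (Symb_formal z0) (Null_formal z0))"
proof -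
  have ne: "conic_nhds z0 \<noteq> {}" by (rule conic_nhds_nonempty[OF assms])
  note S1 = germ_space_symbols[OF ne] and S2 = germ_space_series(1)[OF ne] and S3 =
    germ_space_series(2)[OF ne]
  note I1 = germ_inclusion[OF S1 S2, where \<phi> = fps_const]
  note I2 = germ_inclusion[OF S2 S3, where \<phi> = "\<lambda>P. P"]
  have c1: "cl_germ_eq z0 (fps_const x) (fps_const y)" if "symb_germ_eq z0 x y" for x y
    using that by (simp only: symb_germ_eq_iff cl_geq_eq)
  have c1': "symb_germ_eq z0 x y" if "cl_germ_eq z0 (fps_const x) (fps_const y)" for x y
    using that by (simp only: symb_germ_eq_iff cl_geq_eq)
  have c2: "fps_const x \<in> total_at z0 cl_symbols" if "x \<in> total_at z0 symbols" for x
    using total_fn_cl_syms that by (simp only: total_symbols_iff cl_syms_eq)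
  have c3: "fps_const x \<in> total_at z0 cl_null_symbols" if "x \<in> total_at z0 null_symbols" for x
    using total_fn_cl_nulls that by (simp only: total_symbols_iff cl_nulls_eq)
  have c4: "x \<in> total_at z0 null_symbols"
    if "x \<in> total_at z0 symbols" "k \<in> total_at z0 cl_null_symbols" "cl_germ_eq z0 (fps_const x) k" for x k
  proof -
    have "formal.geq z0 (fps_const x) k" by (rule cl_geq_formal_geq) (use that(3) in \<open>simp only:
      cl_geq_eq\<close>)
    moreover have "k \<in> total_at z0 formal.nulls" by (rule total_cl_formal_nulls) (use that(2) in
      \<open>simp only: cl_nulls_eq\<close>)
    ultimately show ?thesis using total_symbol_formally_null that(1) by (simp only: total_symbols_iff)
  qed
  \<comment> \<open>The difference of a classical symbol and its resummation is a classical symbol that is formally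
    null.\<close>
  have c5: "\<exists>x\<in>total_at z0 symbols. y - fps_const x \<in> total_at z0 cl_null_symbols" if y:
    "y \<in> total_at z0 cl_symbols" for y
  proof -
    have y': "y \<in> total_at z0 cl.syms" using y by (simp only: cl_syms_eq)
    obtain q where q: "q \<in> total_at z0 symbols" "y - fps_const q \<in> total_at z0 formal.nulls"
      using formal_germ_class_has_symbol[OF assms total_cl_formal_syms[OF y']] by (elim exE conjE)
    have "fps_const q \<in> total_at z0 cl.syms" using c2[OF q(1)] by (simp only: cl_syms_eq)
    then have "y + series_scale (-1) (fps_const q) \<in> total_at z0 cl.syms"
      by (intro cl.total_syms_add y' cl.total_syms_scale)
    moreover have "y + series_scale (-1) (fps_const q) = y - fps_const q"
      by (rule fps_ext) (auto simp: fun_eq_iff)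
    ultimately have "y - fps_const q \<in> total_at z0 cl.syms" by (simp only:)
    from total_cl_symbol_formally_null[OF this q(2) formal.geq_refl[OF ne]]
    have "y - fps_const q \<in> total_at z0 cl_null_symbols" by (simp only: cl_nulls_eq)
    then show ?thesis using q(1) by (rule rev_bexI[rotated])
  qed
  have d1: "formal_germ_eq z0 x y" if "cl_germ_eq z0 x y" for x y :: "'n series"
    using cl_geq_formal_geq that by (simp only: cl_geq_eq formal_geq_eq)
  have d2: "x \<in> total_at z0 formal_symbols" if "x \<in> total_at z0 cl_symbols" for x
    using total_cl_formal_syms that by (simp only: cl_syms_eq formal_syms_eq)
  have d3: "x \<in> total_at z0 formal_null_symbols" if "x \<in> total_at z0 cl_null_symbols" for x
    using total_cl_formal_nulls that by (simp only: cl_nulls_eq formal_nulls_eq)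
  have d4: "cl_germ_eq z0 x y" if "x \<in> total_at z0 cl_symbols" "y \<in> total_at z0 cl_symbols"
    "formal_germ_eq z0 x y" for x y
    using cl_geq_if_formal_geq that by (simp only: cl_geq_eq formal_geq_eq cl_syms_eq)
  have d5: "x \<in> total_at z0 cl_null_symbols"
    if "x \<in> total_at z0 cl_symbols" "k \<in> total_at z0 formal_null_symbols" "formal_germ_eq z0 x k" for x k
    using total_cl_symbol_formally_null that by (simp only: formal_geq_eq cl_syms_eq cl_nulls_eq
      formal_nulls_eq)
  have d6: "\<exists>x\<in>total_at z0 cl_symbols. y - x \<in> total_at z0 formal_null_symbols" if y:
    "y \<in> total_at z0 formal_symbols" for y
  proof -
    have "y \<in> total_at z0 formal.syms" using y by (simp only: formal_syms_eq)
    then obtain q where q: "q \<in> total_at z0 symbols" "y - fps_const q \<in> total_at z0 formal.nulls"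
      using formal_germ_class_has_symbol[OF assms] by blast
    then show ?thesis using c2 by (intro bexI[of _ "fps_const q"]) (simp_all only: formal_nulls_eq)
  qed
  note I1' = I1[OF fps_const_laws c1 c2 c3 c1' c4 c5]
  note I2' = I2[OF refl refl d1 d2 d3 d4 d5 d6]
  note defs = Symb_def Symb_cl_def Symb_formal_def Null_def Null_cl_def Null_formal_def incl_cl_def
    incl_formal_def germs_at_total
  show ?thesis
    unfolding defs
    by (intro conjI germ_space.module_GM[OF S1] germ_space.module_GM[OF S2] germ_space.module_GM[OF S3]
        germ_space.submodule_GM[OF S1] germ_space.submodule_GM[OF S2] germ_space.submodule_GM[OF S3]
          I1' I2')
qed

end
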